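(* Let $d\ge4$ be an integer, let $\Omega\subset\mathbb{R}^d$ be an open bounded domain, let $a,b>0$ be fixed numbers, and let $h\in L^\infty(\Omega)$ be a positive function. Consider the problem $$-\left(a+b\int_\Omega|\nabla u|^2\right)\Delta u=|u|^{2^*-2}u+h(x)\ \text{ in }\Omega,\qquad u=0\ \text{ on }\partial\Omega. \qquad (\ast)$$ Then: (i) if $a^{\frac{d-4}{2}}b\ge\mathtt{L}_d$, problem $(\ast)$ has at least one weak solution in $H_0^1(\Omega)$; (ii) if $a^{\frac{d-4}{2}}b>\mathtt{C}_d$, problem $(\ast)$ has a unique weak solution in $H_0^1(\Omega)$.
   Context: Here $2^*=\frac{2d}{d-2}$; $H_0^1(\Omega)$ is the usual Sobolev space of real-valued functions with norm $\|u\|=\left(\int_\Omega|\nabla u|^2\right)^{1/2}$, and $\|u\|_q=\left(\int_\Omega|u|^q\right)^{1/q}$. The sharp Sobolev constant is $$\mathtt{S}_d=\inf_{u\in H_0^1(\Omega)\setminus\{0\}}\frac{\|u\|^2}{\|u\|_{2^*}^2},$$ which depends only on $d$. For $d>4$, $$\mathtt{L}_d=\frac{4(d-4)^{\frac{d-4}{2}}}{d^{\frac{d-2}{2}}\mathtt{S}_d^{\frac d2}},\qquad \mathtt{C}_d=\frac{2(d-4)^{\frac{d-4}{2}}(d+2)^{\frac{d-2}{2}}}{(d-2)^{d-2}\mathtt{S}_d^{\frac d2}},$$ and for $d=4$, $\mathtt{L}_4=\frac{1}{\mathtt{S}_4^2}$, $\mathtt{C}_4=\frac{3}{\mathtt{S}_4^2}$.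 A weak solution of $(\ast)$ is a function $u\in H_0^1(\Omega)$ such that $$(a+b\|u\|^2)\int_\Omega\nabla u\cdot\nabla v=\int_\Omega|u|^{2^*-2}uv+\int_\Omega h v\qquad\text{for all }v\in H_0^1(\Omega).$$ *)

theory Defs
  imports "HOL-Analysis.Analysis"
begin

subsection \<open>Test functions\<close>

definition partial_deriv :: "'n \<Rightarrow> (real^'n \<Rightarrow> real) \<Rightarrow> real^'n \<Rightarrow> real" where
  "partial_deriv i f x = frechet_derivative f (at x) (axis i 1)"

definition classical_gradient :: "(real^'n \<Rightarrow> real) \<Rightarrow> real^'n \<Rightarrow> real^'n" where
  "classical_gradient f x = (\<chi> i. partial_deriv i f x)"

text \<open>Every iterated partial derivative is Frechet differentiable at every point, hence in
  particular continuous.\<close>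

definition smooth :: "(real^'n \<Rightarrow> real) \<Rightarrow> bool" where
  "smooth f \<longleftrightarrow> (\<forall>ks x. foldr partial_deriv ks f differentiable (at x))"

definition test_functions :: "(real^'n) set \<Rightarrow> (real^'n \<Rightarrow> real) set" where
  "test_functions \<Omega> =
     {\<phi>. smooth \<phi> \<and> compact (closure {x. \<phi> x \<noteq> 0}) \<and> closure {x. \<phi> x \<noteq> 0} \<subseteq> \<Omega>}"


subsection \<open>Lebesgue spaces\<close>

text \<open>Elements of the function spaces below are represented by functions on the whole space, of
  which only the restriction to \<open>\<Omega>\<close> matters; two of them are the same element iff they agree
  almost everywhere on \<open>\<Omega>\<close>.\<close>

definition eq_ae :: "(real^'n) set \<Rightarrow> (real^'n \<Rightarrow> real) \<Rightarrow> (real^'n \<Rightarrow> real) \<Rightarrow> bool" where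
  "eq_ae \<Omega> u v \<longleftrightarrow> (AE x in lebesgue_on \<Omega>. u x = v x)"

definition L2 :: "(real^'n) set \<Rightarrow> (real^'n \<Rightarrow> 'b::euclidean_space) set" where
  "L2 \<Omega> = {f \<in> borel_measurable (lebesgue_on \<Omega>).
              integrable (lebesgue_on \<Omega>) (\<lambda>x. (norm (f x))\<^sup>2)}"

definition Linfty :: "(real^'n) set \<Rightarrow> (real^'n \<Rightarrow> real) set" where
  "Linfty \<Omega> = {f \<in> borel_measurable (lebesgue_on \<Omega>).
                  \<exists>C. AE x in lebesgue_on \<Omega>. \<bar>f x\<bar> \<le> C}"

definition Lp_norm :: "real \<Rightarrow> (real^'n) set \<Rightarrow> (real^'n \<Rightarrow> real) \<Rightarrow> real" where
  "Lp_norm q \<Omega> u = (LINT x|lebesgue_on \<Omega>. \<bar>u x\<bar> powr q) powr (1 / q)"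

definition locally_integrable ::
    "(real^'n) set \<Rightarrow> (real^'n \<Rightarrow> 'b::euclidean_space) \<Rightarrow> bool" where
  "locally_integrable \<Omega> f \<longleftrightarrow>
     (\<forall>K. compact K \<and> K \<subseteq> \<Omega> \<longrightarrow> integrable (lebesgue_on K) f)"


subsection \<open>Sobolev spaces\<close>

definition has_weak_gradient ::
    "(real^'n) set \<Rightarrow> (real^'n \<Rightarrow> real) \<Rightarrow> (real^'n \<Rightarrow> real^'n) \<Rightarrow> bool" where
  "has_weak_gradient \<Omega> u g \<longleftrightarrow>
     locally_integrable \<Omega> u \<and> locally_integrable \<Omega> g \<and>
     (\<forall>\<phi>\<in>test_functions \<Omega>.
        (LINT x|lebesgue_on \<Omega>. u x *\<^sub>R classical_gradient \<phi> x) =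
        - (LINT x|lebesgue_on \<Omega>. \<phi> x *\<^sub>R g x))"

text \<open>On an open set a weak gradient is unique up to almost everywhere equality, so the choice
  made here does not affect integrals over \<open>\<Omega>\<close>.\<close>

definition weak_gradient :: "(real^'n) set \<Rightarrow> (real^'n \<Rightarrow> real) \<Rightarrow> real^'n \<Rightarrow> real^'n" where
  "weak_gradient \<Omega> u = (SOME g. has_weak_gradient \<Omega> u g)"

definition H1 :: "(real^'n) set \<Rightarrow> (real^'n \<Rightarrow> real) set" where
  "H1 \<Omega> = {u \<in> L2 \<Omega>. \<exists>g\<in>L2 \<Omega>. has_weak_gradient \<Omega> u g}"

definition H1_norm :: "(real^'n) set \<Rightarrow> (real^'n \<Rightarrow> real) \<Rightarrow> real" where
  "H1_norm \<Omega> u = sqrt ((LINT x|lebesgue_on \<Omega>. (u x)\<^sup>2)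
                        + (LINT x|lebesgue_on \<Omega>. (norm (weak_gradient \<Omega> u x))\<^sup>2))"

text \<open>The closure of the test functions in the \<open>H1\<close> norm.\<close>

definition H10 :: "(real^'n) set \<Rightarrow> (real^'n \<Rightarrow> real) set" where
  "H10 \<Omega> = {u \<in> H1 \<Omega>. \<exists>\<phi>. (\<forall>k. \<phi> k \<in> test_functions \<Omega>) \<and>
                (\<lambda>k::nat. H1_norm \<Omega> (\<lambda>x. u x - \<phi> k x)) \<longlonglongrightarrow> 0}"

definition H10_norm :: "(real^'n) set \<Rightarrow> (real^'n \<Rightarrow> real) \<Rightarrow> real" where
  "H10_norm \<Omega> u = sqrt (LINT x|lebesgue_on \<Omega>. (norm (weak_gradient \<Omega> u x))\<^sup>2)"


subsection \<open>The constants\<close>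

definition two_star :: "nat \<Rightarrow> real" where
  "two_star d = 2 * real d / (real d - 2)"

text \<open>The infimum does not depend on the nonempty open set \<open>\<Omega>\<close>, but its definition mentions it.\<close>

definition sobolev_const :: "(real^'n) set \<Rightarrow> real" where
  "sobolev_const \<Omega> =
     Inf {(H10_norm \<Omega> u)\<^sup>2 / (Lp_norm (two_star CARD('n)) \<Omega> u)\<^sup>2 |u.
            u \<in> H10 \<Omega> \<and> \<not> eq_ae \<Omega> u (\<lambda>_. 0)}"

text \<open>The case \<open>d = 4\<close> of both constants is stated separately because \<open>0 powr 0 = 0\<close>.\<close>

definition L_const :: "nat \<Rightarrow> real \<Rightarrow> real" where
  "L_const d S =
     (if d = 4 then 1 / S\<^sup>2
      else 4 * (real d - 4) powr ((real d - 4) / 2)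
           / (real d powr ((real d - 2) / 2) * S powr (real d / 2)))"

definition C_const :: "nat \<Rightarrow> real \<Rightarrow> real" where
  "C_const d S =
     (if d = 4 then 3 / S\<^sup>2
      else 2 * (real d - 4) powr ((real d - 4) / 2) * (real d + 2) powr ((real d - 2) / 2)
           / ((real d - 2) powr (real d - 2) * S powr (real d / 2)))"


subsection \<open>Weak solutions\<close>

definition weak_solution ::
    "(real^'n) set \<Rightarrow> real \<Rightarrow> real \<Rightarrow> (real^'n \<Rightarrow> real) \<Rightarrow> (real^'n \<Rightarrow> real) \<Rightarrow> bool" where
  "weak_solution \<Omega> a b h u \<longleftrightarrow>
     u \<in> H10 \<Omega> \<and>
     (\<forall>v\<in>H10 \<Omega>.
        (a + b * (H10_norm \<Omega> u)\<^sup>2)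
          * (LINT x|lebesgue_on \<Omega>. weak_gradient \<Omega> u x \<bullet> weak_gradient \<Omega> v x) =
        (LINT x|lebesgue_on \<Omega>. \<bar>u x\<bar> powr (two_star CARD('n) - 2) * u x * v x)
          + (LINT x|lebesgue_on \<Omega>. h x * v x))"

end

theory Submission
  imports Defs "HOL-Library.Diagonal_Subsequence"
begin

text \<open>
  Weak solutions are the critical points of
  \<open>J u = a/2 \<parallel>u\<parallel>\<^sup>2 + b/4 \<parallel>u\<parallel>\<^sup>4 - 1/p \<integral>|u|\<^sup>p - \<integral>h u\<close> with \<open>p = 2d/(d - 2)\<close>. If \<open>u\<^sub>n\<close> converges weakly
  to \<open>u\<close> and \<open>t\<^sub>n = \<parallel>u\<^sub>n - u\<parallel>\<close>, the Brezis-Lieb lemma and the Sobolev inequality give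
  \<open>J u\<^sub>n \<ge> J u + (a/2 t\<^sub>n\<^sup>2 + b/4 t\<^sub>n\<^sup>4 - S powr (-p/2) / p * t\<^sub>n powr p) + o(1)\<close>. By weighted AM-GM the
  condition with \<open>L_const\<close> says exactly that the bracket is never negative, so \<open>J\<close> attains its infimum.
  The condition with \<open>C_const\<close> says that \<open>a + b t\<^sup>2 > (p - 1) S powr (-p/2) t powr (p - 2)\<close>, which makes the
  derivative of \<open>J\<close> strictly monotone along segments.

  The Sobolev inequality rests on one estimate, \<open>\<integral>|f(x+h) - f x|\<^sup>2 \<le> |h|\<^sup>2 \<integral>|\<nabla>f|\<^sup>2\<close>. Applied to truncations of
  \<open>f\<close>, it bounds the measure \<open>\<alpha> t\<close> of \<open>{|f| \<ge> t}\<close> by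
  \<open>\<alpha> t \<le> C (\<alpha> (t/2)) powr (2/d) t\<^sup>-\<^sup>2 \<integral>\<^bsub>t/2<|f|<t\<^esub> |\<nabla>f|\<^sup>2\<close>, and these bounds are summed over dyadic levels.
  The same estimate yields Rellich's theorem by averaging over cells of a grid.
\<close>

subsection \<open>Continuously differentiable functions with compact support\<close>

text \<open>The exponent \<open>p\<close> is critical: bounded sequences in \<open>H10\<close> may
  lose \<open>p\<close>-mass in a weak limit, so the energy is not weakly lower semicontinuous for
  free. The loss has to be paid for by the Kirchhoff term, which is possible for large losses
  because d \<ge> 4 means p \<le> 4; for d = 4 the two growth rates coincide.

  \<open>sobolev_const\<close> is an infimum, so its positivity is itself a claim. It amounts to the
  Sobolev inequality with some constant, whose size is irrelevant; every later estimate uses the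
  infimum itself.

  Truncations are only once continuously differentiable. The basic estimates are therefore proved
  for the class \<open>C1c\<close>, with the gradient carried along as an explicit function; test
  functions are a special case, and elements of \<open>H10\<close> are reached by approximation.

  Existence in (ii) does not rest on a comparison of the two constants: the pointwise inequality
  behind uniqueness implies the one behind existence.\<close>

definition C1c :: "('a::euclidean_space \<Rightarrow> real) \<Rightarrow> ('a \<Rightarrow> 'a) \<Rightarrow> bool" where
  "C1c f G \<longleftrightarrow> (\<forall>x. (f has_derivative (\<lambda>h. G x \<bullet> h)) (at x)) \<and> continuous_on UNIV G
     \<and> bounded {x. f x \<noteq> 0}"

lemma C1c_continuous: "C1c f G \<Longrightarrow> continuous_on UNIV f" "C1c f G \<Longrightarrow> continuous_on UNIV G"
  unfolding C1c_def
  by (auto intro!: continuous_at_imp_continuous_on intro: has_derivative_continuous)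

lemma C1c_support:
  assumes "C1c f G"
  obtains R where "R > 0" "\<And>x. norm x > R \<Longrightarrow> f x = 0" "\<And>x. norm x > R \<Longrightarrow> G x = 0"
proof -
  from assms obtain R where R: "R > 0" "\<And>x. f x \<noteq> 0 \<Longrightarrow> norm x \<le> R"
    unfolding C1c_def bounded_pos by auto
  have f0: "f x = 0" if "norm x > R" for x
    using R(2)[of x] that by (meson not_le)
  have "G x = 0" if x: "norm x > R" for x
  proof -
    have "open {x::'a. norm x > R}"
      by (intro open_Collect_less continuous_intros)
    moreover have "((\<lambda>_::'a. 0::real) has_derivative (\<lambda>h. 0)) (at x)" by simp
    ultimately have "(f has_derivative (\<lambda>h. 0)) (at x)"
      using x f0 by (intro has_derivative_transform_within_open[of "\<lambda>_. 0" _ x UNIV "{x. norm x > R}" f]) auto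
    moreover have "(f has_derivative (\<lambda>h. G x \<bullet> h)) (at x)" using assms by (simp add: C1c_def)
    ultimately have "(\<lambda>h. G x \<bullet> h) = (\<lambda>h. 0)" by (rule has_derivative_unique[rotated])
    then have "G x \<bullet> G x = 0" by (rule fun_cong)
    then show ?thesis by simp
  qed
  with R(1) f0 show ?thesis by (rule that)
qed

lemma integrable_bounded_support:
  fixes f :: "'a::euclidean_space \<Rightarrow> 'b::{banach, second_countable_topology}"
  assumes "continuous_on UNIV f" "\<And>x. norm x > R \<Longrightarrow> f x = 0"
  shows "integrable lborel f"
proof -
  have "integrable lborel (\<lambda>x. indicator (cball 0 R) x *\<^sub>R f x)"
    by (intro borel_integrable_compact compact_cball continuous_on_subset[OF assms(1)]) auto
  also have "(\<lambda>x. indicator (cball 0 R) x *\<^sub>R f x) = f"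
    using assms(2) by (auto simp: indicator_def fun_eq_iff not_le)
  finally show ?thesis .
qed

lemma C1c_integrable_square:
  assumes "C1c f G"
  shows "integrable lborel (\<lambda>x. (f x)\<^sup>2)" "integrable lborel (\<lambda>x. (norm (G x))\<^sup>2)"
proof -
  obtain R where R: "\<And>x. norm x > R \<Longrightarrow> f x = 0" "\<And>x. norm x > R \<Longrightarrow> G x = 0"
    using C1c_support[OF assms] by metis
  show "integrable lborel (\<lambda>x. (f x)\<^sup>2)"
    by (rule integrable_bounded_support[of _ R])
       (auto simp: R intro!: continuous_intros C1c_continuous[OF assms])
  show "integrable lborel (\<lambda>x. (norm (G x))\<^sup>2)"
    by (rule integrable_bounded_support[of _ R])
       (auto simp: R intro!: continuous_intros C1c_continuous[OF assms])
qed

section \<open>Translations and square integrals of increments\<close>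

lemma nn_integral_lborel_translation:
  fixes h :: "'a::euclidean_space"
  assumes [measurable]: "f \<in> borel_measurable borel"
  shows "(\<integral>\<^sup>+x. f (x + h) \<partial>lborel) = (\<integral>\<^sup>+x. f x \<partial>lborel)"
proof -
  have "(\<integral>\<^sup>+x. f x \<partial>lborel) = (\<integral>\<^sup>+x. f x \<partial>distr lborel borel ((+) h))"
    by (simp add: lborel_distr_plus)
  also have "\<dots> = (\<integral>\<^sup>+x. f (h + x) \<partial>lborel)"
    by (subst nn_integral_distr) auto
  finally show ?thesis by (simp add: add.commute)
qed

lemma integral_lborel_translation:
  fixes h :: "'a::euclidean_space" and f :: "'a \<Rightarrow> 'b::{banach, second_countable_topology}"
  assumes [measurable]: "f \<in> borel_measurable borel"
  shows "(\<integral>x. f (x + h) \<partial>lborel) = (\<integral>x. f x \<partial>lborel)"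
proof -
  have "(\<integral>x. f x \<partial>lborel) = (\<integral>x. f x \<partial>distr lborel borel ((+) h))"
    by (simp add: lborel_distr_plus)
  also have "\<dots> = (\<integral>x. f (h + x) \<partial>lborel)"
    by (subst integral_distr) auto
  finally show ?thesis by (simp add: add.commute)
qed

text \<open>The increment is the mean over [0,1] of the directional derivative along the segment,
  and the square of a mean is at most the mean of the squares.\<close>

lemma C1c_increment_square_le:
  assumes "C1c f G"
  shows "ennreal ((f (x + h) - f x)\<^sup>2)
    \<le> (\<integral>\<^sup>+t. ennreal (indicator {0..1} t * ((norm h)\<^sup>2 * (norm (G (x + t *\<^sub>R h)))\<^sup>2)) \<partial>lborel)"
proof -
  define y where "y = (\<lambda>t. G (x + t *\<^sub>R h) \<bullet> h)"
  define c where "c = f (x + h) - f x"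
  have cG: "continuous_on A (\<lambda>t. G (x + t *\<^sub>R h))" for A
    by (rule continuous_on_compose2[OF C1c_continuous(2)[OF assms]]) (auto intro!: continuous_intros)
  have cy: "continuous_on A y" for A
    unfolding y_def by (intro continuous_intros cG)
  have der: "((\<lambda>t. f (x + t *\<^sub>R h)) has_vector_derivative y t) (at t within {0..1})" for t
  proof -
    have "(f has_derivative (\<lambda>h'. G (x + t *\<^sub>R h) \<bullet> h')) (at (x + t *\<^sub>R h))"
      using assms by (simp add: C1c_def)
    then have "((\<lambda>t. f (x + t *\<^sub>R h)) has_derivative (\<lambda>s. G (x + t *\<^sub>R h) \<bullet> (0 + s *\<^sub>R h))) (at t within {0..1})"
      by (intro has_derivative_compose[of "\<lambda>t. x + t *\<^sub>R h" _ t _ f]) (auto intro!: derivative_eq_intros)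
    then show ?thesis unfolding y_def has_vector_derivative_def by (simp add: mult.commute)
  qed
  have I1: "has_bochner_integral lborel (\<lambda>t. indicator {0..1} t *\<^sub>R y t) c"
    using has_bochner_integral_FTC_Icc[of 0 1 "\<lambda>t. f (x + t *\<^sub>R h)" y] der cy
    by (simp add: c_def)
  have I2: "integrable lborel (\<lambda>t. indicator {0..1} t *\<^sub>R (y t)\<^sup>2)"
    by (intro borel_integrable_compact continuous_intros cy) auto
  have I3: "has_bochner_integral lborel (\<lambda>t. indicator {0..1::real} t :: real) 1"
    using has_bochner_integral_real_indicator[of "{0..1::real}" lborel] by simp
  \<comment> \<open>This is the integral of (y t - c)^2, the variance of \<open>y\<close> about its
    mean \<open>c\<close>.\<close>
  have "0 \<le> (\<integral>t. indicator {0..1} t *\<^sub>R (y t)\<^sup>2 - 2 * c * (indicator {0..1} t *\<^sub>R y t)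
               + c\<^sup>2 * indicator {0..1} t \<partial>lborel)"
  proof (rule Bochner_Integration.integral_nonneg)
    fix t
    have "indicator {0..1} t *\<^sub>R (y t)\<^sup>2 - 2 * c * (indicator {0..1} t *\<^sub>R y t) + c\<^sup>2 * indicator {0..1} t
      = indicator {0..1} t * (y t - c)\<^sup>2"
      by (simp add: power2_eq_square algebra_simps)
    then show "0 \<le> indicator {0..1} t *\<^sub>R (y t)\<^sup>2 - 2 * c * (indicator {0..1} t *\<^sub>R y t) + c\<^sup>2 * indicator {0..1} t"
      by simp
  qed
  also have "\<dots> = (\<integral>t. indicator {0..1} t *\<^sub>R (y t)\<^sup>2 \<partial>lborel) - 2 * c * c + c\<^sup>2 * 1"
    using I1 I2 I3 by (simp add: has_bochner_integral_iff)
  finally have "c\<^sup>2 \<le> (\<integral>t. indicator {0..1} t *\<^sub>R (y t)\<^sup>2 \<partial>lborel)"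
    by (simp add: power2_eq_square)
  then have "ennreal (c\<^sup>2) \<le> (\<integral>\<^sup>+t. ennreal (indicator {0..1} t *\<^sub>R (y t)\<^sup>2) \<partial>lborel)"
    by (subst nn_integral_eq_integral[OF I2]) (auto intro: ennreal_leI)
  also have "\<dots> \<le> (\<integral>\<^sup>+t. ennreal (indicator {0..1} t * ((norm h)\<^sup>2 * (norm (G (x + t *\<^sub>R h)))\<^sup>2)) \<partial>lborel)"
  proof (rule nn_integral_mono, rule ennreal_leI)
    fix t
    have "(y t)\<^sup>2 \<le> (norm h)\<^sup>2 * (norm (G (x + t *\<^sub>R h)))\<^sup>2"
      unfolding y_def power_mult_distrib[symmetric]
      using Cauchy_Schwarz_ineq2[of "G (x + t *\<^sub>R h)" h]
      by (intro power2_le_iff_abs_le[THEN iffD2]) (auto simp: mult.commute)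
    then show "indicator {0..1} t *\<^sub>R (y t)\<^sup>2 \<le> indicator {0..1} t * ((norm h)\<^sup>2 * (norm (G (x + t *\<^sub>R h)))\<^sup>2)"
      by (auto simp: indicator_def)
  qed
  finally show ?thesis by (simp add: c_def)
qed

text \<open>After exchanging the integrals, the inner one over \<open>x\<close> is translation
  invariant and hence independent of \<open>t\<close>.\<close>

lemma C1c_translation_estimate:
  fixes f :: "'a::euclidean_space \<Rightarrow> real"
  assumes "C1c f G"
  shows "(\<integral>\<^sup>+x. ennreal ((f (x + h) - f x)\<^sup>2) \<partial>lborel)
    \<le> ennreal ((norm h)\<^sup>2 * (\<integral>x. (norm (G x))\<^sup>2 \<partial>lborel))"
proof -
  note cont = C1c_continuous[OF assms]
  have [measurable]: "f \<in> borel_measurable borel" "G \<in> borel_measurable borel"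
    using cont by (auto intro: borel_measurable_continuous_onI)
  let ?F = "\<lambda>x t. ennreal (indicator {0..1} t * ((norm h)\<^sup>2 * (norm (G (x + t *\<^sub>R h)))\<^sup>2))"
  have "(\<integral>\<^sup>+x. ennreal ((f (x + h) - f x)\<^sup>2) \<partial>lborel) \<le> (\<integral>\<^sup>+x. (\<integral>\<^sup>+t. ?F x t \<partial>lborel) \<partial>lborel)"
    by (rule nn_integral_mono) (rule C1c_increment_square_le[OF assms])
  also have "\<dots> = (\<integral>\<^sup>+t. (\<integral>\<^sup>+x. ?F x t \<partial>lborel) \<partial>lborel)"
    by (rule lborel_pair.Fubini') simp
  also have "\<dots> = (\<integral>\<^sup>+t. indicator {0..1::real} t * ennreal ((norm h)\<^sup>2 * (\<integral>x. (norm (G x))\<^sup>2 \<partial>lborel)) \<partial>lborel)"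
  proof (rule nn_integral_cong)
    fix t :: real
    have "(\<integral>\<^sup>+x. ?F x t \<partial>lborel) = (\<integral>\<^sup>+x. ennreal (indicator {0..1} t * ((norm h)\<^sup>2 * (norm (G x))\<^sup>2)) \<partial>lborel)"
      by (rule nn_integral_lborel_translation) measurable
    also have "\<dots> = ennreal (\<integral>x. indicator {0..1} t * ((norm h)\<^sup>2 * (norm (G x))\<^sup>2) \<partial>lborel)"
      using C1c_integrable_square(2)[OF assms] by (intro nn_integral_eq_integral) auto
    also have "\<dots> = indicator {0..1::real} t * ennreal ((norm h)\<^sup>2 * (\<integral>x. (norm (G x))\<^sup>2 \<partial>lborel))"
      by (auto simp: indicator_def)
    finally show "(\<integral>\<^sup>+x. ?F x t \<partial>lborel) = \<dots>" .
  qed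
  also have "\<dots> = ennreal ((norm h)\<^sup>2 * (\<integral>x. (norm (G x))\<^sup>2 \<partial>lborel))"
    by (subst nn_integral_multc) (auto simp: mult.commute)
  finally show ?thesis .
qed

text \<open>Difference quotients in a coordinate direction integrate to zero by translation
  invariance, and they converge boundedly to the partial derivative. Applied to products, this is
  integration by parts.\<close>

lemma C1c_integral_gradient:
  fixes f :: "'a::euclidean_space \<Rightarrow> real"
  assumes "C1c f G"
  shows "(\<integral>x. G x \<partial>lborel) = 0"
proof -
  note cont = C1c_continuous[OF assms]
  have [measurable]: "f \<in> borel_measurable borel" "G \<in> borel_measurable borel"
    using cont by (auto intro: borel_measurable_continuous_onI)
  obtain R where R: "R > 0" "\<And>x. norm x > R \<Longrightarrow> f x = 0" "\<And>x. norm x > R \<Longrightarrow> G x = 0"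
    using C1c_support[OF assms] by metis
  have "bounded (G ` cball 0 R)"
    by (intro compact_imp_bounded compact_continuous_image continuous_on_subset[OF cont(2)]) auto
  then obtain L where L: "L > 0" "\<And>x. x \<in> cball 0 R \<Longrightarrow> norm (G x) \<le> L"
    unfolding bounded_pos by auto
  have L': "norm (G x) \<le> L" for x
    using L R(3)[of x] by (cases "norm x \<le> R") (auto simp: less_imp_le)
  have lip: "\<bar>f y - f x\<bar> \<le> L * norm (y - x)" for x y
  proof -
    have "norm (f y - f x) \<le> L * norm (y - x)"
    proof (rule differentiable_bound[of UNIV])
      show "(f has_derivative (\<lambda>h. G x \<bullet> h)) (at x within UNIV)" for x
        using assms by (simp add: C1c_def)
      show "onorm (\<lambda>h. G x \<bullet> h) \<le> L" for x
        using L'[of x] by (intro onorm_le) (smt (verit) Cauchy_Schwarz_ineq2 mult_right_mono norm_ge_zero real_norm_def)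
    qed auto
    then show ?thesis by simp
  qed
  have If: "integrable lborel f"
    by (rule integrable_bounded_support[of _ R]) (use cont R in auto)
  have IG: "integrable lborel G"
    by (rule integrable_bounded_support[of _ R]) (use cont R in auto)
  have "(\<integral>x. G x \<bullet> e \<partial>lborel) = 0" if e: "e \<in> Basis" for e
  proof -
    define s where "s n x = (f (x + inverse (real (Suc n)) *\<^sub>R e) - f x) / inverse (real (Suc n))" for n x
    have s0: "(\<integral>x. s n x \<partial>lborel) = 0" for n
    proof -
      have "integrable lborel (\<lambda>x. f (x + inverse (real (Suc n)) *\<^sub>R e))"
      proof (rule integrable_bounded_support[of _ "R + 1"])
        show "continuous_on UNIV (\<lambda>x. f (x + inverse (real (Suc n)) *\<^sub>R e))"
          by (rule continuous_on_compose2[OF cont(1)]) (auto intro!: continuous_intros)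
        fix x :: 'a assume "norm x > R + 1"
        moreover have "norm (inverse (real (Suc n)) *\<^sub>R e) \<le> 1"
          using e by (simp add: field_simps)
        ultimately have "norm (x + inverse (real (Suc n)) *\<^sub>R e) > R"
          using norm_diff_ineq[of x "inverse (real (Suc n)) *\<^sub>R e"] by linarith
        then show "f (x + inverse (real (Suc n)) *\<^sub>R e) = 0" by (rule R(2))
      qed
      then show ?thesis
        unfolding s_def using If
        by (subst integral_divide_zero) (simp add: integral_lborel_translation)
    qed
    have "(\<lambda>n. \<integral>x. s n x \<partial>lborel) \<longlonglongrightarrow> (\<integral>x. G x \<bullet> e \<partial>lborel)"
    \<comment> \<open>\<open>L\<close> is a Lipschitz constant of \<open>f\<close>; shifts of length
      at most 1 keep the support inside the ball of radius \<open>R + 1\<close>.\<close>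
    proof (rule integral_dominated_convergence[where w="\<lambda>x. L * indicator (cball 0 (R+1)) x"])
      show "integrable lborel (\<lambda>x. L * indicator (cball (0::'a) (R+1)) x :: real)"
        using emeasure_lborel_cball_finite[of 0 "R+1"]
        by (intro integrable_mult_right integrable_real_indicator) auto
      show "AE x in lborel. (\<lambda>i. s i x) \<longlonglongrightarrow> G x \<bullet> e"
      proof (rule AE_I2)
        fix x
        have "(f has_derivative (\<lambda>h. G x \<bullet> h)) (at x)" using assms by (simp add: C1c_def)
        then have "((\<lambda>t. f (x + t *\<^sub>R e)) has_derivative (\<lambda>s. G x \<bullet> (0 + s *\<^sub>R e))) (at 0)"
          by (intro has_derivative_compose[of "\<lambda>t. x + t *\<^sub>R e" _ 0 _ f]) (auto intro!: derivative_eq_intros)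
        moreover have "(\<lambda>s. G x \<bullet> (0 + s *\<^sub>R e)) = (*) (G x \<bullet> e)"
          by (simp add: fun_eq_iff)
        ultimately have "((\<lambda>t. f (x + t *\<^sub>R e)) has_field_derivative G x \<bullet> e) (at 0)"
          by (simp only: has_field_derivative_def)
        then have "((\<lambda>h. (f (x + h *\<^sub>R e) - f x) / h) \<longlongrightarrow> G x \<bullet> e) (at 0)"
          by (simp add: has_field_derivative_iff)
        moreover have "filterlim (\<lambda>n. inverse (real (Suc n))) (at 0) sequentially"
          using LIMSEQ_inverse_real_of_nat by (auto simp: filterlim_at)
        ultimately show "(\<lambda>i. s i x) \<longlonglongrightarrow> G x \<bullet> e"
          unfolding s_def by (rule filterlim_compose)
      qed
      show "AE x in lborel. norm (s i x) \<le> L * indicator (cball 0 (R+1)) x" for i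
      proof (rule AE_I2)
        fix x
        let ?t = "inverse (real (Suc i))"
        have n1: "norm (?t *\<^sub>R e) = ?t" using e by simp
        have t1: "?t > 0" "?t \<le> 1" by (auto simp: field_simps)
        show "norm (s i x) \<le> L * indicator (cball 0 (R+1)) x"
        proof (cases "norm x \<le> R + 1")
          case True
          have "norm (s i x) \<le> L"
          proof -
            have "\<bar>f (x + ?t *\<^sub>R e) - f x\<bar> \<le> L * ?t"
              using lip[of "x + ?t *\<^sub>R e" x] n1 by simp
            then show ?thesis unfolding s_def real_norm_def abs_divide abs_of_pos[OF t1(1)]
              using t1(1) by (subst pos_divide_le_eq) auto
          qed
          with True show ?thesis by simp
        next
          case False
          then have "norm (x + ?t *\<^sub>R e) > R" "norm x > R"
            using norm_diff_ineq[of x "?t *\<^sub>R e"] n1 t1 by linarith+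
          then have "s i x = 0" unfolding s_def by (simp add: R(2))
          then show ?thesis using False by simp
        qed
      qed
    qed (auto simp: s_def)
    then show ?thesis by (simp add: s0 LIMSEQ_const_iff)
  qed
  then have "(\<integral>x. G x \<partial>lborel) \<bullet> e = 0 \<bullet> e" if "e \<in> Basis" for e
    using integral_inner_left[OF IG, of e] that inner_zero_left by metis
  then show ?thesis by (rule euclidean_eqI)
qed

text \<open>A shift longer than the diameter of the support moves every point of the support out of
  it, so \<open>f\<close> is dominated by its own increment.\<close>

lemma C1c_poincare:
  fixes f :: "'a::euclidean_space \<Rightarrow> real"
  assumes "C1c f G" "\<And>x. norm x > R \<Longrightarrow> f x = 0" "R \<ge> 0"
  shows "(\<integral>x. (f x)\<^sup>2 \<partial>lborel) \<le> (2*R+1)\<^sup>2 * (\<integral>x. (norm (G x))\<^sup>2 \<partial>lborel)"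
proof -
  have [measurable]: "f \<in> borel_measurable borel"
    using C1c_continuous[OF assms(1)] by (auto intro: borel_measurable_continuous_onI)
  obtain e :: 'a where e: "e \<in> Basis" using nonempty_Basis by blast
  define h where "h = (2*R+1) *\<^sub>R e"
  have nh: "norm h = 2*R+1" using e assms(3) by (simp add: h_def)
  have "ennreal (\<integral>x. (f x)\<^sup>2 \<partial>lborel) = (\<integral>\<^sup>+x. ennreal ((f x)\<^sup>2) \<partial>lborel)"
    by (rule nn_integral_eq_integral[symmetric, OF C1c_integrable_square(1)[OF assms(1)]]) auto
  also have "\<dots> \<le> (\<integral>\<^sup>+x. ennreal ((f (x + h) - f x)\<^sup>2) \<partial>lborel)"
  proof (rule nn_integral_mono, rule ennreal_leI)
    fix x
    show "(f x)\<^sup>2 \<le> (f (x + h) - f x)\<^sup>2"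
    proof (cases "norm x \<le> R")
      case True
      then have "norm (x + h) > R"
        using norm_diff_ineq[of h x] nh by (simp add: add.commute)
      then show ?thesis using assms(2) by simp
    qed (use assms(2) in auto)
  qed
  also have "\<dots> \<le> ennreal ((norm h)\<^sup>2 * (\<integral>x. (norm (G x))\<^sup>2 \<partial>lborel))"
    by (rule C1c_translation_estimate[OF assms(1)])
  finally show ?thesis
    unfolding nh by (subst (asm) ennreal_le_iff) auto
qed

subsection \<open>The critical Sobolev inequality\<close>

text \<open>A quadratic spline rising from 0 at 0 to 1 at 1. Its second derivative is 4 on the first
  half of the unit interval and -4 on the second, which keeps the slope at most 2. One continuous
  derivative is all that \<open>C1c\<close> asks for.\<close>

definition smooth_step :: "real \<Rightarrow> real" where
  "smooth_step r = 2 * (max 0 r)\<^sup>2 - 4 * (max 0 (r - 1/2))\<^sup>2 + 2 * (max 0 (r - 1))\<^sup>2"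

definition smooth_step' :: "real \<Rightarrow> real" where
  "smooth_step' r = 4 * max 0 r - 8 * max 0 (r - 1/2) + 4 * max 0 (r - 1)"

lemma DERIV_max_0_square: "((\<lambda>r::real. (max 0 r)\<^sup>2) has_real_derivative 2 * max 0 r) (at r)"
proof (cases r "0::real" rule: linorder_cases)
  case less
  have "((\<lambda>r::real. 0) has_real_derivative 2 * max 0 r) (at r)"
    using less by (auto intro!: derivative_eq_intros)
  then show ?thesis
    by (rule DERIV_cong_ev[OF refl _ refl, THEN iffD1, rotated])
       (use less in \<open>auto intro!: eventually_mono[OF eventually_nhds_in_open[of "{..<0}"]]\<close>)
next
  case equal
  have "((\<lambda>h::real. (max 0 h)\<^sup>2 / h) \<longlongrightarrow> 0) (at 0)"
  proof (rule Lim_null_comparison)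
    show "\<forall>\<^sub>F h in at (0::real). norm ((max 0 h)\<^sup>2 / h) \<le> \<bar>h\<bar>"
      by (rule always_eventually) (auto simp: max_def power2_eq_square)
    show "((\<lambda>h::real. \<bar>h\<bar>) \<longlongrightarrow> 0) (at 0)" by (rule tendsto_eq_intros | simp)+
  qed
  with equal show ?thesis by (simp add: has_field_derivative_iff)
next
  case greater
  have "((\<lambda>r::real. r\<^sup>2) has_real_derivative 2 * max 0 r) (at r)"
    using greater by (auto intro!: derivative_eq_intros)
  then show ?thesis
    by (rule DERIV_cong_ev[OF refl _ refl, THEN iffD1, rotated])
       (use greater in \<open>auto intro!: eventually_mono[OF eventually_nhds_in_open[of "{0<..}"]]\<close>)
qed

lemma DERIV_smooth_step: "(smooth_step has_real_derivative smooth_step' r) (at r)"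
proof -
  have *: "((\<lambda>r. (max 0 (r - c))\<^sup>2) has_real_derivative 2 * max 0 (r - c)) (at r)" for c :: real
  proof -
    have "((\<lambda>r. r - c) has_real_derivative 1) (at r)" by (auto intro!: derivative_eq_intros)
    from DERIV_chain2[where f = "\<lambda>r. (max 0 r)\<^sup>2" and g = "\<lambda>r. r - c", OF DERIV_max_0_square this]
    show ?thesis by simp
  qed
  show ?thesis
    unfolding smooth_step_def[abs_def] smooth_step'_def
    by (rule derivative_eq_intros DERIV_max_0_square * | simp)+
qed

lemma smooth_step_eq: "r \<le> 0 \<Longrightarrow> smooth_step r = 0" "r \<ge> 1 \<Longrightarrow> smooth_step r = 1"
  "r \<le> 0 \<Longrightarrow> smooth_step' r = 0" "r \<ge> 1 \<Longrightarrow> smooth_step' r = 0"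
  by (auto simp: smooth_step_def smooth_step'_def max_def power2_eq_square algebra_simps)

lemma smooth_step_bounds: "0 \<le> smooth_step r" "smooth_step r \<le> 1" "\<bar>smooth_step' r\<bar> \<le> 2"
proof -
  consider "r \<le> 0" | "0 < r" "r \<le> 1/2" | "1/2 < r" "r < 1" | "r \<ge> 1" by linarith
  then have "0 \<le> smooth_step r \<and> smooth_step r \<le> 1 \<and> \<bar>smooth_step' r\<bar> \<le> 2"
  proof cases
    case 2
    then have "smooth_step r = 2 * r\<^sup>2" "smooth_step' r = 4 * r"
      by (auto simp: smooth_step_def smooth_step'_def max_def)
    moreover have "r\<^sup>2 \<le> (1/2)\<^sup>2" using 2 by (intro power_mono) auto
    ultimately show ?thesis using 2 by (auto simp: power2_eq_square)
  next
    case 3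
    then have "smooth_step r = 1 - 2 * (1 - r)\<^sup>2" "smooth_step' r = 4 * (1 - r)"
      by (auto simp: smooth_step_def smooth_step'_def max_def power2_eq_square algebra_simps)
    moreover have "(1 - r)\<^sup>2 \<le> (1/2)\<^sup>2" using 3 by (intro power_mono) auto
    ultimately show ?thesis using 3 by (auto simp: power2_eq_square)
  qed (auto simp: smooth_step_eq)
  then show "0 \<le> smooth_step r" "smooth_step r \<le> 1" "\<bar>smooth_step' r\<bar> \<le> 2" by auto
qed

text \<open>The step is composed with the square of \<open>f\<close>, because the absolute value
  would spoil differentiability at the zeros of \<open>f\<close>.\<close>

lemma C1c_truncation:
  fixes f :: "'a::euclidean_space \<Rightarrow> real"
  assumes fG: "C1c f G" and t: "t > 0"
  obtains v V where "C1c v V" "\<And>x. 0 \<le> v x" "\<And>x. v x \<le> 1"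
    "\<And>x. \<bar>f x\<bar> \<le> t / 2 \<Longrightarrow> v x = 0" "\<And>x. \<bar>f x\<bar> \<ge> t \<Longrightarrow> v x = 1"
    "\<And>x. (norm (V x))\<^sup>2 \<le> 36 / t\<^sup>2 * (indicator {x. t / 2 < \<bar>f x\<bar> \<and> \<bar>f x\<bar> < t} x * (norm (G x))\<^sup>2)"
proof -
  \<comment> \<open>The affine function of the square of \<open>f x\<close> that is 0 for |f x| =
    t/2 and 1 for |f x| = t.\<close>
  define r where "r x = (4 / (3 * t\<^sup>2)) * (f x)\<^sup>2 - 1/3" for x
  define v where "v x = smooth_step (r x)" for x
  define V where "V x = (smooth_step' (r x) * (8 / (3 * t\<^sup>2)) * f x) *\<^sub>R G x" for x
  note cont = C1c_continuous[OF fG]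
  have r0: "r x \<le> 0" if "\<bar>f x\<bar> \<le> t / 2" for x
  proof -
    have "(f x)\<^sup>2 \<le> (t/2)\<^sup>2" using that t by (subst abs_le_square_iff[symmetric]) auto
    then show ?thesis using t by (simp add: r_def field_simps)
  qed
  have r1: "r x \<ge> 1" if "\<bar>f x\<bar> \<ge> t" for x
  proof -
    have "t\<^sup>2 \<le> (f x)\<^sup>2" using that t by (subst abs_le_square_iff[symmetric]) auto
    then show ?thesis using t by (simp add: r_def field_simps)
  qed
  have "C1c v V"
    unfolding C1c_def
  proof (intro conjI allI)
    fix x
    have "(f has_derivative (\<lambda>h. G x \<bullet> h)) (at x)" using fG by (simp add: C1c_def)
    then have "(r has_derivative (\<lambda>h. (4 / (3 * t\<^sup>2)) * (2 * f x * (G x \<bullet> h)))) (at x)"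
      unfolding r_def using t by (auto intro!: derivative_eq_intros simp: power2_eq_square)
    then have "((\<lambda>x. smooth_step (r x)) has_derivative
        (\<lambda>h. smooth_step' (r x) * ((4 / (3 * t\<^sup>2)) * (2 * f x * (G x \<bullet> h))))) (at x)"
      by (rule has_derivative_compose[OF _ DERIV_smooth_step[unfolded has_field_derivative_def], unfolded o_def])
    then show "(v has_derivative (\<lambda>h. V x \<bullet> h)) (at x)"
      unfolding v_def V_def by (simp add: mult.assoc)
  next
    show "continuous_on UNIV V"
      unfolding V_def r_def smooth_step'_def using t
      by (intro continuous_intros cont) auto
    show "bounded {x. v x \<noteq> 0}"
    proof (rule bounded_subset)
      show "bounded {x. f x \<noteq> 0}" using fG by (simp add: C1c_def)
      show "{x. v x \<noteq> 0} \<subseteq> {x. f x \<noteq> 0}"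
        using r0 t by (auto simp: v_def smooth_step_eq)
    qed
  qed
  moreover have "(norm (V x))\<^sup>2 \<le> 36 / t\<^sup>2 * (indicator {x. t / 2 < \<bar>f x\<bar> \<and> \<bar>f x\<bar> < t} x * (norm (G x))\<^sup>2)" for x
  proof -
    consider "\<bar>f x\<bar> \<le> t/2" | "\<bar>f x\<bar> \<ge> t" | "t / 2 < \<bar>f x\<bar>" "\<bar>f x\<bar> < t" by linarith
    then show ?thesis
    proof cases
      case 3
      have "\<bar>smooth_step' (r x) * (8 / (3 * t\<^sup>2)) * f x\<bar> \<le> 2 * (8 / (3 * t\<^sup>2)) * t"
        unfolding abs_mult using 3 t smooth_step_bounds(3)[of "r x"] by (intro mult_mono) auto
      \<comment> \<open>The exact factor is 16/3; 6 is a round bound, and its square is the constant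
        36.\<close>
      also have "\<dots> \<le> 6 / t" using t by (simp add: field_simps power2_eq_square)
      finally have "\<bar>smooth_step' (r x) * (8 / (3 * t\<^sup>2)) * f x\<bar>\<^sup>2 \<le> (6 / t)\<^sup>2"
        by (rule power_mono) simp
      then have "\<bar>smooth_step' (r x) * (8 / (3 * t\<^sup>2)) * f x\<bar>\<^sup>2 * (norm (G x))\<^sup>2 \<le> (6 / t)\<^sup>2 * (norm (G x))\<^sup>2"
        by (rule mult_right_mono) simp
      then show ?thesis
        using 3 by (simp add: V_def power_mult_distrib power_divide)
    qed (auto simp: V_def r0 r1 smooth_step_eq)
  qed
  ultimately show ?thesis
    using r0 r1 by (intro that[of v V]) (auto simp: v_def smooth_step_eq smooth_step_bounds)
qed

text \<open>Shifting by \<open>h\<close> in a ball whose volume is twice that of the support of \<open>v\<close> moves a point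
  with \<open>v = 1\<close> out of the support for at least half of all \<open>h\<close>.\<close>

lemma C1c_level_set_estimate:
  fixes v :: "'a::euclidean_space \<Rightarrow> real"
  assumes vV: "C1c v V" and A: "A \<in> sets borel" "bounded A" "{x. v x \<noteq> 0} \<subseteq> A"
  defines "m \<equiv> measure lborel A" and "d \<equiv> DIM('a)"
  shows "measure lborel {x. v x = 1}
     \<le> 2 * (2 * m / unit_ball_vol (real d)) powr (2 / real d) * (\<integral>x. (norm (V x))\<^sup>2 \<partial>lborel)"
proof -
  have [measurable]: "v \<in> borel_measurable borel"
    using C1c_continuous[OF vV] by (auto intro: borel_measurable_continuous_onI)
  note [measurable] = A(1)
  define \<omega> where "\<omega> = unit_ball_vol (real d)"
  have \<omega>: "\<omega> > 0" unfolding \<omega>_def by (rule unit_ball_vol_pos) simp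
  have dpos: "d > 0" by (simp add: d_def)
  have finA: "emeasure lborel A \<noteq> \<infinity>"
    using emeasure_bounded_finite[OF A(2)] by auto
  have eA: "emeasure lborel A = ennreal m"
    unfolding m_def by (rule emeasure_eq_ennreal_measure) (use finA in auto)
  define E where "E = {x. v x = 1}"
  have v0: "v y = 0" if "y \<notin> A" for y
    using A(3) that by auto
  have EA: "E \<subseteq> A" using A(3) by (auto simp: E_def)
  have [measurable]: "E \<in> sets borel" unfolding E_def by measurable
  have eE: "emeasure lborel E = ennreal (measure lborel E)"
    by (rule emeasure_eq_ennreal_measure)
       (metis EA finA emeasure_mono A(1) sets_lborel infinity_ennreal_def neq_top_trans)
  let ?I = "\<integral>x. (norm (V x))\<^sup>2 \<partial>lborel"
  have I0: "?I \<ge> 0" by simp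
  have m0: "m \<ge> 0" by (simp add: m_def)
  have ME: "measure lborel E \<le> m"
    unfolding m_def using EA finA by (intro measure_mono_fmeasurable) (auto simp: fmeasurable_def less_top)
  show ?thesis
  proof (cases "m = 0")
    case True
    then have "measure lborel E \<le> 0" using ME by simp
    also have "0 \<le> 2 * (2 * m / unit_ball_vol (real d)) powr (2 / real d) * ?I" by simp
    finally show ?thesis by (simp add: E_def)
  next
    case False
    with m0 have m: "m > 0" by simp
    \<comment> \<open>The ball of radius \<open>r\<close> has volume \<open>2 * m\<close>. Shifts in
      it cost a factor r^2, which is the source of the exponent 2/d.\<close>
    define r where "r = (2 * m / \<omega>) powr (1 / real d)"
    have r: "r > 0" using m \<omega> by (simp add: r_def)
    have rd: "r ^ d = 2 * m / \<omega>"
      using m \<omega> dpos unfolding r_def by (simp add: powr_realpow[symmetric] powr_powr)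
    have r2: "r\<^sup>2 = (2 * m / \<omega>) powr (2 / real d)"
      using m \<omega> unfolding r_def by (simp add: powr_realpow[symmetric] powr_powr)
    define B where "B = ball (0::'a) r"
    have eB: "emeasure lborel B = ennreal (2 * m)"
      unfolding B_def using r \<omega> by (subst emeasure_ball) (auto simp: d_def[symmetric] \<omega>_def[symmetric] rd)
    have [measurable]: "B \<in> sets borel" by (simp add: B_def)
    let ?F = "\<lambda>x h. indicator E x * (indicator B h * ennreal ((v (x + h) - v x)\<^sup>2))"
    have "ennreal m * emeasure lborel E = (\<integral>\<^sup>+x. indicator E x * ennreal m \<partial>lborel)"
      by (subst nn_integral_multc) (auto simp: mult.commute)
    also have "\<dots> \<le> (\<integral>\<^sup>+x. (\<integral>\<^sup>+h. ?F x h \<partial>lborel) \<partial>lborel)"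
    proof (rule nn_integral_mono)
      fix x :: 'a
      show "indicator E x * ennreal m \<le> (\<integral>\<^sup>+h. ?F x h \<partial>lborel)"
      proof (cases "x \<in> E")
        case True
        have mA: "emeasure lborel {h. x + h \<in> A} = ennreal m"
        proof -
          have "emeasure lborel {h. x + h \<in> A} = emeasure lborel ((+) x -` A \<inter> space lborel)"
            by (rule arg_cong[where f="emeasure lborel"]) auto
          also have "\<dots> = emeasure (distr lborel borel ((+) x)) A"
            by (subst emeasure_distr) auto
          also have "\<dots> = ennreal m" by (simp add: lborel_distr_plus eA)
          finally show ?thesis .
        qed
        have [measurable]: "{h. x + h \<in> A} \<in> sets borel"
          by measurable
        have "ennreal (2 * m) = emeasure lborel B" by (simp add: eB)
        also have "\<dots> \<le> emeasure lborel ((B - {h. x + h \<in> A}) \<union> {h. x + h \<in> A})"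
          by (intro emeasure_mono) auto
        also have "\<dots> \<le> emeasure lborel (B - {h. x + h \<in> A}) + emeasure lborel {h. x + h \<in> A}"
          by (intro emeasure_subadditive) auto
        finally have "ennreal m + ennreal m \<le> emeasure lborel (B - {h. x + h \<in> A}) + ennreal m"
          using m by (simp add: mA flip: ennreal_plus)
        then have "ennreal m \<le> emeasure lborel (B - {h. x + h \<in> A})"
          by (simp add: ennreal_add_left_cancel_le add.commute)
        also have "\<dots> = (\<integral>\<^sup>+h. indicator (B - {h. x + h \<in> A}) h \<partial>lborel)"
          by (subst nn_integral_indicator) auto
        also have "\<dots> \<le> (\<integral>\<^sup>+h. ?F x h \<partial>lborel)"
          using True v0 by (intro nn_integral_mono) (auto simp: indicator_def E_def)
        finally show ?thesis using True by simp
      qed simp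
    qed
    also have "\<dots> = (\<integral>\<^sup>+h. (\<integral>\<^sup>+x. ?F x h \<partial>lborel) \<partial>lborel)"
      by (rule lborel_pair.Fubini') simp
    also have "\<dots> \<le> (\<integral>\<^sup>+h. indicator B h * ennreal (r\<^sup>2 * ?I) \<partial>lborel)"
    proof (rule nn_integral_mono)
      fix h :: 'a
      show "(\<integral>\<^sup>+x. ?F x h \<partial>lborel) \<le> indicator B h * ennreal (r\<^sup>2 * ?I)"
      proof (cases "h \<in> B")
        case True
        have "(\<integral>\<^sup>+x. ?F x h \<partial>lborel) \<le> (\<integral>\<^sup>+x. ennreal ((v (x + h) - v x)\<^sup>2) \<partial>lborel)"
          by (intro nn_integral_mono) (auto simp: indicator_def)
        also have "\<dots> \<le> ennreal ((norm h)\<^sup>2 * ?I)"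
          by (rule C1c_translation_estimate[OF vV])
        also have "\<dots> \<le> ennreal (r\<^sup>2 * ?I)"
          using True r by (intro ennreal_leI mult_right_mono power_mono) (auto simp: B_def)
        finally show ?thesis using True by simp
      qed simp
    qed
    also have "\<dots> = ennreal (2 * m) * ennreal (r\<^sup>2 * ?I)"
      by (subst nn_integral_multc) (auto simp: eB)
    finally have "ennreal (m * measure lborel E) \<le> ennreal (2 * m * (r\<^sup>2 * ?I))"
      using m I0 unfolding eE by (simp flip: ennreal_mult)
    then have "m * measure lborel E \<le> m * (2 * r\<^sup>2 * ?I)"
      using m I0 by (subst (asm) ennreal_le_iff) (auto simp: mult_ac)
    then show ?thesis
      using m by (simp add: E_def r2 \<omega>_def)
  qed
qed

section \<open>Summation over dyadic levels\<close>

lemma powr_divide_power: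
  fixes M p :: real
  assumes "M > 0"
  shows "(M / 2 ^ j) powr p = M powr p * (1 / 2 powr p) ^ j"
proof -
  have "(2 ^ j) powr p = (2 powr p) ^ j"
    by (simp add: powr_realpow[symmetric] powr_powr mult.commute)
  then show ?thesis using assms by (simp add: powr_divide power_one_over field_simps)
qed

text \<open>The level-set estimate for the truncation at height \<open>t\<close>: it vanishes where
  |f| \<le> t/2, equals 1 where |f| \<ge> t, and its gradient lives in the strip between. Strips of
  different dyadic levels are disjoint, so the gradient integrals can be added.\<close>

lemma C1c_dyadic_level_estimate:
  fixes f :: "'a::euclidean_space \<Rightarrow> real"
  assumes fG: "C1c f G" and t: "t > 0"
  shows "measure lborel {x. \<bar>f x\<bar> \<ge> t}
    \<le> 2 * (2 / unit_ball_vol (real DIM('a))) powr (2 / real DIM('a))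
       * measure lborel {x. \<bar>f x\<bar> \<ge> t / 2} powr (2 / real DIM('a))
       * (36 / t\<^sup>2 * (\<integral>x. indicator {x. t / 2 < \<bar>f x\<bar> \<and> \<bar>f x\<bar> < t} x * (norm (G x))\<^sup>2 \<partial>lborel))"
proof -
  have [measurable]: "f \<in> borel_measurable borel" "G \<in> borel_measurable borel"
    using C1c_continuous[OF fG] by (auto intro: borel_measurable_continuous_onI)
  obtain v V where vV: "C1c v V" "\<And>x. 0 \<le> v x" "\<And>x. v x \<le> 1"
    "\<And>x. \<bar>f x\<bar> \<le> t / 2 \<Longrightarrow> v x = 0" "\<And>x. \<bar>f x\<bar> \<ge> t \<Longrightarrow> v x = 1"
    and V: "\<And>x. (norm (V x))\<^sup>2 \<le> 36 / t\<^sup>2 * (indicator {x. t / 2 < \<bar>f x\<bar> \<and> \<bar>f x\<bar> < t} x * (norm (G x))\<^sup>2)"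
    using C1c_truncation[OF fG t] by blast
  have [measurable]: "v \<in> borel_measurable borel"
    using C1c_continuous[OF vV(1)] by (auto intro: borel_measurable_continuous_onI)
  let ?A = "{x. \<bar>f x\<bar> \<ge> t / 2}"
  have bdd: "bounded ?A"
    by (rule bounded_subset[of "{x. f x \<noteq> 0}"]) (use fG t in \<open>auto simp: C1c_def\<close>)
  have vA: "v x \<noteq> 0 \<Longrightarrow> t / 2 \<le> \<bar>f x\<bar>" for x
    using vV(4)[of x] by linarith
  have bE: "bounded {x. v x = 1}"
    by (rule bounded_subset[of "{x. v x \<noteq> 0}"]) (use vV(1) in \<open>auto simp: C1c_def\<close>)
  have i: "integrable lborel (\<lambda>x. indicator {x. t / 2 < \<bar>f x\<bar> \<and> \<bar>f x\<bar> < t} x * (norm (G x))\<^sup>2)"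
    by (rule Bochner_Integration.integrable_bound[OF C1c_integrable_square(2)[OF fG]])
       (auto simp: indicator_def)
  have "measure lborel {x. \<bar>f x\<bar> \<ge> t} \<le> measure lborel {x. v x = 1}"
    using vV(5) emeasure_bounded_finite[OF bE]
    by (intro measure_mono_fmeasurable) (auto simp: fmeasurable_def)
  also have "\<dots> \<le> 2 * (2 * measure lborel ?A / unit_ball_vol (real DIM('a))) powr (2 / real DIM('a))
      * (\<integral>x. (norm (V x))\<^sup>2 \<partial>lborel)"
    using vA by (intro C1c_level_set_estimate[OF vV(1)] bdd) auto
  also have "\<dots> \<le> 2 * (2 * measure lborel ?A / unit_ball_vol (real DIM('a))) powr (2 / real DIM('a))
      * (\<integral>x. 36 / t\<^sup>2 * (indicator {x. t / 2 < \<bar>f x\<bar> \<and> \<bar>f x\<bar> < t} x * (norm (G x))\<^sup>2) \<partial>lborel)"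
    using i by (intro mult_left_mono integral_mono C1c_integrable_square(2)[OF vV(1)] V integrable_mult_right) auto
  also have "(2 * measure lborel ?A / unit_ball_vol (real DIM('a))) powr (2 / real DIM('a))
      = (2 / unit_ball_vol (real DIM('a))) powr (2 / real DIM('a)) * measure lborel ?A powr (2 / real DIM('a))"
    by (subst powr_mult[symmetric]) auto
  finally show ?thesis
    by (simp only: integral_mult_right_zero mult.assoc)
qed

text \<open>Let \<open>b j\<close> be the measure \<open>a j\<close> of a level set weighted by
  \<open>t j powr p\<close>, and \<open>B\<close> the sum of all \<open>b j\<close>. At the critical
  exponent the powers of the level cancel in the dyadic estimate, so \<open>b j\<close> is at most a
  constant times \<open>b (Suc j) powr (2 / d) * g j\<close>. Since \<open>b (Suc j)\<close> is at
  most \<open>B\<close> and the \<open>g j\<close> add up to at most \<Gamma>, \<open>B\<close> is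
  bounded by a multiple of \<open>B powr (2 / d) * \<Gamma>\<close>, and the power of
  \<open>B\<close> can be divided out.\<close>

theorem C1c_sobolev:
  assumes dim: "DIM('a::euclidean_space) > 2"
  defines "p \<equiv> two_star DIM('a)"
  shows "\<exists>K>0. \<forall>(f::'a \<Rightarrow> real) G. C1c f G \<longrightarrow>
    (\<integral>x. \<bar>f x\<bar> powr p \<partial>lborel) \<le> K * (\<integral>x. (norm (G x))\<^sup>2 \<partial>lborel) powr (p / 2)"
proof -
  define d where "d = real DIM('a)"
  have d: "d > 2" using dim by (simp add: d_def)
  have p: "p = 2 * d / (d - 2)" by (simp add: p_def two_star_def d_def)
  have p2: "p > 2" using d by (simp add: p field_simps)
  \<comment> \<open>The first identity cancels the powers of the level; the second gives the power
    of \<open>B\<close> left after the division.\<close>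
  have pd: "p * (2 / d) = p - 2" "1 - 2 / d = 2 / p" using d by (simp_all add: p field_simps)
  define C0 where "C0 = 2 * (2 / unit_ball_vol d) powr (2 / d) * 36"
  have "unit_ball_vol d > 0" using d by (intro unit_ball_vol_pos) simp
  then have C0: "C0 > 0" by (simp add: C0_def)
  define C1 where "C1 = C0 * 2 powr (p - 2)"
  have C1: "C1 > 0" using C0 by (simp add: C1_def)
  define K where "K = 2 powr p * C1 powr (p / 2)"
  have "(\<integral>x. \<bar>f x\<bar> powr p \<partial>lborel) \<le> K * (\<integral>x. (norm (G x))\<^sup>2 \<partial>lborel) powr (p / 2)"
    if fG: "C1c f G" for f :: "'a \<Rightarrow> real" and G
  proof -
    have [measurable]: "f \<in> borel_measurable borel" "G \<in> borel_measurable borel"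
      using C1c_continuous[OF fG] by (auto intro: borel_measurable_continuous_onI)
    define \<Gamma> where "\<Gamma> = (\<integral>x. (norm (G x))\<^sup>2 \<partial>lborel)"
    have \<Gamma>0: "\<Gamma> \<ge> 0" by (simp add: \<Gamma>_def)
    obtain R where R: "R > 0" "\<And>x. norm x > R \<Longrightarrow> f x = 0" using C1c_support[OF fG] by metis
    obtain M where M: "M > 0" "\<And>x. \<bar>f x\<bar> < M"
    proof -
      have "bounded (f ` cball 0 R)"
        by (intro compact_imp_bounded compact_continuous_image
            continuous_on_subset[OF C1c_continuous(1)[OF fG]]) auto
      then obtain L where L: "L > 0" "\<And>x. x \<in> cball 0 R \<Longrightarrow> \<bar>f x\<bar> \<le> L"
        unfolding bounded_pos by auto
      have "\<bar>f x\<bar> < L + 1" for x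
        using L(1) L(2)[of x] R(2)[of x] by (cases "norm x \<le> R") auto
      then show ?thesis using L(1) by (intro that[of "L+1"]) auto
    qed
    define t where "t j = M / 2 ^ j" for j :: nat
    have t: "t j > 0" "t (Suc j) = t j / 2" for j using M by (auto simp: t_def)
    have t_anti: "t k \<le> t j" if "j \<le> k" for j k
      using M that by (auto simp: t_def intro!: divide_left_mono power_increasing)
    define a where "a j = measure lborel {x. \<bar>f x\<bar> \<ge> t j}" for j
    have bdd: "bounded {x. \<bar>f x\<bar> \<ge> t j}" for j
      by (rule bounded_subset[of "{x. f x \<noteq> 0}"])
         (use fG t(1)[of j] in \<open>auto simp: C1c_def\<close>)
    define m where "m = measure lborel {x. f x \<noteq> 0}"
    have a: "0 \<le> a j" "a j \<le> m" for j
    proof -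
      have "bounded {x. f x \<noteq> 0}" using fG by (simp add: C1c_def)
      from emeasure_bounded_finite[OF this] show "a j \<le> m" unfolding a_def m_def using t(1)[of j]
        by (intro measure_mono_fmeasurable) (auto simp: fmeasurable_def)
    qed (simp add: a_def)
    define I where "I j = {x. t (Suc j) < \<bar>f x\<bar> \<and> \<bar>f x\<bar> < t j}" for j
    have [measurable]: "I j \<in> sets borel" for j unfolding I_def by measurable
    define g where "g j = (\<integral>x. indicator (I j) x * (norm (G x))\<^sup>2 \<partial>lborel)" for j
    have g0: "g j \<ge> 0" for j by (simp add: g_def)
    have gi: "integrable lborel (\<lambda>x. indicator (I j) x * (norm (G x))\<^sup>2)" for j
      by (rule Bochner_Integration.integrable_bound[OF C1c_integrable_square(2)[OF fG]])
         (auto simp: indicator_def)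
    have disj: "disjoint_family I"
      unfolding disjoint_family_on_def
    proof (intro ballI impI)
      fix i j :: nat assume "i \<noteq> j"
      then consider "Suc i \<le> j" | "Suc j \<le> i" by linarith
      then show "I i \<inter> I j = {}" by cases (use t_anti in \<open>fastforce simp: I_def\<close>)+
    qed
    have gsum: "(\<Sum>j<N. g j) \<le> \<Gamma>" for N
    proof -
      have "(\<Sum>j<N. g j) = (\<integral>x. (\<Sum>j<N. indicator (I j) x * (norm (G x))\<^sup>2) \<partial>lborel)"
        unfolding g_def using gi by (subst Bochner_Integration.integral_sum) auto
      also have "\<dots> \<le> \<Gamma>"
        unfolding \<Gamma>_def
      proof (rule integral_mono)
        show "integrable lborel (\<lambda>x. \<Sum>j<N. indicator (I j) x * (norm (G x))\<^sup>2)"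
          by (intro Bochner_Integration.integrable_sum gi)
        show "integrable lborel (\<lambda>x. (norm (G x))\<^sup>2)" by (rule C1c_integrable_square(2)[OF fG])
        fix x
        have "(\<Sum>j<N. indicator (I j) x * (norm (G x))\<^sup>2) = (\<Sum>j<N. indicator (I j) x :: real) * (norm (G x))\<^sup>2"
          by (rule sum_distrib_right[symmetric])
        also have "(\<Sum>j<N. indicator (I j) x :: real) = indicator (\<Union>j<N. I j) x"
          by (rule indicator_UN_disjoint[symmetric])
             (use disj in \<open>auto simp: disjoint_family_on_def\<close>)
        also have "\<dots> * (norm (G x))\<^sup>2 \<le> (norm (G x))\<^sup>2" by (auto simp: indicator_def)
        finally show "(\<Sum>j<N. indicator (I j) x * (norm (G x))\<^sup>2) \<le> (norm (G x))\<^sup>2" .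
      qed
      finally show ?thesis .
    qed
    define b where "b j = t j powr p * a j" for j
    have b0: "b j \<ge> 0" for j using a by (simp add: b_def)
    \<comment> \<open>\<open>B\<close> must be known to be finite before a power of it can be
      divided out. The measures \<open>a j\<close> are at most \<open>m\<close>, so a geometric
      series dominates.\<close>
    have "summable b"
    proof (rule summable_comparison_test)
      have "1 < 2 powr p" using powr_less_mono[of 0 p 2] p2 by simp
      then have "\<bar>1 / 2 powr p\<bar> < 1" by simp
      then show "summable (\<lambda>j. (M powr p * m) * (1 / 2 powr p) ^ j)"
        by (intro summable_mult summable_geometric) simp
      show "\<exists>N. \<forall>n\<ge>N. norm (b n) \<le> M powr p * m * (1 / 2 powr p) ^ n"
        using b0 a M(1) unfolding b_def t_def powr_divide_power[OF M(1)]
        by (auto simp: mult_ac intro!: mult_left_mono exI[of _ 0])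
    qed
    define B where "B = (\<Sum>j. b j)"
    have bB: "b j \<le> B" for j
      unfolding B_def using sum_le_suminf[OF \<open>summable b\<close>, of "{j}"] b0 by auto
    have B0: "B \<ge> 0" using b0 bB order_trans by blast
    have step: "b j \<le> C1 * B powr (2 / d) * g j" for j
    proof -
      have "a j \<le> C0 * a (Suc j) powr (2 / d) * ((1 / (t j)\<^sup>2) * g j)"
        using C1c_dyadic_level_estimate[OF fG t(1)[of j]]
        by (simp add: a_def g_def I_def t(2) C0_def d_def mult_ac)
      then have "b j \<le> t j powr p * (C0 * a (Suc j) powr (2 / d) * ((1 / (t j)\<^sup>2) * g j))"
        unfolding b_def by (rule mult_left_mono) simp
      also have "\<dots> = C1 * ((t (Suc j) powr p) powr (2 / d) * a (Suc j) powr (2 / d)) * g j"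
      proof -
        have "(t (Suc j) powr p) powr (2 / d) = t j powr (p - 2) / 2 powr (p - 2)"
          using t(1)[of j] unfolding powr_powr pd t(2) by (simp add: powr_divide)
        moreover have "t j powr p = t j powr (p - 2) * (t j)\<^sup>2"
          using t(1)[of j] by (simp add: powr_diff)
        ultimately show ?thesis using t(1)[of j] by (simp add: C1_def field_simps)
      qed
      also have "\<dots> = C1 * b (Suc j) powr (2 / d) * g j"
        using a t(1) by (simp add: b_def powr_mult)
      also have "\<dots> \<le> C1 * B powr (2 / d) * g j"
        using C1 g0 b0 bB d by (intro mult_right_mono mult_left_mono powr_mono2) auto
      finally show ?thesis .
    qed
    have BB: "B \<le> C1 * B powr (2 / d) * \<Gamma>"
      unfolding B_def
    proof (rule suminf_le_const[OF \<open>summable b\<close>], unfold B_def[symmetric])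
      fix N
      have "(\<Sum>j<N. b j) \<le> (\<Sum>j<N. C1 * B powr (2 / d) * g j)" by (rule sum_mono) (rule step)
      also have "\<dots> = C1 * B powr (2 / d) * (\<Sum>j<N. g j)" by (rule sum_distrib_left[symmetric])
      also have "\<dots> \<le> C1 * B powr (2 / d) * \<Gamma>" using C1 gsum by (intro mult_left_mono) auto
      finally show "(\<Sum>j<N. b j) \<le> C1 * B powr (2 / d) * \<Gamma>" .
    qed
    have B: "B \<le> (C1 * \<Gamma>) powr (p / 2)"
    proof (cases "B = 0")
      case False
      then have Bp: "B > 0" using B0 by simp
      have "B powr (2 / p) = B / B powr (2 / d)"
        using Bp unfolding pd(2)[symmetric] by (simp add: powr_diff)
      also have "\<dots> \<le> C1 * \<Gamma>" using BB Bp by (simp add: field_simps)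
      finally have "(B powr (2 / p)) powr (p / 2) \<le> (C1 * \<Gamma>) powr (p / 2)"
        using p2 by (intro powr_mono2) auto
      then show ?thesis using Bp p2 by (simp add: powr_powr)
    qed simp
    have [measurable]: "{x. \<bar>f x\<bar> \<ge> t j} \<in> sets borel" for j by measurable
    \<comment> \<open>A value of |f| between two consecutive levels is estimated by the upper one,
      on a set described by the lower one; the shift by one level costs the factor 2^p.\<close>
    have "(\<integral>\<^sup>+x. ennreal (\<bar>f x\<bar> powr p) \<partial>lborel)
        \<le> (\<integral>\<^sup>+x. (\<Sum>j. ennreal (t j powr p) * indicator {x. \<bar>f x\<bar> \<ge> t (Suc j)} x) \<partial>lborel)"
    proof (rule nn_integral_mono)
      fix x
      show "ennreal (\<bar>f x\<bar> powr p) \<le> (\<Sum>j. ennreal (t j powr p) * indicator {x. \<bar>f x\<bar> \<ge> t (Suc j)} x)"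
      proof (cases "f x = 0")
        case False
        have "t \<longlonglongrightarrow> 0" unfolding t_def
          using tendsto_mult[OF tendsto_const[of M] LIMSEQ_realpow_zero[of "1/2"]]
          by (simp add: power_one_over)
        then have "eventually (\<lambda>j. t j < \<bar>f x\<bar>) sequentially"
          by (rule order_tendstoD) (use False in auto)
        then have ex: "\<exists>j. t j \<le> \<bar>f x\<bar>" by (auto simp: eventually_sequentially intro: less_imp_le)
        define j where "j = (LEAST j. t j \<le> \<bar>f x\<bar>)"
        have j: "t j \<le> \<bar>f x\<bar>" unfolding j_def by (rule LeastI_ex[OF ex])
        have "t 0 = M" by (simp add: t_def)
        \<comment> \<open>All values lie strictly below \<open>M\<close>, which is
          \<open>t 0\<close>, so the first level not exceeding |f x| has a predecessor.\<close>
        then have "j \<noteq> 0" using j M(2)[of x] by (metis not_le)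
        then obtain i where i: "j = Suc i" by (cases j) auto
        have "\<not> t i \<le> \<bar>f x\<bar>" using not_less_Least[of i "\<lambda>j. t j \<le> \<bar>f x\<bar>"] i j_def by auto
        then have "ennreal (\<bar>f x\<bar> powr p) \<le> ennreal (t i powr p) * indicator {x. \<bar>f x\<bar> \<ge> t (Suc i)} x"
          using j i p2 by (auto intro!: ennreal_leI powr_mono2)
        also have "\<dots> \<le> (\<Sum>j. ennreal (t j powr p) * indicator {x. \<bar>f x\<bar> \<ge> t (Suc j)} x)"
        proof -
          have "T i \<le> (\<Sum>j. T j)" for T :: "nat \<Rightarrow> ennreal" using sum_le_suminf[of T "{i}"] by simp
          then show ?thesis .
        qed
        finally show ?thesis .
      qed simp
    qed
    also have "\<dots> = (\<Sum>j. \<integral>\<^sup>+x. ennreal (t j powr p) * indicator {x. \<bar>f x\<bar> \<ge> t (Suc j)} x \<partial>lborel)"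
      by (rule nn_integral_suminf) measurable
    also have "\<dots> = (\<Sum>j. ennreal (2 powr p * b (Suc j)))"
    proof (rule suminf_cong)
      fix j
      have "emeasure lborel {x. \<bar>f x\<bar> \<ge> t (Suc j)} = ennreal (a (Suc j))"
        unfolding a_def using emeasure_bounded_finite[OF bdd[of "Suc j"]]
        by (intro emeasure_eq_ennreal_measure) auto
      moreover have "t j powr p = 2 powr p * t (Suc j) powr p"
        using t(1)[of j] by (simp add: t(2) powr_divide)
      ultimately show "(\<integral>\<^sup>+x. ennreal (t j powr p) * indicator {x. \<bar>f x\<bar> \<ge> t (Suc j)} x \<partial>lborel)
          = ennreal (2 powr p * b (Suc j))"
        using a by (subst nn_integral_cmult_indicator) (auto simp: b_def ennreal_mult mult.assoc)
    qed
    also have "\<dots> = ennreal (\<Sum>j. 2 powr p * b (Suc j))"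
      using b0 \<open>summable b\<close> by (intro suminf_ennreal2) (auto intro!: summable_mult simp: summable_Suc_iff)
    also have "\<dots> \<le> ennreal (2 powr p * B)"
    proof (rule ennreal_leI)
      have "(\<Sum>j. b (Suc j)) = B - b 0"
        using suminf_split_head[OF \<open>summable b\<close>] by (simp add: B_def)
      then show "(\<Sum>j. 2 powr p * b (Suc j)) \<le> 2 powr p * B"
        using b0[of 0] \<open>summable b\<close> by (subst suminf_mult) (auto simp: summable_Suc_iff)
    qed
    finally have nn: "(\<integral>\<^sup>+x. ennreal (\<bar>f x\<bar> powr p) \<partial>lborel) \<le> ennreal (2 powr p * B)" .
    have "(\<integral>x. \<bar>f x\<bar> powr p \<partial>lborel) \<le> 2 powr p * B"
      using nn B0 by (subst integral_eq_nn_integral) (auto intro: enn2real_leI)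
    also have "\<dots> \<le> 2 powr p * (C1 * \<Gamma>) powr (p / 2)" using B by simp
    also have "\<dots> = K * \<Gamma> powr (p / 2)" using C1 \<Gamma>0 by (simp add: K_def powr_mult mult.assoc)
    finally show ?thesis by (simp add: \<Gamma>_def)
  qed
  moreover have "K > 0" using C1 by (simp add: K_def)
  ultimately show ?thesis by blast
qed

subsection \<open>Test functions\<close>

text \<open>With \<open>q = 1\<close> this is the classical flat function exp(-1/t). Allowing a
  polynomial in 1/t makes the family closed under differentiation.\<close>

definition flat_exp :: "real poly \<Rightarrow> real \<Rightarrow> real" where
  "flat_exp q t = (if t > 0 then poly q (1 / t) * exp (- (1 / t)) else 0)"

lemma poly_over_exp_tendsto_0: "((\<lambda>x::real. poly q x * exp (- x)) \<longlongrightarrow> 0) at_top"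
proof -
  have "((\<lambda>x. \<Sum>i\<le>degree q. coeff q i * (x ^ i / exp x)) \<longlongrightarrow> (\<Sum>i\<le>degree q. coeff q i * 0)) at_top"
    by (intro tendsto_sum tendsto_mult tendsto_const tendsto_power_div_exp_0)
  moreover have "(\<lambda>x. \<Sum>i\<le>degree q. coeff q i * (x ^ i / exp x)) = (\<lambda>x. poly q x * exp (- x))"
    by (simp add: poly_altdef exp_minus sum_distrib_right divide_inverse mult.assoc)
  ultimately show ?thesis by simp
qed

lemma flat_exp_at_right_0: "((\<lambda>t. flat_exp q t) \<longlongrightarrow> 0) (at_right 0)"
proof -
  have "((\<lambda>t::real. poly q (1 / t) * exp (- (1 / t))) \<longlongrightarrow> 0) (at_right 0)"
    by (rule filterlim_compose[OF poly_over_exp_tendsto_0])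
       (use filterlim_inverse_at_top_right in \<open>simp add: inverse_eq_divide\<close>)
  then show ?thesis
    by (rule Lim_transform_eventually)
       (auto simp: flat_exp_def eventually_at_filter intro!: always_eventually)
qed

lemma DERIV_flat_exp:
  "(flat_exp q has_real_derivative flat_exp ([:0,0,1:] * (q - pderiv q)) t) (at t)"
proof (cases t "0::real" rule: linorder_cases)
  case less
  have "((\<lambda>r::real. 0) has_real_derivative flat_exp ([:0,0,1:] * (q - pderiv q)) t) (at t)"
    using less by (auto simp: flat_exp_def intro!: derivative_eq_intros)
  then show ?thesis
    by (rule DERIV_cong_ev[OF refl _ refl, THEN iffD1, rotated])
       (use less in \<open>auto simp: flat_exp_def intro!: eventually_mono[OF eventually_nhds_in_open[of "{..<0}"]]\<close>)
next
  case equal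
  have "((\<lambda>h. flat_exp q h / h) \<longlongrightarrow> 0) (at 0)"
  proof (rule filterlim_split_at)
    have "((\<lambda>_. 0) \<longlongrightarrow> (0::real)) (at_left (0::real))" by simp
    then show "((\<lambda>h. flat_exp q h / h) \<longlongrightarrow> 0) (at_left 0)"
      by (rule Lim_transform_eventually)
         (auto simp: flat_exp_def eventually_at_filter intro!: always_eventually)
    \<comment> \<open>For positive \<open>h\<close>, division by \<open>h\<close> only multiplies
      the polynomial by its variable.\<close>
    show "((\<lambda>h. flat_exp q h / h) \<longlongrightarrow> 0) (at_right 0)"
      by (rule Lim_transform_eventually[OF flat_exp_at_right_0[of "[:0,1:] * q"]])
         (auto simp: flat_exp_def eventually_at_filter intro!: always_eventually)
  qed
  with equal show ?thesis by (simp add: has_field_derivative_iff flat_exp_def)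
next
  case greater
  have "((\<lambda>t::real. poly q (1 / t) * exp (- (1 / t))) has_real_derivative flat_exp ([:0,0,1:] * (q - pderiv q)) t) (at t)"
    using greater
    by (auto simp: flat_exp_def power2_eq_square algebra_simps
        intro!: derivative_eq_intros DERIV_chain2[OF poly_DERIV])
  then show ?thesis
    by (rule DERIV_cong_ev[OF refl _ refl, THEN iffD1, rotated])
       (use greater in \<open>auto simp: flat_exp_def intro!: eventually_mono[OF eventually_nhds_in_open[of "{0<..}"]]\<close>)
qed

text \<open>A class of differentiable functions closed under partial derivatives, so that the
  condition on iterated derivatives in \<open>smooth\<close> follows by induction on the list of
  directions.\<close>

inductive_set flat_exp_algebra :: "(real^'n \<Rightarrow> real) set" where
  base: "(\<lambda>x. flat_exp q (c * x $ i + e)) \<in> flat_exp_algebra"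
| const: "(\<lambda>x. c) \<in> flat_exp_algebra"
| add: "f \<in> flat_exp_algebra \<Longrightarrow> g \<in> flat_exp_algebra \<Longrightarrow> (\<lambda>x. f x + g x) \<in> flat_exp_algebra"
| mult: "f \<in> flat_exp_algebra \<Longrightarrow> g \<in> flat_exp_algebra \<Longrightarrow> (\<lambda>x. f x * g x) \<in> flat_exp_algebra"

lemma partial_deriv_eq:
  "(f has_derivative D) (at x) \<Longrightarrow> partial_deriv i f x = D (axis i 1)"
  unfolding partial_deriv_def by (simp add: frechet_derivative_at[symmetric])

lemma flat_exp_algebra_closed:
  fixes f :: "real^'n \<Rightarrow> real"
  assumes "f \<in> flat_exp_algebra"
  shows "(\<forall>x. f differentiable (at x)) \<and> (\<forall>i. partial_deriv i f \<in> flat_exp_algebra)"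
  using assms
proof induction
  case (base q c i e)
  have D: "((\<lambda>x. flat_exp q (c * x $ i + e)) has_derivative
      (\<lambda>h. flat_exp ([:0,0,1:] * (q - pderiv q)) (c * x $ i + e) * (c * h $ i))) (at x)" for x :: "real^'n"
  proof -
    have "((\<lambda>x::real^'n. c * x $ i + e) has_derivative (\<lambda>h. c * h $ i)) (at x)"
      by (auto intro!: derivative_eq_intros bounded_linear_imp_has_derivative bounded_linear_vec_nth)
    from has_derivative_compose[OF this DERIV_flat_exp[unfolded has_field_derivative_def]]
    show ?thesis .
  qed
  have "partial_deriv j (\<lambda>x. flat_exp q (c * x $ i + e)) =
     (\<lambda>x. flat_exp ([:0,0,1:] * (q - pderiv q)) (c * x $ i + e) * (c * (axis j 1 :: real^'n) $ i))" for j
    by (rule ext) (rule partial_deriv_eq[OF D])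
  then show ?case using D by (auto simp: differentiable_def intro!: flat_exp_algebra.intros simp del: mult_pCons_left)
next
  case (const c)
  have "partial_deriv i (\<lambda>x::real^'n. c) = (\<lambda>x. 0)" for i
    by (rule ext, subst partial_deriv_eq[of _ "\<lambda>h. 0"]) auto
  then show ?case by (auto intro: flat_exp_algebra.intros)
next
  case (add f g)
  have D: "(f has_derivative frechet_derivative f (at x)) (at x)"
    "(g has_derivative frechet_derivative g (at x)) (at x)" for x
    using add by (auto simp: frechet_derivative_works)
  have "partial_deriv i (\<lambda>x. f x + g x) = (\<lambda>x. partial_deriv i f x + partial_deriv i g x)" for i
    by (rule ext, subst partial_deriv_eq[OF has_derivative_add[OF D]]) (simp add: partial_deriv_def)
  then show ?case using add by (auto intro: flat_exp_algebra.intros)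
next
  case (mult f g)
  have D: "(f has_derivative frechet_derivative f (at x)) (at x)"
    "(g has_derivative frechet_derivative g (at x)) (at x)" for x
    using mult by (auto simp: frechet_derivative_works)
  have "partial_deriv i (\<lambda>x. f x * g x) = (\<lambda>x. f x * partial_deriv i g x + partial_deriv i f x * g x)" for i
    by (rule ext, subst partial_deriv_eq[OF has_derivative_mult[OF D]]) (simp add: partial_deriv_def)
  then show ?case using mult by (auto intro!: flat_exp_algebra.intros)
qed

lemma smooth_flat_exp_algebra: "f \<in> flat_exp_algebra \<Longrightarrow> smooth f"
proof -
  assume f: "f \<in> flat_exp_algebra"
  have "foldr partial_deriv ks f \<in> flat_exp_algebra" for ks
    by (induction ks) (use f flat_exp_algebra_closed in auto)
  then show ?thesis unfolding smooth_def using flat_exp_algebra_closed by blast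
qed

text \<open>The parameter \<open>k\<close> sharpens the bump: as it grows, the functions tend to the
  indicator of the open box, while their support stays inside the closed box.\<close>

definition box_bump :: "nat \<Rightarrow> real^'n \<Rightarrow> real^'n \<Rightarrow> real^'n \<Rightarrow> real" where
  "box_bump k a b x = (\<Prod>i\<in>UNIV. flat_exp 1 (real k * (x $ i - a $ i))
     * flat_exp 1 (real k * (b $ i - x $ i)))"

lemma smooth_box_bump: "smooth (box_bump k a b)"
proof -
  have base: "(\<lambda>x. flat_exp 1 (real k * (x $ i - a $ i))) \<in> flat_exp_algebra"
    "(\<lambda>x. flat_exp 1 (real k * (b $ i - x $ i))) \<in> flat_exp_algebra" for i
    using flat_exp_algebra.base[of 1 "real k" i "- real k * a $ i"]
      flat_exp_algebra.base[of 1 "- real k" i "real k * b $ i"]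
    by (simp_all add: algebra_simps)
  have "(\<lambda>x. \<Prod>i\<in>I. flat_exp 1 (real k * (x $ i - a $ i))
     * flat_exp 1 (real k * (b $ i - x $ i))) \<in> flat_exp_algebra" if "finite I" for I :: "'a set"
    using that by induction (auto intro!: flat_exp_algebra.intros(2-4) base)
  then show ?thesis
    unfolding box_bump_def[abs_def] by (intro smooth_flat_exp_algebra) simp
qed

lemma flat_exp_1_bounds: "0 \<le> flat_exp 1 t" "flat_exp 1 t \<le> 1"
  by (auto simp: flat_exp_def)

lemma box_bump_bounds: "0 \<le> box_bump k a b x" "box_bump k a b x \<le> 1"
  unfolding box_bump_def
  by (auto intro!: prod_nonneg prod_le_1 mult_nonneg_nonneg mult_le_one simp: flat_exp_1_bounds simp del: mult_minus_left)

lemma box_bump_eq_0: "x \<notin> box a b \<Longrightarrow> box_bump k a b x = 0"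
proof -
  assume "x \<notin> box a b"
  then obtain i where "x $ i \<le> a $ i \<or> b $ i \<le> x $ i"
    by (auto simp: mem_box_cart not_less)
  then have "real k * (x $ i - a $ i) \<le> 0 \<or> real k * (b $ i - x $ i) \<le> 0"
    by (auto intro: mult_nonneg_nonpos)
  then have "flat_exp 1 (real k * (x $ i - a $ i)) * flat_exp 1 (real k * (b $ i - x $ i)) = 0"
    by (auto simp: flat_exp_def)
  then show ?thesis unfolding box_bump_def by (intro prod_zero) auto
qed

lemma box_bump_pos: "x \<in> box a b \<Longrightarrow> k > 0 \<Longrightarrow> box_bump k a b x > 0"
  unfolding box_bump_def by (intro prod_pos) (auto simp: mem_box_cart flat_exp_def)

lemma box_bump_tendsto: "(\<lambda>k. box_bump k a b x) \<longlonglongrightarrow> indicator (box a b) x"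
proof (cases "x \<in> box a b")
  case True
  have 1: "(\<lambda>k. flat_exp 1 (real k * s)) \<longlonglongrightarrow> 1" if "s > 0" for s
  proof -
    have "(\<lambda>k. exp (- (inverse (real k) * (1 / s)))) \<longlonglongrightarrow> exp (- (0 * (1 / s)))"
      by (intro tendsto_intros lim_inverse_n)
    then have "(\<lambda>k. exp (- (inverse (real k) * (1 / s)))) \<longlonglongrightarrow> 1" by simp
    then show ?thesis
      by (rule Lim_transform_eventually)
         (use that in \<open>auto intro!: eventually_mono[OF eventually_gt_at_top[of 0]] simp: flat_exp_def field_simps\<close>)
  qed
  have "(\<lambda>k. box_bump k a b x) \<longlonglongrightarrow> (\<Prod>i\<in>(UNIV::'a set). 1 * 1)"
    unfolding box_bump_def
  proof (intro tendsto_prod tendsto_mult)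
    fix i
    show "(\<lambda>k. flat_exp 1 (real k * (x $ i - a $ i))) \<longlonglongrightarrow> 1"
      using 1[of "x $ i - a $ i"] True by (auto simp: mem_box_cart algebra_simps)
    show "(\<lambda>k. flat_exp 1 (real k * (b $ i - x $ i))) \<longlonglongrightarrow> 1"
      using 1[of "b $ i - x $ i"] True by (auto simp: mem_box_cart algebra_simps)
  qed
  then show ?thesis using True by simp
qed (simp add: box_bump_eq_0)

lemma box_bump_test_function:
  assumes "cbox a b \<subseteq> \<Omega>"
  shows "box_bump k a b \<in> test_functions \<Omega>"
proof -
  have "closure {x. box_bump k a b x \<noteq> 0} \<subseteq> cbox a b"
    using box_bump_eq_0[of _ a b k] box_subset_cbox[of a b] by (intro closure_minimal) auto
  moreover have "compact (closure {x. box_bump k a b x \<noteq> 0})"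
    using bounded_subset[OF bounded_cbox calculation] unfolding compact_eq_bounded_closed by simp
  ultimately show ?thesis
    using assms smooth_box_bump by (auto simp: test_functions_def)
qed

section \<open>Calculus with test functions\<close>

lemma smooth_linear_combination:
  assumes "smooth f" "smooth g"
  shows "smooth (\<lambda>x. c * f x + e * g x)"
proof -
  have df: "foldr partial_deriv ks f differentiable (at x)" "foldr partial_deriv ks g differentiable (at x)" for ks x
    using assms by (auto simp: smooth_def)
  have eq: "foldr partial_deriv ks (\<lambda>x. c * f x + e * g x)
     = (\<lambda>x. c * foldr partial_deriv ks f x + e * foldr partial_deriv ks g x)" for ks
  proof (induction ks)
    case (Cons k ks)
    let ?f = "foldr partial_deriv ks f" and ?g = "foldr partial_deriv ks g"
    have D: "(?f has_derivative frechet_derivative ?f (at x)) (at x)"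
      "(?g has_derivative frechet_derivative ?g (at x)) (at x)" for x
      using df by (auto simp: frechet_derivative_works)
    have "partial_deriv k (\<lambda>x. c * ?f x + e * ?g x) = (\<lambda>x. c * partial_deriv k ?f x + e * partial_deriv k ?g x)"
      by (rule ext, subst partial_deriv_eq[OF has_derivative_add[OF has_derivative_mult_right[OF D(1)] has_derivative_mult_right[OF D(2)]]])
         (simp add: partial_deriv_def)
    then show ?case using Cons by simp
  qed simp
  show ?thesis
    unfolding smooth_def eq using df by (intro allI derivative_intros) auto
qed

lemma test_functions_support:
  assumes "\<phi> \<in> test_functions \<Omega>" "x \<notin> \<Omega>"
  shows "\<phi> x = 0"
proof -
  have "closure {x. \<phi> x \<noteq> 0} \<subseteq> \<Omega>" using assms(1) by (simp add: test_functions_def)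
  then have "{x. \<phi> x \<noteq> 0} \<subseteq> \<Omega>" by (rule subset_trans[OF closure_subset])
  then show ?thesis using assms(2) by auto
qed

lemma test_functions_linear_combination:
  assumes "\<phi> \<in> test_functions \<Omega>" "\<psi> \<in> test_functions \<Omega>"
  shows "(\<lambda>x. c * \<phi> x + e * \<psi> x) \<in> test_functions \<Omega>"
proof -
  let ?C = "closure {x. \<phi> x \<noteq> 0} \<union> closure {x. \<psi> x \<noteq> 0}"
  have sub: "closure {x. c * \<phi> x + e * \<psi> x \<noteq> 0} \<subseteq> ?C"
    unfolding closure_Un[symmetric] by (rule closure_mono) auto
  have "smooth \<phi>" "smooth \<psi>" "compact ?C" "?C \<subseteq> \<Omega>"
    using assms by (auto simp: test_functions_def intro!: compact_Un)
  moreover have "compact (?C \<inter> closure {x. c * \<phi> x + e * \<psi> x \<noteq> 0})"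
    by (rule compact_Int_closed[OF \<open>compact ?C\<close> closed_closure])
  then have "compact (closure {x. c * \<phi> x + e * \<psi> x \<noteq> 0})"
    by (simp only: Int_absorb1[OF sub])
  ultimately show ?thesis
    using sub smooth_linear_combination[of \<phi> \<psi> c e] unfolding test_functions_def by blast
qed

lemma smooth_has_gradient:
  assumes "smooth \<phi>"
  shows "(\<phi> has_derivative (\<lambda>h. classical_gradient \<phi> x \<bullet> h)) (at x)"
proof -
  have "\<phi> differentiable (at x)" using assms[unfolded smooth_def, rule_format, of "[]"] by simp
  then have D: "(\<phi> has_derivative frechet_derivative \<phi> (at x)) (at x)"
    by (simp add: frechet_derivative_works)
  then interpret bounded_linear "frechet_derivative \<phi> (at x)" by (rule has_derivative_bounded_linear)
  have "frechet_derivative \<phi> (at x) h = classical_gradient \<phi> x \<bullet> h" for h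
  proof -
    have "frechet_derivative \<phi> (at x) h = frechet_derivative \<phi> (at x) (\<Sum>i\<in>UNIV. h $ i *\<^sub>R axis i 1)"
      using basis_expansion[of h] by (simp add: scalar_mult_eq_scaleR)
    also have "\<dots> = (\<Sum>i\<in>UNIV. h $ i * frechet_derivative \<phi> (at x) (axis i 1))"
      by (simp add: sum scaleR)
    finally show ?thesis
      by (simp add: classical_gradient_def partial_deriv_def inner_vec_def mult.commute)
  qed
  then have "frechet_derivative \<phi> (at x) = (\<lambda>h. classical_gradient \<phi> x \<bullet> h)" by (rule ext)
  with D show ?thesis by simp
qed

lemma continuous_classical_gradient:
  assumes "smooth \<phi>"
  shows "continuous_on UNIV (classical_gradient \<phi>)"
proof -
  have "partial_deriv i \<phi> differentiable (at x)" for i x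
    using assms[unfolded smooth_def, rule_format, of "[i]"] by simp
  then have "continuous_on UNIV (partial_deriv i \<phi>)" for i
    by (intro continuous_at_imp_continuous_on ballI differentiable_imp_continuous_within)
  then show ?thesis
    unfolding classical_gradient_def[abs_def] by (intro continuous_on_vec_lambda)
qed

lemma C1c_test_function:
  assumes "\<phi> \<in> test_functions \<Omega>"
  shows "C1c \<phi> (classical_gradient \<phi>)"
proof -
  have "smooth \<phi>" "bounded (closure {x. \<phi> x \<noteq> 0})"
    using assms by (auto simp: test_functions_def compact_imp_bounded)
  moreover have "bounded {x. \<phi> x \<noteq> 0}"
    using calculation(2) closure_subset bounded_subset by blast
  ultimately show ?thesis
    unfolding C1c_def by (auto intro: smooth_has_gradient continuous_classical_gradient)
qed

lemma C1c_gradient_unique: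
  assumes "C1c f G" "C1c f G'"
  shows "G = G'"
proof
  fix x
  have "(\<lambda>h. G x \<bullet> h) = (\<lambda>h. G' x \<bullet> h)"
    using assms by (intro has_derivative_unique[of f _ x]) (auto simp: C1c_def)
  then show "G x = G' x" by (metis inner_commute vector_eq_ldot)
qed

lemma C1c_linear_combination:
  assumes "C1c f F" "C1c g G"
  shows "C1c (\<lambda>x. c * f x + e * g x) (\<lambda>x. c *\<^sub>R F x + e *\<^sub>R G x)"
proof -
  have "bounded {x. c * f x + e * g x \<noteq> 0}"
    by (rule bounded_subset[of "{x. f x \<noteq> 0} \<union> {x. g x \<noteq> 0}"])
       (use assms in \<open>auto simp: C1c_def\<close>)
  then show ?thesis
    using assms unfolding C1c_def
    by (auto intro!: derivative_eq_intros continuous_intros simp: inner_add_left)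
qed

lemma classical_gradient_linear_combination:
  assumes "\<phi> \<in> test_functions \<Omega>" "\<psi> \<in> test_functions \<Omega>"
  shows "classical_gradient (\<lambda>x. c * \<phi> x + e * \<psi> x)
    = (\<lambda>x. c *\<^sub>R classical_gradient \<phi> x + e *\<^sub>R classical_gradient \<psi> x)"
  using C1c_gradient_unique C1c_test_function[OF test_functions_linear_combination[OF assms]]
    C1c_linear_combination[OF assms[THEN C1c_test_function]] by blast

lemma C1c_mult:
  assumes "C1c f F" "C1c g G"
  shows "C1c (\<lambda>x. f x * g x) (\<lambda>x. f x *\<^sub>R G x + g x *\<^sub>R F x)"
proof -
  have "bounded {x. f x * g x \<noteq> 0}"
    by (rule bounded_subset[of "{x. f x \<noteq> 0}"])
       (use assms in \<open>auto simp: C1c_def\<close>)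
  moreover have "((\<lambda>x. f x * g x) has_derivative (\<lambda>h. (f x *\<^sub>R G x + g x *\<^sub>R F x) \<bullet> h)) (at x)" for x
  proof -
    have "(f has_derivative (\<lambda>h. F x \<bullet> h)) (at x)" "(g has_derivative (\<lambda>h. G x \<bullet> h)) (at x)"
      using assms by (auto simp: C1c_def)
    from has_derivative_mult[OF this] show ?thesis
      by (simp add: inner_add_left mult.commute)
  qed
  moreover have "continuous_on UNIV (\<lambda>x. f x *\<^sub>R G x + g x *\<^sub>R F x)"
    using assms[THEN C1c_continuous(1)] assms[THEN C1c_continuous(2)] by (intro continuous_intros)
  ultimately show ?thesis unfolding C1c_def by auto
qed

text \<open>The positive and negative parts of \<open>F\<close> are densities of two measures that
  agree on open boxes. Boxes are stable under intersection and generate the Borel sets, so the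
  measures coincide, and with them the densities almost everywhere.\<close>

lemma integrable_zero_boxes_AE_zero:
  fixes F :: "'a::euclidean_space \<Rightarrow> real"
  assumes F: "integrable lborel F"
    and 0: "\<And>a b. (\<integral>x. indicator (box a b) x * F x \<partial>lborel) = 0"
  shows "AE x in lborel. F x = 0"
proof -
  have [measurable]: "F \<in> borel_measurable borel" using F by auto
  define P where "P x = max 0 (F x)" for x
  define Q where "Q x = max 0 (- F x)" for x
  have [measurable]: "P \<in> borel_measurable borel" "Q \<in> borel_measurable borel"
    unfolding P_def Q_def by measurable
  have PQ: "integrable lborel P" "integrable lborel Q"
    unfolding P_def Q_def using F by auto
  have P0: "P x \<ge> 0" "Q x \<ge> 0" "F x = P x - Q x" for x by (auto simp: P_def Q_def)
  have ind: "integrable lborel (\<lambda>x. indicator (box a b) x * f x)"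
    if "integrable lborel f" for a b and f :: "'a \<Rightarrow> real"
    using integrable_mult_indicator[OF _ that, of "box a b"] by simp
  have em: "emeasure (density lborel (\<lambda>x. ennreal (f x))) (box a b) = ennreal (\<integral>x. indicator (box a b) x * f x \<partial>lborel)"
    if "integrable lborel f" "\<And>x. f x \<ge> 0" for a b and f :: "'a \<Rightarrow> real"
  proof -
    have "emeasure (density lborel (\<lambda>x. ennreal (f x))) (box a b)
      = (\<integral>\<^sup>+x. ennreal (indicator (box a b) x * f x) \<partial>lborel)"
      using that by (subst emeasure_density) (auto simp: ennreal_mult'' mult.commute ennreal_indicator
          intro!: nn_integral_cong split: split_indicator)
    then show ?thesis using ind[OF that(1), of a b] that(2)
      by (subst (asm) nn_integral_eq_integral) auto
  qed
  have "density lborel (\<lambda>x. ennreal (P x)) = density lborel (\<lambda>x. ennreal (Q x))"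
  proof (rule measure_eqI_generator_eq[where E="range (\<lambda>(a, b). box a b)" and \<Omega>=UNIV
        and A="\<lambda>n. box (- (real n *\<^sub>R One)) (real n *\<^sub>R One)"])
    show "Int_stable (range (\<lambda>(a, b). box a b :: 'a set))"
      by (auto simp: Int_stable_def box_Int_box)
    have sb: "sets borel = sigma_sets UNIV (range (\<lambda>(a, b). box a b :: 'a set))"
      by (subst borel_eq_box) simp
    then show "sets (density lborel (\<lambda>x. ennreal (P x))) = sigma_sets UNIV (range (\<lambda>(a, b). box a b))"
      "sets (density lborel (\<lambda>x. ennreal (Q x))) = sigma_sets UNIV (range (\<lambda>(a, b). box a b))"
      by simp_all
    show "(\<Union>n. box (- (real n *\<^sub>R One)) (real n *\<^sub>R One)) = (UNIV::'a set)"
      by (rule UN_box_eq_UNIV)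
    show "range (\<lambda>n. box (- (real n *\<^sub>R One)) (real n *\<^sub>R One)) \<subseteq> range (\<lambda>(a, b). box a b :: 'a set)" by auto
    fix X :: "'a set" assume "X \<in> range (\<lambda>(a, b). box a b)"
    then obtain a b where X: "X = box a b" by auto
    have "(\<integral>x. indicator (box a b) x * P x \<partial>lborel) - (\<integral>x. indicator (box a b) x * Q x \<partial>lborel) = 0"
      using 0[of a b] ind[OF PQ(1)] ind[OF PQ(2)]
      by (subst Bochner_Integration.integral_diff[symmetric]) (auto simp: P0(3) algebra_simps)
    then show "emeasure (density lborel (\<lambda>x. ennreal (P x))) X = emeasure (density lborel (\<lambda>x. ennreal (Q x))) X"
      unfolding X by (simp add: em PQ P0)
  next
    show "emeasure (density lborel (\<lambda>x. ennreal (P x))) (box (- (real n *\<^sub>R One)) (real n *\<^sub>R One)) \<noteq> \<infinity>" for n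
      by (simp add: em PQ P0)
  qed auto
  then have "AE x in lborel. ennreal (P x) = ennreal (Q x)"
    by (subst (asm) sigma_finite_measure.density_unique_iff[OF sigma_finite_lborel]) auto
  then show ?thesis by eventually_elim (use P0 in auto)
qed

subsection \<open>Square integrable functions\<close>

lemma complete_lebesgue_on:
  assumes "S \<in> sets lebesgue"
  shows "complete_measure (lebesgue_on S)"
proof
  fix A B assume "B \<subseteq> A" "A \<in> null_sets (lebesgue_on S)"
  then have "A \<subseteq> S" "A \<in> null_sets lebesgue"
    using null_sets_restrict_space[of S lebesgue A] assms by auto
  with \<open>B \<subseteq> A\<close> have "B \<subseteq> S" "B \<in> sets lebesgue"
    using completion.complete by auto
  then show "B \<in> sets (lebesgue_on S)"
    using assms by (simp add: sets_restrict_space_iff)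
qed

text \<open>Rests on the completeness of the restricted Lebesgue measure. It makes
  \<open>weak_gradient\<close> measurable, since a gradient obtained by choice is pinned down only
  up to a null set.\<close>

lemma borel_measurable_lebesgue_on_AE:
  fixes f g :: "'a::euclidean_space \<Rightarrow> 'b::euclidean_space"
  assumes S: "S \<in> sets lebesgue" and g: "g \<in> borel_measurable (lebesgue_on S)"
    and ae: "AE x in lebesgue_on S. f x = g x"
  shows "f \<in> borel_measurable (lebesgue_on S)"
proof (rule measurableI)
  fix A :: "'b set" assume A: "A \<in> sets borel"
  show "f -` A \<inter> space (lebesgue_on S) \<in> sets (lebesgue_on S)"
  proof (rule complete_measure.in_sets_AE[OF complete_lebesgue_on[OF S]])
    show "g -` A \<inter> space (lebesgue_on S) \<in> sets (lebesgue_on S)"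
      using g A by (rule measurable_sets)
    show "AE x in lebesgue_on S. (x \<in> g -` A \<inter> space (lebesgue_on S)) = (x \<in> f -` A \<inter> space (lebesgue_on S))"
      using ae by eventually_elim auto
  qed auto
qed auto

text \<open>Links the two settings in use: function spaces live over the completed measure on the
  domain, calculus is done with the Borel measure on the whole space.\<close>

lemma integrable_lebesgue_on_iff_lborel:
  fixes f :: "'a::euclidean_space \<Rightarrow> 'b::euclidean_space"
  assumes S: "S \<in> sets lebesgue" and f: "f \<in> borel_measurable borel" and 0: "\<And>x. x \<notin> S \<Longrightarrow> f x = 0"
  shows "integrable (lebesgue_on S) f \<longleftrightarrow> integrable lborel f"
    "(\<integral>x. f x \<partial>lebesgue_on S) = (\<integral>x. f x \<partial>lborel)"
proof -
  have eq: "(\<lambda>x. if x \<in> S then f x else 0) = f" using 0 by auto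
  show "integrable (lebesgue_on S) f \<longleftrightarrow> integrable lborel f"
    using Lebesgue_Measure.integrable_restrict_UNIV[OF S, of f] f by (simp add: eq integrable_completion)
  show "(\<integral>x. f x \<partial>lebesgue_on S) = (\<integral>x. f x \<partial>lborel)"
    using Lebesgue_Measure.integral_restrict_UNIV[OF S, of f] f by (simp add: eq integral_completion)
qed

abbreviation sqnorm :: "(real^'n) set \<Rightarrow> (real^'n \<Rightarrow> 'b::euclidean_space) \<Rightarrow> real" where
  "sqnorm \<Omega> f \<equiv> (\<integral>x. (norm (f x))\<^sup>2 \<partial>lebesgue_on \<Omega>)"

abbreviation ip :: "(real^'n) set \<Rightarrow> (real^'n \<Rightarrow> 'b::euclidean_space) \<Rightarrow> (real^'n \<Rightarrow> 'b) \<Rightarrow> real" where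
  "ip \<Omega> f g \<equiv> (\<integral>x. f x \<bullet> g x \<partial>lebesgue_on \<Omega>)"

lemma L2_D: "f \<in> L2 \<Omega> \<Longrightarrow> f \<in> borel_measurable (lebesgue_on \<Omega>)"
  "f \<in> L2 \<Omega> \<Longrightarrow> integrable (lebesgue_on \<Omega>) (\<lambda>x. (norm (f x))\<^sup>2)"
  by (auto simp: L2_def)

lemma L2_I: "f \<in> borel_measurable (lebesgue_on \<Omega>) \<Longrightarrow> integrable (lebesgue_on \<Omega>) (\<lambda>x. (norm (f x))\<^sup>2) \<Longrightarrow> f \<in> L2 \<Omega>"
  by (auto simp: L2_def)

lemma L2_mult_integrable:
  assumes "f \<in> L2 \<Omega>" "g \<in> L2 \<Omega>"
  shows "integrable (lebesgue_on \<Omega>) (\<lambda>x. norm (f x) * norm (g x))"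
proof (rule Bochner_Integration.integrable_bound)
  show "integrable (lebesgue_on \<Omega>) (\<lambda>x. (norm (f x))\<^sup>2 + (norm (g x))\<^sup>2)"
    using assms by (auto dest: L2_D)
  show "(\<lambda>x. norm (f x) * norm (g x)) \<in> borel_measurable (lebesgue_on \<Omega>)"
    using assms[THEN L2_D(1)] by measurable
  show "AE x in lebesgue_on \<Omega>. norm (norm (f x) * norm (g x)) \<le> norm ((norm (f x))\<^sup>2 + (norm (g x))\<^sup>2)"
  proof (rule AE_I2)
    fix x
    have "2 * (norm (f x) * norm (g x)) \<le> (norm (f x))\<^sup>2 + (norm (g x))\<^sup>2"
      using sum_squares_bound[of "norm (f x)" "norm (g x)"] by (simp add: mult.assoc)
    moreover have "0 \<le> norm (f x) * norm (g x)" by simp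
    ultimately have "norm (f x) * norm (g x) \<le> (norm (f x))\<^sup>2 + (norm (g x))\<^sup>2" by linarith
    then show "norm (norm (f x) * norm (g x)) \<le> norm ((norm (f x))\<^sup>2 + (norm (g x))\<^sup>2)" by simp
  qed
qed

lemma L2_scaled_norm_integrable:
  fixes h :: "real^'n \<Rightarrow> 'c::{banach, second_countable_topology}"
  assumes "f \<in> L2 \<Omega>" "g \<in> L2 \<Omega>" "h \<in> borel_measurable (lebesgue_on \<Omega>)"
    "\<And>x. norm (h x) \<le> norm (f x) * norm (g x)"
  shows "integrable (lebesgue_on \<Omega>) h"
  by (rule Bochner_Integration.integrable_bound[OF L2_mult_integrable[OF assms(1,2)] assms(3)]) (use assms(4) in auto)

lemma L2_inner_integrable:
  "f \<in> L2 \<Omega> \<Longrightarrow> g \<in> L2 \<Omega> \<Longrightarrow> integrable (lebesgue_on \<Omega>) (\<lambda>x. f x \<bullet> g x)"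
  by (rule L2_scaled_norm_integrable[of f _ g]) (auto dest!: L2_D(1) simp: Cauchy_Schwarz_ineq2)

lemma L2_scaleR_integrable:
  fixes f :: "real^'n \<Rightarrow> real"
  shows "f \<in> L2 \<Omega> \<Longrightarrow> g \<in> L2 \<Omega> \<Longrightarrow> integrable (lebesgue_on \<Omega>) (\<lambda>x. f x *\<^sub>R g x)"
  by (rule L2_scaled_norm_integrable[of f _ g]) (auto dest!: L2_D(1))

lemma power2_norm_linear_combination:
  "(norm (c *\<^sub>R x + e *\<^sub>R y))\<^sup>2 = c\<^sup>2 * (norm x)\<^sup>2 + 2 * c * e * (x \<bullet> y) + e\<^sup>2 * (norm y)\<^sup>2"
  unfolding power2_norm_eq_inner
  by (simp add: inner_add_left inner_add_right inner_commute power2_eq_square algebra_simps)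

lemma L2_linear_combination:
  assumes "f \<in> L2 \<Omega>" "g \<in> L2 \<Omega>"
  shows "(\<lambda>x. c *\<^sub>R f x + e *\<^sub>R g x) \<in> L2 \<Omega>"
proof (rule L2_I)
  note [measurable] = assms[THEN L2_D(1)]
  show "(\<lambda>x. c *\<^sub>R f x + e *\<^sub>R g x) \<in> borel_measurable (lebesgue_on \<Omega>)" by measurable
  show "integrable (lebesgue_on \<Omega>) (\<lambda>x. (norm (c *\<^sub>R f x + e *\<^sub>R g x))\<^sup>2)"
    unfolding power2_norm_linear_combination
    by (intro Bochner_Integration.integrable_add integrable_mult_right L2_D(2) L2_inner_integrable assms)
qed

lemma L2_real_linear_combination:
  fixes f g :: "real^'n \<Rightarrow> real"
  shows "f \<in> L2 \<Omega> \<Longrightarrow> g \<in> L2 \<Omega> \<Longrightarrow> (\<lambda>x. c * f x + e * g x) \<in> L2 \<Omega>"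
  using L2_linear_combination[of f \<Omega> g c e] by simp

lemma L2_diff: "f \<in> L2 \<Omega> \<Longrightarrow> g \<in> L2 \<Omega> \<Longrightarrow> (\<lambda>x. f x - g x) \<in> L2 \<Omega>"
  using L2_linear_combination[of f \<Omega> g 1 "-1"] by simp

lemma sqnorm_linear_combination:
  assumes "f \<in> L2 \<Omega>" "g \<in> L2 \<Omega>"
  shows "sqnorm \<Omega> (\<lambda>x. c *\<^sub>R f x + e *\<^sub>R g x) = c\<^sup>2 * sqnorm \<Omega> f + 2 * c * e * ip \<Omega> f g + e\<^sup>2 * sqnorm \<Omega> g"
proof -
  have "sqnorm \<Omega> (\<lambda>x. c *\<^sub>R f x + e *\<^sub>R g x) =
    (\<integral>x. c\<^sup>2 * (norm (f x))\<^sup>2 + 2 * c * e * (f x \<bullet> g x) + e\<^sup>2 * (norm (g x))\<^sup>2 \<partial>lebesgue_on \<Omega>)"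
    unfolding power2_norm_linear_combination ..
  also have "\<dots> = c\<^sup>2 * sqnorm \<Omega> f + 2 * c * e * ip \<Omega> f g + e\<^sup>2 * sqnorm \<Omega> g"
    using assms[THEN L2_D(2)] L2_inner_integrable[OF assms] by simp
  finally show ?thesis .
qed

lemma sqnorm_diff:
  "f \<in> L2 \<Omega> \<Longrightarrow> g \<in> L2 \<Omega> \<Longrightarrow> sqnorm \<Omega> (\<lambda>x. f x - g x) = sqnorm \<Omega> f - 2 * ip \<Omega> f g + sqnorm \<Omega> g"
  using sqnorm_linear_combination[of f \<Omega> g 1 "-1"] by simp

lemma sqnorm_nonneg: "0 \<le> sqnorm \<Omega> f" by simp

text \<open>Formulated for products of norms so that the versions for inner products and for scalar
  multiples both follow. The argument is the discriminant of a nonnegative quadratic form.\<close>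

lemma L2_Cauchy_Schwarz_norm:
  assumes "f \<in> L2 \<Omega>" "g \<in> L2 \<Omega>"
  shows "(\<integral>x. norm (f x) * norm (g x) \<partial>lebesgue_on \<Omega>) \<le> sqrt (sqnorm \<Omega> f) * sqrt (sqnorm \<Omega> g)"
proof -
  define F where "F x = norm (f x)" for x
  define G where "G x = norm (g x)" for x
  have FG: "F \<in> L2 \<Omega>" "G \<in> L2 \<Omega>"
    using assms unfolding F_def G_def by (auto simp: L2_def)
  define A B C where "A = sqnorm \<Omega> F" and "B = ip \<Omega> F G" and "C = sqnorm \<Omega> G"
  have AC: "A \<ge> 0" "C \<ge> 0" by (auto simp: A_def C_def)
  have B0: "B \<ge> 0" by (auto simp: B_def F_def G_def)
  have q: "0 \<le> c\<^sup>2 * A + 2 * c * e * B + e\<^sup>2 * C" for c e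
    using sqnorm_linear_combination[OF FG, of c e] sqnorm_nonneg[of \<Omega> "\<lambda>x. c *\<^sub>R F x + e *\<^sub>R G x"]
    by (simp add: A_def B_def C_def)
  have "B\<^sup>2 \<le> A * C"
  proof (cases "C = 0")
    case True
    have "0 \<le> A + 2 * e * B" for e using q[of 1 e] True by simp
    \<comment> \<open>If \<open>B\<close> were nonzero, this \<open>e\<close> would make the right
      side equal to -1.\<close>
    from this[of "- (A + 1) / (2 * B)"] have "B = 0" by (cases "B = 0") (auto simp: field_simps)
    then show ?thesis using True by simp
  next
    case False
    then have "C > 0" using AC by simp
    have "0 \<le> C\<^sup>2 * A - 2 * C * B * B + B\<^sup>2 * C" using q[of C "- B"] by simp
    then have "0 \<le> C * (A * C - B\<^sup>2)" by (simp add: power2_eq_square algebra_simps)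
    then show ?thesis using \<open>C > 0\<close> by (simp add: zero_le_mult_iff)
  qed
  then have "B \<le> sqrt (A * C)" using real_le_rsqrt by blast
  then show ?thesis by (simp add: A_def B_def C_def F_def G_def real_sqrt_mult)
qed

lemma L2_Cauchy_Schwarz: 
  assumes "f \<in> L2 \<Omega>" "g \<in> L2 \<Omega>"
  shows "\<bar>ip \<Omega> f g\<bar> \<le> sqrt (sqnorm \<Omega> f) * sqrt (sqnorm \<Omega> g)"
proof -
  have "\<bar>ip \<Omega> f g\<bar> \<le> (\<integral>x. \<bar>f x \<bullet> g x\<bar> \<partial>lebesgue_on \<Omega>)" by (rule integral_abs_bound)
  also have "\<dots> \<le> (\<integral>x. norm (f x) * norm (g x) \<partial>lebesgue_on \<Omega>)"
    using assms by (intro integral_mono L2_mult_integrable integrable_abs L2_inner_integrable Cauchy_Schwarz_ineq2)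
  finally show ?thesis using L2_Cauchy_Schwarz_norm[OF assms] by linarith
qed

lemma L2_Cauchy_Schwarz_scaleR: 
  fixes f :: "real^'n \<Rightarrow> real"
  assumes "f \<in> L2 \<Omega>" "g \<in> L2 \<Omega>"
  shows "norm (\<integral>x. f x *\<^sub>R g x \<partial>lebesgue_on \<Omega>) \<le> sqrt (sqnorm \<Omega> f) * sqrt (sqnorm \<Omega> g)"
proof -
  have "norm (\<integral>x. f x *\<^sub>R g x \<partial>lebesgue_on \<Omega>) \<le> (\<integral>x. norm (f x *\<^sub>R g x) \<partial>lebesgue_on \<Omega>)" by (rule integral_norm_bound)
  also have "\<dots> = (\<integral>x. norm (f x) * norm (g x) \<partial>lebesgue_on \<Omega>)" by simp
  finally show ?thesis using L2_Cauchy_Schwarz_norm[OF assms] by linarith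
qed

text \<open>The parallelogram law absorbs the cross term; the factor 2 is the price of working with
  squared norms throughout.\<close>

lemma sqnorm_triangle:
  assumes "f \<in> L2 \<Omega>" "g \<in> L2 \<Omega>" "h \<in> L2 \<Omega>"
  shows "sqnorm \<Omega> (\<lambda>x. f x - h x) \<le> 2 * sqnorm \<Omega> (\<lambda>x. f x - g x) + 2 * sqnorm \<Omega> (\<lambda>x. g x - h x)"
proof -
  note d = L2_diff[OF assms(1,2)] L2_diff[OF assms(2,3)]
  have "sqnorm \<Omega> (\<lambda>x. f x - h x) = sqnorm \<Omega> (\<lambda>x. 1 *\<^sub>R (f x - g x) + 1 *\<^sub>R (g x - h x))" by simp
  also have "\<dots> = sqnorm \<Omega> (\<lambda>x. f x - g x) + 2 * ip \<Omega> (\<lambda>x. f x - g x) (\<lambda>x. g x - h x) + sqnorm \<Omega> (\<lambda>x. g x - h x)"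
    by (subst sqnorm_linear_combination[OF d]) simp
  moreover have "0 \<le> sqnorm \<Omega> (\<lambda>x. f x - g x) - 2 * ip \<Omega> (\<lambda>x. f x - g x) (\<lambda>x. g x - h x) + sqnorm \<Omega> (\<lambda>x. g x - h x)"
    using sqnorm_nonneg[of \<Omega> "\<lambda>x. (f x - g x) - (g x - h x)"] unfolding sqnorm_diff[OF d] .
  ultimately show ?thesis by linarith
qed

lemma sqnorm_commute: "sqnorm \<Omega> (\<lambda>x. f x - g x) = sqnorm \<Omega> (\<lambda>x. g x - f x)"
  by (simp add: norm_minus_commute)

lemma L2_limit_sqnorm:
  assumes "\<And>k. f k \<in> L2 \<Omega>" "g \<in> L2 \<Omega>" "(\<lambda>k::nat. sqnorm \<Omega> (\<lambda>x. g x - f k x)) \<longlonglongrightarrow> 0" "h \<in> L2 \<Omega>"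
  shows "(\<lambda>k. ip \<Omega> (f k) h) \<longlonglongrightarrow> ip \<Omega> g h"
proof -
  have "(\<lambda>k. ip \<Omega> g h - ip \<Omega> (f k) h) \<longlonglongrightarrow> 0"
  proof (rule Lim_null_comparison[OF always_eventually, rule_format])
    fix k
    have "ip \<Omega> g h - ip \<Omega> (f k) h = ip \<Omega> (\<lambda>x. g x - f k x) h"
      using assms by (simp add: inner_diff_left L2_inner_integrable)
    then show "norm (ip \<Omega> g h - ip \<Omega> (f k) h) \<le> sqrt (sqnorm \<Omega> (\<lambda>x. g x - f k x)) * sqrt (sqnorm \<Omega> h)"
      using L2_Cauchy_Schwarz[OF L2_diff[OF assms(2) assms(1)[of k]] assms(4)] by simp
    show "(\<lambda>k. sqrt (sqnorm \<Omega> (\<lambda>x. g x - f k x)) * sqrt (sqnorm \<Omega> h)) \<longlonglongrightarrow> 0"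
      using assms(3) by (auto intro!: tendsto_eq_intros)
  qed
  then have "(\<lambda>k. ip \<Omega> g h - (ip \<Omega> g h - ip \<Omega> (f k) h)) \<longlonglongrightarrow> ip \<Omega> g h - 0"
    by (intro tendsto_diff tendsto_const)
  then show ?thesis by simp
qed

lemma L2_limit_sqnorm_self:
  assumes "\<And>k. f k \<in> L2 \<Omega>" "g \<in> L2 \<Omega>" "(\<lambda>k::nat. sqnorm \<Omega> (\<lambda>x. g x - f k x)) \<longlonglongrightarrow> 0"
  shows "(\<lambda>k. sqnorm \<Omega> (f k)) \<longlonglongrightarrow> sqnorm \<Omega> g"
proof -
  have "(\<lambda>k. sqnorm \<Omega> (\<lambda>x. g x - f k x) + 2 * ip \<Omega> (f k) g - sqnorm \<Omega> g) \<longlonglongrightarrow> 0 + 2 * ip \<Omega> g g - sqnorm \<Omega> g"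
    by (intro tendsto_intros assms L2_limit_sqnorm)
  moreover have "sqnorm \<Omega> (\<lambda>x. g x - f k x) + 2 * ip \<Omega> (f k) g - sqnorm \<Omega> g = sqnorm \<Omega> (f k)" for k
    by (subst sqnorm_diff[OF assms(2,1)]) (simp add: inner_commute)
  ultimately show ?thesis by (simp add: power2_norm_eq_inner)
qed

lemma L2_subseq_AE:
  assumes "\<And>k. f k \<in> L2 \<Omega>" "g \<in> L2 \<Omega>" "(\<lambda>k::nat. sqnorm \<Omega> (\<lambda>x. g x - f k x)) \<longlonglongrightarrow> 0"
  obtains r where "strict_mono (r::nat\<Rightarrow>nat)" "AE x in lebesgue_on \<Omega>. (\<lambda>k. f (r k) x) \<longlonglongrightarrow> g x"
proof -
  obtain r :: "nat \<Rightarrow> nat" where r: "strict_mono r" "AE x in lebesgue_on \<Omega>. (\<lambda>k. (norm (g x - f (r k) x))\<^sup>2) \<longlonglongrightarrow> 0"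
    using tendsto_L1_AE_subseq[of "lebesgue_on \<Omega>" "\<lambda>k x. (norm (g x - f k x))\<^sup>2"] assms
      L2_D(2)[OF L2_diff[OF assms(2) assms(1)]] by auto
  from r(2) have "AE x in lebesgue_on \<Omega>. (\<lambda>k. f (r k) x) \<longlonglongrightarrow> g x"
  proof eventually_elim
    case (elim x)
    then have "(\<lambda>k. sqrt ((norm (g x - f (r k) x))\<^sup>2)) \<longlonglongrightarrow> sqrt 0" by (rule tendsto_real_sqrt)
    then have "(\<lambda>k. g x - f (r k) x) \<longlonglongrightarrow> 0" by (simp add: tendsto_norm_zero_iff)
    then have "(\<lambda>k. g x - (g x - f (r k) x)) \<longlonglongrightarrow> g x - 0" by (intro tendsto_intros)
    then show ?case by simp
  qed
  with r(1) show ?thesis by (rule that)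
qed

text \<open>The terms of a convergent series are bounded, which already forces \<open>d k\<close> to
  decay like 2^(-k/2).\<close>

lemma summable_sqrt_geometric:
  fixes d :: "nat \<Rightarrow> real"
  assumes "summable (\<lambda>k. 2 ^ k * (d k)\<^sup>2)"
  shows "summable d"
proof -
  have "bounded (range (\<lambda>k. 2 ^ k * (d k)\<^sup>2))"
    using summable_imp_bounded[OF assms] .
  then obtain C where C: "C > 0" "\<And>k. 2 ^ k * (d k)\<^sup>2 \<le> C"
    unfolding bounded_pos by (auto simp: abs_le_iff)
  have "norm (d k) \<le> sqrt C * (sqrt (1/2)) ^ k" for k
  proof -
    have "(d k)\<^sup>2 \<le> C * (1/2) ^ k" using C(2)[of k] by (simp add: field_simps power_one_over)
    then have "sqrt ((d k)\<^sup>2) \<le> sqrt (C * (1/2) ^ k)" by (rule real_sqrt_le_mono)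
    then show ?thesis by (simp only: real_sqrt_abs real_sqrt_mult real_sqrt_power[of "1/2"] real_norm_def)
  qed
  moreover have "summable (\<lambda>k. sqrt C * (sqrt (1/2)) ^ k)"
    by (intro summable_mult summable_geometric) (simp add: real_sqrt_divide)
  ultimately show ?thesis by (intro summable_comparison_test'[where g = "\<lambda>k. sqrt C * (sqrt (1/2)) ^ k" and N = 0 and f = d])
qed

text \<open>Riesz-Fischer. Along a subsequence the squared increments are at most 4^(-k) and remain
  summable after weighting with 2^k. The weighted sum is finite almost everywhere, which gives
  absolute convergence at almost every point, and Fatou's lemma turns the pointwise limit into a
  limit in L2.\<close>

theorem L2_complete:
  fixes f :: "nat \<Rightarrow> real^'n \<Rightarrow> 'b::euclidean_space"
  assumes f: "\<And>k. f k \<in> L2 \<Omega>"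
    and cauchy: "\<And>e. e > 0 \<Longrightarrow> \<exists>N. \<forall>m\<ge>N. \<forall>n\<ge>N. sqnorm \<Omega> (\<lambda>x. f m x - f n x) < e"
  obtains g where "g \<in> L2 \<Omega>" "(\<lambda>k. sqnorm \<Omega> (\<lambda>x. g x - f k x)) \<longlonglongrightarrow> 0"
proof -
  let ?M = "lebesgue_on \<Omega>"
  note [measurable] = L2_D(1)[OF f]
  have "\<exists>N. \<forall>k. \<forall>m\<ge>N k. \<forall>n\<ge>N k. sqnorm \<Omega> (\<lambda>x. f m x - f n x) < (1/4) ^ k"
    using cauchy by (intro choice allI) simp
  then obtain N where N: "\<And>k m n. m \<ge> N k \<Longrightarrow> n \<ge> N k \<Longrightarrow> sqnorm \<Omega> (\<lambda>x. f m x - f n x) < (1/4) ^ k"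
    by auto
  \<comment> \<open>Summing the thresholds makes \<open>r\<close> increasing and at least
    \<open>N k\<close> at the same time.\<close>
  define r where "r k = (\<Sum>i\<le>k. N i) + k" for k
  have rN: "r k \<ge> N k" for k
    unfolding r_def using member_le_sum[of k "{..k}" N] by simp
  have r_Suc: "r (Suc k) \<ge> r k" "r k \<ge> k" for k by (auto simp: r_def)
  have mono: "r j \<ge> r i" if "i \<le> j" for i j
    using lift_Suc_mono_le[of r, OF r_Suc(1) that] .
  define D where "D k x = f (r (Suc k)) x - f (r k) x" for k x
  have DL2: "D k \<in> L2 \<Omega>" for k unfolding D_def by (intro L2_diff f)
  have Dk: "sqnorm \<Omega> (D k) \<le> (1/4) ^ k" for k
    unfolding D_def using N[of k "r (Suc k)" "r k"] rN[of k] r_Suc(1)[of k] by simp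
  have "(\<integral>\<^sup>+x. (\<Sum>k. ennreal (2 ^ k * (norm (D k x))\<^sup>2)) \<partial>?M) = (\<Sum>k. \<integral>\<^sup>+x. ennreal (2 ^ k * (norm (D k x))\<^sup>2) \<partial>?M)"
    unfolding D_def by (rule nn_integral_suminf) measurable
  also have "\<dots> = (\<Sum>k. ennreal (2 ^ k * sqnorm \<Omega> (D k)))"
    using L2_D(2)[OF DL2] by (intro suminf_cong) (subst nn_integral_eq_integral, auto)
  also have "\<dots> \<le> (\<Sum>k. ennreal ((1/2) ^ k))"
  proof (intro suminf_le ennreal_leI)
    fix k
    have "2 ^ k * sqnorm \<Omega> (D k) \<le> 2 ^ k * (1/4) ^ k" using Dk[of k] by simp
    also have "\<dots> = (1/2) ^ k" by (simp add: power_mult_distrib[symmetric])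
    finally show "2 ^ k * sqnorm \<Omega> (D k) \<le> (1/2) ^ k" .
  qed auto
  also have "\<dots> = ennreal (\<Sum>k. (1/2) ^ k)"
    by (intro suminf_ennreal2) auto
  finally have "(\<integral>\<^sup>+x. (\<Sum>k. ennreal (2 ^ k * (norm (D k x))\<^sup>2)) \<partial>?M) \<noteq> \<infinity>"
    by (metis ennreal_neq_top infinity_ennreal_def neq_top_trans)
  then have "AE x in ?M. (\<Sum>k. ennreal (2 ^ k * (norm (D k x))\<^sup>2)) \<noteq> \<infinity>"
    unfolding D_def by (intro nn_integral_PInf_AE) measurable
  then have conv: "AE x in ?M. convergent (\<lambda>k. f (r k) x)"
  proof eventually_elim
    case (elim x)
    then have "summable (\<lambda>k. 2 ^ k * (norm (D k x))\<^sup>2)"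
      by (intro summable_suminf_not_top) auto
    then have "summable (\<lambda>k. norm (D k x))" by (rule summable_sqrt_geometric)
    then have "summable (\<lambda>k. D k x)" by (rule summable_norm_cancel)
    then have "convergent (\<lambda>k. f (r 0) x + (\<Sum>i<k. D i x))"
      by (intro convergent_add convergent_const) (simp add: summable_iff_convergent)
    moreover have "f (r 0) x + (\<Sum>i<k. D i x) = f (r k) x" for k
      unfolding D_def by (subst sum_lessThan_telescope) simp
    ultimately show ?case by simp
  qed
  define g where "g x = lim (\<lambda>k. f (r k) x)" for x
  have [measurable]: "g \<in> borel_measurable ?M"
    unfolding g_def by (rule borel_measurable_lim_metric) measurable
  have lim: "AE x in ?M. (\<lambda>k. f (r k) x) \<longlonglongrightarrow> g x"
    using conv by eventually_elim (simp add: g_def convergent_LIMSEQ_iff)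
  \<comment> \<open>Fatou in the index of the subsequence: the Cauchy bound between
    \<open>f n\<close> and later terms passes to the limit \<open>g\<close>.\<close>
  have bound: "(\<integral>\<^sup>+x. ennreal ((norm (g x - f n x))\<^sup>2) \<partial>?M) \<le> ennreal ((1/4) ^ k)" if n: "n \<ge> N k" for n k
  proof -
    have "(\<integral>\<^sup>+x. ennreal ((norm (g x - f n x))\<^sup>2) \<partial>?M) = (\<integral>\<^sup>+x. liminf (\<lambda>i. ennreal ((norm (f (r i) x - f n x))\<^sup>2)) \<partial>?M)"
    proof (rule nn_integral_cong_AE)
      show "AE x in ?M. ennreal ((norm (g x - f n x))\<^sup>2) = liminf (\<lambda>i. ennreal ((norm (f (r i) x - f n x))\<^sup>2))"
        using lim
      proof eventually_elim
        case (elim x)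
        then have "(\<lambda>i. ennreal ((norm (f (r i) x - f n x))\<^sup>2)) \<longlonglongrightarrow> ennreal ((norm (g x - f n x))\<^sup>2)"
          by (intro tendsto_intros)
        then show ?case by (rule lim_imp_Liminf[OF sequentially_bot, symmetric])
      qed
    qed
    also have "\<dots> \<le> liminf (\<lambda>i. \<integral>\<^sup>+x. ennreal ((norm (f (r i) x - f n x))\<^sup>2) \<partial>?M)"
      by (intro nn_integral_liminf) measurable
    also have "\<dots> \<le> ennreal ((1/4) ^ k)"
    proof (rule Liminf_le)
      show "\<forall>\<^sub>F i in sequentially. (\<integral>\<^sup>+x. ennreal ((norm (f (r i) x - f n x))\<^sup>2) \<partial>?M) \<le> ennreal ((1/4) ^ k)"
        using eventually_ge_at_top[of k]
      proof eventually_elim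
        case (elim i)
        then have "r i \<ge> N k" using mono[of k i] rN[of k] by simp
        then show ?case
          using N[of k "r i" n] n L2_D(2)[OF L2_diff[OF f f]]
          by (subst nn_integral_eq_integral) (auto intro!: ennreal_leI)
      qed
    qed simp
    finally show ?thesis .
  qed
  have gf: "(\<lambda>x. g x - f n x) \<in> L2 \<Omega>" if "n \<ge> N k" for n k
  proof (rule L2_I)
    show "integrable ?M (\<lambda>x. (norm (g x - f n x))\<^sup>2)"
    proof (rule integrableI_bounded)
      have "(\<integral>\<^sup>+x. ennreal ((norm (g x - f n x))\<^sup>2) \<partial>?M) < \<infinity>"
        using bound[OF that] by (rule order.strict_trans1) simp
      then show "(\<integral>\<^sup>+x. ennreal (norm ((norm (g x - f n x))\<^sup>2)) \<partial>?M) < \<infinity>" by simp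
    qed measurable
  qed measurable
  have sq: "sqnorm \<Omega> (\<lambda>x. g x - f n x) \<le> (1/4) ^ k" if "n \<ge> N k" for n k
    using bound[OF that] L2_D(2)[OF gf[OF that]]
    by (subst (asm) nn_integral_eq_integral) auto
  have gL2: "g \<in> L2 \<Omega>"
    using L2_linear_combination[OF gf[OF rN[of 0]] f[of "r 0"], of 1 1] by simp
  moreover have "(\<lambda>n. sqnorm \<Omega> (\<lambda>x. g x - f n x)) \<longlonglongrightarrow> 0"
  proof (rule LIMSEQ_I)
    fix e :: real assume "e > 0"
    then obtain k where k: "(1/4) ^ k < e" using real_arch_pow_inv[of e "1/4"] by auto
    then have "\<forall>n\<ge>N k. norm (sqnorm \<Omega> (\<lambda>x. g x - f n x) - 0) < e"
      using sq by (auto intro: order.strict_trans1)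
    then show "\<exists>no. \<forall>n\<ge>no. norm (sqnorm \<Omega> (\<lambda>x. g x - f n x) - 0) < e" by blast
  qed
  ultimately show ?thesis by (rule that)
qed

subsection \<open>Weak gradients\<close>

lemma open_sets_lebesgue: "open S \<Longrightarrow> S \<in> sets lebesgue"
  by (simp add: borel_open sets_completionI_sets)

text \<open>Constants are integrable on compact sets, and the norm of \<open>f\<close> is at most 1
  plus its square.\<close>

lemma L2_locally_integrable:
  assumes "open \<Omega>" "f \<in> L2 \<Omega>"
  shows "locally_integrable \<Omega> f"
  unfolding locally_integrable_def
proof (intro allI impI)
  fix K assume K: "compact K \<and> K \<subseteq> \<Omega>"
  then have Km: "K \<in> sets lebesgue" by (simp add: borel_compact sets_completionI_sets)
  have fm: "f \<in> borel_measurable (lebesgue_on K)"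
    using measurable_restrict_mono[OF L2_D(1)[OF assms(2)]] K by blast
  have "integrable lebesgue (\<lambda>x. if x \<in> \<Omega> then (norm (f x))\<^sup>2 else 0)"
    using L2_D(2)[OF assms(2)] open_sets_lebesgue[OF assms(1)]
    by (simp add: Lebesgue_Measure.integrable_restrict_UNIV)
  then have "integrable (lebesgue_on K) (\<lambda>x. if x \<in> \<Omega> then (norm (f x))\<^sup>2 else 0)"
    using Km integrable_mult_indicator[of K lebesgue "\<lambda>x. if x \<in> \<Omega> then (norm (f x))\<^sup>2 else 0"]
    by (simp add: integrable_restrict_space)
  then have "integrable (lebesgue_on K) (\<lambda>x. (norm (f x))\<^sup>2)"
    by (rule Bochner_Integration.integrable_cong[THEN iffD1, OF refl, rotated]) (use K in auto)
  moreover have "integrable (lebesgue_on K) (\<lambda>x. 1::real)"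
  proof -
    have "K \<in> sets borel" using K by (simp add: borel_compact)
    moreover have "emeasure lborel K < \<infinity>" using K by (intro emeasure_bounded_finite compact_imp_bounded) simp
    ultimately show ?thesis using Km by (simp add: integrable_iff_bounded emeasure_restrict_space)
  qed
  ultimately have "integrable (lebesgue_on K) (\<lambda>x. 1 + (norm (f x))\<^sup>2)"
    by (rule Bochner_Integration.integrable_add[rotated])
  then show "integrable (lebesgue_on K) f"
  proof (rule Bochner_Integration.integrable_bound[OF _ fm], intro AE_I2)
    fix x
    have "2 * norm (f x) \<le> 1 + (norm (f x))\<^sup>2" using sum_squares_bound[of 1 "norm (f x)"] by simp
    moreover have "0 \<le> norm (f x)" by simp
    ultimately have "norm (f x) \<le> 1 + (norm (f x))\<^sup>2" by linarith
    then show "norm (f x) \<le> norm (1 + (norm (f x))\<^sup>2)" by simp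
  qed
qed

lemma test_function_borel [measurable]:
  assumes "\<phi> \<in> test_functions \<Omega>"
  shows "\<phi> \<in> borel_measurable borel" "classical_gradient \<phi> \<in> borel_measurable borel"
  using C1c_continuous[OF C1c_test_function[OF assms]] by (auto intro: borel_measurable_continuous_onI)

lemma test_function_gradient_support:
  assumes "\<phi> \<in> test_functions \<Omega>" "x \<notin> \<Omega>"
  shows "classical_gradient \<phi> x = 0"
proof -
  let ?S = "- closure {x. \<phi> x \<noteq> 0}"
  have "closure {x. \<phi> x \<noteq> 0} \<subseteq> \<Omega>" using assms(1) by (simp add: test_functions_def)
  then have x: "x \<in> ?S" using assms(2) by auto
  have f0: "\<phi> y = 0" if "y \<in> ?S" for y
    using that closure_subset[of "{x. \<phi> x \<noteq> 0}"] by auto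
  have "(\<phi> has_derivative (\<lambda>h. 0)) (at x)"
  proof (rule has_derivative_transform_within_open[of "\<lambda>_. 0" "\<lambda>h. 0" x UNIV ?S])
    show "open ?S" by (intro open_Compl closed_closure)
    show "0 = \<phi> y" if "y \<in> ?S" for y using f0[OF that] by simp
  qed (use x in simp_all)
  moreover have "(\<phi> has_derivative (\<lambda>h. classical_gradient \<phi> x \<bullet> h)) (at x)"
    using C1c_test_function[OF assms(1)] by (simp add: C1c_def)
  ultimately have "(\<lambda>h. classical_gradient \<phi> x \<bullet> h) = (\<lambda>h. 0)" by (rule has_derivative_unique[rotated])
  then have "classical_gradient \<phi> x \<bullet> classical_gradient \<phi> x = 0" by (rule fun_cong)
  then show ?thesis by simp
qed

lemma borel_measurable_lebesgue_onI:
  "f \<in> borel_measurable borel \<Longrightarrow> f \<in> borel_measurable (lebesgue_on S)"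
  by (intro measurable_restrict_space1 measurable_completion) simp

lemma test_function_sqnorm:
  assumes \<Omega>: "open \<Omega>" and \<phi>: "\<phi> \<in> test_functions \<Omega>"
  shows "sqnorm \<Omega> \<phi> = (\<integral>x. (\<phi> x)\<^sup>2 \<partial>lborel)"
    "sqnorm \<Omega> (classical_gradient \<phi>) = (\<integral>x. (norm (classical_gradient \<phi> x))\<^sup>2 \<partial>lborel)"
    "\<phi> \<in> L2 \<Omega>" "classical_gradient \<phi> \<in> L2 \<Omega>"
proof -
  note S = open_sets_lebesgue[OF \<Omega>]
  note [measurable] = test_function_borel[OF \<phi>]
  note supp = test_functions_support[OF \<phi>] test_function_gradient_support[OF \<phi>]
  note sq = C1c_integrable_square[OF C1c_test_function[OF \<phi>]]
  note m = borel_measurable_lebesgue_onI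
  show "sqnorm \<Omega> \<phi> = (\<integral>x. (\<phi> x)\<^sup>2 \<partial>lborel)"
    by (subst integrable_lebesgue_on_iff_lborel(2)[OF S]) (auto simp: supp)
  show "sqnorm \<Omega> (classical_gradient \<phi>) = (\<integral>x. (norm (classical_gradient \<phi> x))\<^sup>2 \<partial>lborel)"
    by (subst integrable_lebesgue_on_iff_lborel(2)[OF S]) (auto simp: supp)
  show "\<phi> \<in> L2 \<Omega>" unfolding L2_def using sq(1)
    by (auto intro!: m simp: supp integrable_lebesgue_on_iff_lborel(1)[OF S])
  show "classical_gradient \<phi> \<in> L2 \<Omega>" unfolding L2_def using sq(2)
    by (auto intro!: m simp: supp integrable_lebesgue_on_iff_lborel(1)[OF S])
qed

section \<open>The fundamental lemma of the calculus of variations\<close>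

lemma compactly_supported_times_locally_integrable:
  fixes g :: "real^'n \<Rightarrow> 'b::euclidean_space"
  assumes \<Omega>: "open \<Omega>" and \<phi>: "\<phi> \<in> test_functions \<Omega>" and g: "locally_integrable \<Omega> g"
  shows "integrable (lebesgue_on \<Omega>) (\<lambda>x. \<phi> x *\<^sub>R g x)"
proof -
  define K where "K = closure {x. \<phi> x \<noteq> 0}"
  have K: "compact K" "K \<subseteq> \<Omega>" using \<phi> by (auto simp: test_functions_def K_def)
  have Km: "K \<in> sets lebesgue" using K by (simp add: borel_compact sets_completionI_sets)
  have 0: "\<phi> x = 0" if "x \<notin> K" for x
    using that closure_subset[of "{x. \<phi> x \<noteq> 0}"] by (auto simp: K_def)
  have cont: "continuous_on UNIV \<phi>" using C1c_continuous C1c_test_function[OF \<phi>] by blast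
  have "bounded (\<phi> ` K)"
    using K by (intro compact_imp_bounded compact_continuous_image continuous_on_subset[OF cont]) auto
  then obtain L where L: "L > 0" "\<And>x. x \<in> K \<Longrightarrow> \<bar>\<phi> x\<bar> \<le> L" unfolding bounded_pos by auto
  have gK: "integrable (lebesgue_on K) g" using g K by (simp add: locally_integrable_def)
  have "integrable (lebesgue_on K) (\<lambda>x. \<phi> x *\<^sub>R g x)"
  proof (rule Bochner_Integration.integrable_bound[of _ "\<lambda>x. L *\<^sub>R norm (g x)"])
    show "integrable (lebesgue_on K) (\<lambda>x. L *\<^sub>R norm (g x))" using gK by simp
    have "\<phi> \<in> borel_measurable (lebesgue_on K)"
      using test_function_borel(1)[OF \<phi>] by (intro measurable_restrict_space1 measurable_completion) simp
    then show "(\<lambda>x. \<phi> x *\<^sub>R g x) \<in> borel_measurable (lebesgue_on K)" using gK by measurable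
    show "AE x in lebesgue_on K. norm (\<phi> x *\<^sub>R g x) \<le> norm (L *\<^sub>R norm (g x))"
      using L by (intro AE_I2) (auto simp: intro!: mult_right_mono)
  qed
  then have "integrable lebesgue (\<lambda>x. if x \<in> K then \<phi> x *\<^sub>R g x else 0)"
    using Km by (simp add: Lebesgue_Measure.integrable_restrict_UNIV)
  also have "(\<lambda>x. if x \<in> K then \<phi> x *\<^sub>R g x else 0) = (\<lambda>x. if x \<in> \<Omega> then \<phi> x *\<^sub>R g x else 0)"
    using 0 K(2) by (intro ext) auto
  finally show ?thesis
    using open_sets_lebesgue[OF \<Omega>] by (simp add: Lebesgue_Measure.integrable_restrict_UNIV)
qed

text \<open>Test functions approximate indicators of boxes, so \<open>g\<close> integrates to zero over small boxes.\<close>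

lemma fundamental_lemma_box:
  fixes g :: "real^'n \<Rightarrow> real"
  assumes \<Omega>: "open \<Omega>" and g: "locally_integrable \<Omega> g"
    and 0: "\<And>\<phi>. \<phi> \<in> test_functions \<Omega> \<Longrightarrow> (\<integral>x. \<phi> x * g x \<partial>lebesgue_on \<Omega>) = 0"
    and box: "cbox c d \<subseteq> \<Omega>"
  shows "AE x in lebesgue. x \<in> box c d \<longrightarrow> g x = 0"
proof -
  note S = open_sets_lebesgue[OF \<Omega>]
  have Km: "cbox c d \<in> sets lebesgue" by (simp add: sets_completionI_sets)
  have gK: "integrable lebesgue (\<lambda>x. if x \<in> cbox c d then g x else 0)"
    using g box Km by (simp add: locally_integrable_def Lebesgue_Measure.integrable_restrict_UNIV)
  \<comment> \<open>\<open>G\<close> is a Borel version of \<open>g\<close> cut off to the closed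
    box, so that the criterion by integrals over boxes applies to it.\<close>
  then obtain G where [measurable]: "G \<in> borel_measurable borel"
    and G: "AE x in lborel. (if x \<in> cbox c d then g x else 0) = G x"
    using completion_ex_borel_measurable_real[of "\<lambda>x. if x \<in> cbox c d then g x else 0" lborel]
    by (auto dest: borel_measurable_integrable)
  have G': "AE x in lebesgue. (if x \<in> cbox c d then g x else 0) = G x"
    using G by (rule AE_completion)
  have iG: "integrable lebesgue G"
    by (rule Bochner_Integration.integrable_cong_AE[THEN iffD1, OF _ _ G' gK])
       (use gK in \<open>auto intro: measurable_completion\<close>)
  then have iG': "integrable lborel G" by (simp add: integrable_completion)
  have ind: "integrable lborel (\<lambda>x. indicator (box a b) x * F x)"
    if "integrable lborel F" for a b and F :: "real^'n \<Rightarrow> real"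
    using integrable_mult_indicator[OF _ that, of "box a b"] by simp
  have "AE x in lborel. indicator (box c d) x * G x = 0"
  proof (rule integrable_zero_boxes_AE_zero[OF ind[OF iG']])
    fix a b :: "real^'n"
    \<comment> \<open>The intersection of two boxes is again a box, here with closure inside the
      domain, so its bumps are admissible test functions.\<close>
    obtain a' b' where ab: "cbox a b \<inter> cbox c d = cbox a' b'" "box a b \<inter> box c d = box a' b'"
      unfolding Int_interval box_Int_box by blast
    have sub: "cbox a' b' \<subseteq> cbox c d" "cbox a' b' \<subseteq> \<Omega>" "box a' b' \<subseteq> cbox c d"
      using ab(1) box box_subset_cbox[of a' b'] by auto
    have z: "(\<integral>x. box_bump k a' b' x * G x \<partial>lborel) = 0" for k
    proof -
      have bt: "box_bump k a' b' \<in> test_functions \<Omega>" by (rule box_bump_test_function[OF sub(2)])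
      note [measurable] = test_function_borel(1)[OF bt]
      have "(\<integral>x. box_bump k a' b' x * G x \<partial>lborel) = (\<integral>x. box_bump k a' b' x * G x \<partial>lebesgue)"
        by (rule integral_completion[symmetric]) measurable
      also have "\<dots> = (\<integral>x. (if x \<in> \<Omega> then box_bump k a' b' x * g x else 0) \<partial>lebesgue)"
      proof (rule integral_cong_AE)
        show "AE x in lebesgue. box_bump k a' b' x * G x = (if x \<in> \<Omega> then box_bump k a' b' x * g x else 0)"
          using G'
        proof eventually_elim
          case (elim x)
          show ?case
          proof (cases "x \<in> box a' b'")
            case True
            then have "x \<in> cbox c d" "x \<in> \<Omega>" using sub box by blast+
            then show ?thesis using elim by simp
          qed (simp add: box_bump_eq_0)
        qed
        show "(\<lambda>x. box_bump k a' b' x * G x) \<in> borel_measurable lebesgue"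
          by (rule measurable_completion) measurable
        have "integrable (lebesgue_on \<Omega>) (\<lambda>x. box_bump k a' b' x *\<^sub>R g x)"
          by (rule compactly_supported_times_locally_integrable[OF \<Omega> bt g])
        then show "(\<lambda>x. if x \<in> \<Omega> then box_bump k a' b' x * g x else 0) \<in> borel_measurable lebesgue"
          using Lebesgue_Measure.integrable_restrict_UNIV[OF S, of "\<lambda>x. box_bump k a' b' x * g x"]
          by (intro borel_measurable_integrable[of lebesgue]) simp
      qed
      also have "\<dots> = (\<integral>x. box_bump k a' b' x * g x \<partial>lebesgue_on \<Omega>)"
        by (rule Lebesgue_Measure.integral_restrict_UNIV[OF S])
      also have "\<dots> = 0" by (rule 0[OF bt])
      finally show ?thesis .
    qed
    have "(\<lambda>k. \<integral>x. box_bump k a' b' x * G x \<partial>lborel) \<longlonglongrightarrow> (\<integral>x. indicator (box a' b') x * G x \<partial>lborel)"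
    proof (rule integral_dominated_convergence[where w="\<lambda>x. norm (G x)"])
      show "AE x in lborel. (\<lambda>k. box_bump k a' b' x * G x) \<longlonglongrightarrow> indicator (box a' b') x * G x"
        by (intro AE_I2 tendsto_mult box_bump_tendsto tendsto_const)
      show "AE x in lborel. norm (box_bump k a' b' x * G x) \<le> norm (G x)" for k
        using box_bump_bounds[of k a' b'] by (intro AE_I2) (auto simp: abs_mult mult_left_le_one_le)
      show "(\<lambda>x. box_bump k a' b' x * G x) \<in> borel_measurable lborel" for k
        using test_function_borel(1)[OF box_bump_test_function[OF sub(2)]] by measurable
    qed (use iG' in auto)
    then have "(\<integral>x. indicator (box a' b') x * G x \<partial>lborel) = 0"
      by (simp add: z LIMSEQ_const_iff)
    then show "(\<integral>x. indicator (box a b) x * (indicator (box c d) x * G x) \<partial>lborel) = 0"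
      unfolding ab(2)[symmetric] indicator_inter_arith by (simp add: mult.assoc)
  qed
  then have "AE x in lebesgue. indicator (box c d) x * G x = 0" by (rule AE_completion)
  with G' show ?thesis
  proof eventually_elim
    case (elim x)
    then show ?case using box_subset_cbox[of c d] by auto
  qed
qed

text \<open>An open set is a countable union of closed boxes, whose boundaries are null sets; on
  each box the scalar version is applied to every component.\<close>

lemma fundamental_lemma:
  fixes g :: "real^'n \<Rightarrow> 'b::euclidean_space"
  assumes \<Omega>: "open \<Omega>" and g: "locally_integrable \<Omega> g"
    and 0: "\<And>\<phi>. \<phi> \<in> test_functions \<Omega> \<Longrightarrow> (\<integral>x. \<phi> x *\<^sub>R g x \<partial>lebesgue_on \<Omega>) = 0"
  shows "AE x in lebesgue_on \<Omega>. g x = 0"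
proof -
  note S = open_sets_lebesgue[OF \<Omega>]
  obtain \<D> where D: "countable \<D>" "\<And>X. X \<in> \<D> \<Longrightarrow> \<exists>a b. X = cbox a b" "\<Union>\<D> = \<Omega>"
    using open_countable_Union_open_cbox[OF \<Omega>] by metis
  have box: "AE x in lebesgue. x \<in> cbox a b \<longrightarrow> g x \<bullet> e = 0" if "cbox a b \<subseteq> \<Omega>" for a b e
  proof -
    have "AE x in lebesgue. x \<in> box a b \<longrightarrow> g x \<bullet> e = 0"
    proof (rule fundamental_lemma_box[OF \<Omega> _ _ that])
      show "locally_integrable \<Omega> (\<lambda>x. g x \<bullet> e)"
        using g by (auto simp: locally_integrable_def)
      fix \<phi> assume \<phi>: "\<phi> \<in> test_functions \<Omega>"
      have i: "integrable (lebesgue_on \<Omega>) (\<lambda>x. \<phi> x *\<^sub>R g x)"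
        by (rule compactly_supported_times_locally_integrable[OF \<Omega> \<phi> g])
      have "(\<integral>x. \<phi> x * (g x \<bullet> e) \<partial>lebesgue_on \<Omega>) = (\<integral>x. (\<phi> x *\<^sub>R g x) \<bullet> e \<partial>lebesgue_on \<Omega>)" by simp
      also have "\<dots> = (\<integral>x. \<phi> x *\<^sub>R g x \<partial>lebesgue_on \<Omega>) \<bullet> e"
        using i by (intro integral_inner_left) simp
      also have "\<dots> = 0" by (simp add: 0[OF \<phi>])
      finally show "(\<integral>x. \<phi> x * (g x \<bullet> e) \<partial>lebesgue_on \<Omega>) = 0" .
    qed
    moreover have "AE x in lebesgue. x \<notin> cbox a b - box a b"
      by (rule AE_not_in) (use negligible_frontier_interval[of a b] in \<open>simp add: negligible_iff_null_sets\<close>)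
    ultimately show ?thesis by eventually_elim auto
  qed
  have "AE x in lebesgue. \<forall>X\<in>\<D>. \<forall>e\<in>Basis. x \<in> X \<longrightarrow> g x \<bullet> e = 0"
  proof (intro AE_ball_countable' D(1) countable_finite finite_Basis)
    fix X and e :: 'b assume X: "X \<in> \<D>"
    then obtain a b where "X = cbox a b" "cbox a b \<subseteq> \<Omega>" using D by blast
    then show "AE x in lebesgue. x \<in> X \<longrightarrow> g x \<bullet> e = 0" using box by simp
  qed
  then have "AE x in lebesgue. x \<in> \<Omega> \<longrightarrow> g x = 0"
  proof eventually_elim
    case (elim x)
    show ?case
    proof
      assume "x \<in> \<Omega>"
      then obtain X where "X \<in> \<D>" "x \<in> X" using D(3) by blast
      with elim have "\<forall>e\<in>Basis. g x \<bullet> e = 0 \<bullet> e" by (simp only: inner_zero_left) blast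
      then show "g x = 0" by (rule euclidean_eq_iff[THEN iffD2])
    qed
  qed
  then show ?thesis using S by (simp add: AE_restrict_space_iff)
qed

lemma weak_gradient_unique:
  assumes \<Omega>: "open \<Omega>" and g: "has_weak_gradient \<Omega> u g" "has_weak_gradient \<Omega> u g'"
  shows "AE x in lebesgue_on \<Omega>. g x = g' x"
proof -
  have l: "locally_integrable \<Omega> g" "locally_integrable \<Omega> g'" using g by (auto simp: has_weak_gradient_def)
  have "AE x in lebesgue_on \<Omega>. g x - g' x = 0"
  proof (rule fundamental_lemma[OF \<Omega>])
    show "locally_integrable \<Omega> (\<lambda>x. g x - g' x)" using l by (auto simp: locally_integrable_def)
    fix \<phi> assume \<phi>: "\<phi> \<in> test_functions \<Omega>"
    note i = compactly_supported_times_locally_integrable[OF \<Omega> \<phi>]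
    have "(\<integral>x. \<phi> x *\<^sub>R g x \<partial>lebesgue_on \<Omega>) = (\<integral>x. \<phi> x *\<^sub>R g' x \<partial>lebesgue_on \<Omega>)"
    proof -
      have "(\<integral>x. u x *\<^sub>R classical_gradient \<phi> x \<partial>lebesgue_on \<Omega>) = - (\<integral>x. \<phi> x *\<^sub>R g x \<partial>lebesgue_on \<Omega>)"
        "(\<integral>x. u x *\<^sub>R classical_gradient \<phi> x \<partial>lebesgue_on \<Omega>) = - (\<integral>x. \<phi> x *\<^sub>R g' x \<partial>lebesgue_on \<Omega>)"
        using g \<phi> by (simp_all add: has_weak_gradient_def)
      then show ?thesis by simp
    qed
    then show "(\<integral>x. \<phi> x *\<^sub>R (g x - g' x) \<partial>lebesgue_on \<Omega>) = 0"
      using i[OF l(1)] i[OF l(2)] by (simp add: scaleR_diff_right)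
  qed
  then show ?thesis by simp
qed

text \<open>Identifies the gradient picked by choice with any explicit one, so that from here on
  only explicit gradients have to be exhibited.\<close>

lemma weak_gradient_AE_eq:
  assumes "open \<Omega>" "has_weak_gradient \<Omega> u g"
  shows "AE x in lebesgue_on \<Omega>. weak_gradient \<Omega> u x = g x"
  using weak_gradient_unique[OF assms(1) someI[of "has_weak_gradient \<Omega> u", OF assms(2)] assms(2)]
  unfolding weak_gradient_def .

lemma L2_cong_AE:
  assumes "open \<Omega>" "g \<in> L2 \<Omega>" "AE x in lebesgue_on \<Omega>. f x = g x"
  shows "f \<in> L2 \<Omega>"
proof (rule L2_I)
  show m: "f \<in> borel_measurable (lebesgue_on \<Omega>)"
    by (rule borel_measurable_lebesgue_on_AE[OF open_sets_lebesgue[OF assms(1)] L2_D(1)[OF assms(2)] assms(3)])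
  show "integrable (lebesgue_on \<Omega>) (\<lambda>x. (norm (f x))\<^sup>2)"
    by (rule Bochner_Integration.integrable_cong_AE[THEN iffD1, OF _ _ _ L2_D(2)[OF assms(2)]])
       (use m assms(2,3) in \<open>auto dest: L2_D(1)\<close>)
qed

text \<open>The product of two test functions is again of class \<open>C1c\<close>, so its gradient
  integrates to zero; the product rule splits this into the two sides.\<close>

lemma test_function_has_weak_gradient:
  assumes \<Omega>: "open \<Omega>" and u: "u \<in> test_functions \<Omega>"
  shows "has_weak_gradient \<Omega> u (classical_gradient u)"
  unfolding has_weak_gradient_def
proof (intro conjI ballI)
  note sq = test_function_sqnorm[OF \<Omega>]
  show "locally_integrable \<Omega> u" "locally_integrable \<Omega> (classical_gradient u)"
    by (auto intro!: L2_locally_integrable \<Omega> sq u)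
  fix \<phi> assume \<phi>: "\<phi> \<in> test_functions \<Omega>"
  note [measurable] = test_function_borel[OF u] test_function_borel[OF \<phi>]
  let ?I = "\<lambda>x. u x *\<^sub>R classical_gradient \<phi> x + \<phi> x *\<^sub>R classical_gradient u x"
  have "(\<integral>x. ?I x \<partial>lebesgue_on \<Omega>) = (\<integral>x. ?I x \<partial>lborel)"
    by (rule integrable_lebesgue_on_iff_lborel(2)[OF open_sets_lebesgue[OF \<Omega>]])
       (auto simp: test_functions_support[OF u] test_functions_support[OF \<phi>])
  also have "\<dots> = 0"
    by (rule C1c_integral_gradient[OF C1c_mult[OF C1c_test_function[OF u] C1c_test_function[OF \<phi>]]])
  finally have "(\<integral>x. ?I x \<partial>lebesgue_on \<Omega>) = 0" .
  then have "(\<integral>x. u x *\<^sub>R classical_gradient \<phi> x \<partial>lebesgue_on \<Omega>) + (\<integral>x. \<phi> x *\<^sub>R classical_gradient u x \<partial>lebesgue_on \<Omega>) = 0"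
    using sq(3,4)[OF u] sq(3,4)[OF \<phi>] by (subst (asm) Bochner_Integration.integral_add) (auto intro: L2_scaleR_integrable)
  then show "(\<integral>x. u x *\<^sub>R classical_gradient \<phi> x \<partial>lebesgue_on \<Omega>) = - (\<integral>x. \<phi> x *\<^sub>R classical_gradient u x \<partial>lebesgue_on \<Omega>)"
    by (simp add: eq_neg_iff_add_eq_0)
qed

text \<open>Separates convergence in the H1 norm into convergence of the functions and of the
  gradients, with the limit gradient \<open>g\<close> named instead of chosen. That \<open>g\<close>
  is the weak gradient of \<open>u\<close> becomes a consequence.\<close>

definition H10_approx :: "(real^'n) set \<Rightarrow> (nat \<Rightarrow> real^'n \<Rightarrow> real) \<Rightarrow> (real^'n \<Rightarrow> real) \<Rightarrow> (real^'n \<Rightarrow> real^'n) \<Rightarrow> bool" where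
  "H10_approx \<Omega> \<phi> u g \<longleftrightarrow> u \<in> L2 \<Omega> \<and> g \<in> L2 \<Omega> \<and> (\<forall>k. \<phi> k \<in> test_functions \<Omega>) \<and>
     (\<lambda>k. sqnorm \<Omega> (\<lambda>x. u x - \<phi> k x)) \<longlonglongrightarrow> 0 \<and>
     (\<lambda>k. sqnorm \<Omega> (\<lambda>x. g x - classical_gradient (\<phi> k) x)) \<longlonglongrightarrow> 0"

text \<open>Integration by parts holds exactly for the approximants, so its defect
  \<open>A + B\<close> for \<open>u\<close> is controlled by the approximation errors.\<close>

lemma H10_approx_weak_gradient:
  assumes \<Omega>: "open \<Omega>" and a: "H10_approx \<Omega> \<phi> u g"
  shows "has_weak_gradient \<Omega> u g"
  unfolding has_weak_gradient_def
proof (intro conjI ballI)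
  have L2: "u \<in> L2 \<Omega>" "g \<in> L2 \<Omega>" and \<phi>: "\<And>k. \<phi> k \<in> test_functions \<Omega>"
    and lim: "(\<lambda>k. sqnorm \<Omega> (\<lambda>x. u x - \<phi> k x)) \<longlonglongrightarrow> 0"
     "(\<lambda>k. sqnorm \<Omega> (\<lambda>x. g x - classical_gradient (\<phi> k) x)) \<longlonglongrightarrow> 0"
    using a by (auto simp: H10_approx_def)
  note sq = test_function_sqnorm[OF \<Omega>]
  show "locally_integrable \<Omega> u" "locally_integrable \<Omega> g"
    by (auto intro!: L2_locally_integrable \<Omega> L2)
  fix \<psi> assume \<psi>: "\<psi> \<in> test_functions \<Omega>"
  let ?g = "classical_gradient"
  define A where "A = (\<integral>x. u x *\<^sub>R ?g \<psi> x \<partial>lebesgue_on \<Omega>)"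
  define B where "B = (\<integral>x. \<psi> x *\<^sub>R g x \<partial>lebesgue_on \<Omega>)"
  have "norm (A + B) \<le> sqrt (sqnorm \<Omega> (\<lambda>x. u x - \<phi> k x)) * sqrt (sqnorm \<Omega> (?g \<psi>))
     + sqrt (sqnorm \<Omega> \<psi>) * sqrt (sqnorm \<Omega> (\<lambda>x. g x - ?g (\<phi> k) x))" for k
  proof -
    have "(\<integral>x. \<phi> k x *\<^sub>R ?g \<psi> x \<partial>lebesgue_on \<Omega>) = - (\<integral>x. \<psi> x *\<^sub>R ?g (\<phi> k) x \<partial>lebesgue_on \<Omega>)"
      using test_function_has_weak_gradient[OF \<Omega> \<phi>[of k]] \<psi> by (auto simp: has_weak_gradient_def)
    moreover have "(\<integral>x. (u x - \<phi> k x) *\<^sub>R ?g \<psi> x \<partial>lebesgue_on \<Omega>) = A - (\<integral>x. \<phi> k x *\<^sub>R ?g \<psi> x \<partial>lebesgue_on \<Omega>)"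
      unfolding A_def scaleR_diff_left
      by (intro Bochner_Integration.integral_diff L2_scaleR_integrable L2 sq \<phi> \<psi>)
    moreover have "(\<integral>x. \<psi> x *\<^sub>R (g x - ?g (\<phi> k) x) \<partial>lebesgue_on \<Omega>) = B - (\<integral>x. \<psi> x *\<^sub>R ?g (\<phi> k) x \<partial>lebesgue_on \<Omega>)"
      unfolding B_def scaleR_diff_right
      by (intro Bochner_Integration.integral_diff L2_scaleR_integrable L2 sq \<phi> \<psi>)
    ultimately have "A + B = (\<integral>x. (u x - \<phi> k x) *\<^sub>R ?g \<psi> x \<partial>lebesgue_on \<Omega>) + (\<integral>x. \<psi> x *\<^sub>R (g x - ?g (\<phi> k) x) \<partial>lebesgue_on \<Omega>)"
      by simp
    then have "norm (A + B) \<le> norm (\<integral>x. (u x - \<phi> k x) *\<^sub>R ?g \<psi> x \<partial>lebesgue_on \<Omega>) + norm (\<integral>x. \<psi> x *\<^sub>R (g x - ?g (\<phi> k) x) \<partial>lebesgue_on \<Omega>)"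
      by (simp add: norm_triangle_ineq)
    also have "\<dots> \<le> sqrt (sqnorm \<Omega> (\<lambda>x. u x - \<phi> k x)) * sqrt (sqnorm \<Omega> (?g \<psi>))
     + sqrt (sqnorm \<Omega> \<psi>) * sqrt (sqnorm \<Omega> (\<lambda>x. g x - ?g (\<phi> k) x))"
      by (intro add_mono L2_Cauchy_Schwarz_scaleR L2_diff L2 sq \<phi> \<psi>)
    finally show ?thesis .
  qed
  moreover have "(\<lambda>k. sqrt (sqnorm \<Omega> (\<lambda>x. u x - \<phi> k x)) * sqrt (sqnorm \<Omega> (?g \<psi>))
     + sqrt (sqnorm \<Omega> \<psi>) * sqrt (sqnorm \<Omega> (\<lambda>x. g x - ?g (\<phi> k) x))) \<longlonglongrightarrow> sqrt 0 * sqrt (sqnorm \<Omega> (?g \<psi>)) + sqrt (sqnorm \<Omega> \<psi>) * sqrt 0"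
    by (intro tendsto_intros lim)
  ultimately have "norm (A + B) \<le> sqrt 0 * sqrt (sqnorm \<Omega> (?g \<psi>)) + sqrt (sqnorm \<Omega> \<psi>) * sqrt 0"
    by (intro LIMSEQ_le_const) auto
  then show "A = - B" by (simp add: eq_neg_iff_add_eq_0)
qed

lemma sqnorm_cong_AE:
  assumes "open \<Omega>" "g \<in> L2 \<Omega>" "AE x in lebesgue_on \<Omega>. f x = g x"
  shows "sqnorm \<Omega> f = sqnorm \<Omega> g"
  using L2_D(1)[OF L2_cong_AE[OF assms]] L2_D(1)[OF assms(2)] assms(3)
  by (intro integral_cong_AE) auto

lemma has_weak_gradient_diff:
  assumes \<Omega>: "open \<Omega>" and g: "u \<in> L2 \<Omega>" "v \<in> L2 \<Omega>" "g \<in> L2 \<Omega>" "h \<in> L2 \<Omega>"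
    and w: "has_weak_gradient \<Omega> u g" "has_weak_gradient \<Omega> v h"
  shows "has_weak_gradient \<Omega> (\<lambda>x. u x - v x) (\<lambda>x. g x - h x)"
  unfolding has_weak_gradient_def
proof (intro conjI ballI)
  show "locally_integrable \<Omega> (\<lambda>x. u x - v x)" "locally_integrable \<Omega> (\<lambda>x. g x - h x)"
    by (auto intro!: L2_locally_integrable \<Omega> L2_diff g)
  fix \<psi> assume \<psi>: "\<psi> \<in> test_functions \<Omega>"
  note sq = test_function_sqnorm[OF \<Omega> \<psi>]
  have "(\<integral>x. (u x - v x) *\<^sub>R classical_gradient \<psi> x \<partial>lebesgue_on \<Omega>)
     = (\<integral>x. u x *\<^sub>R classical_gradient \<psi> x \<partial>lebesgue_on \<Omega>) - (\<integral>x. v x *\<^sub>R classical_gradient \<psi> x \<partial>lebesgue_on \<Omega>)"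
    unfolding scaleR_diff_left by (intro Bochner_Integration.integral_diff L2_scaleR_integrable g sq)
  moreover have "(\<integral>x. \<psi> x *\<^sub>R (g x - h x) \<partial>lebesgue_on \<Omega>)
     = (\<integral>x. \<psi> x *\<^sub>R g x \<partial>lebesgue_on \<Omega>) - (\<integral>x. \<psi> x *\<^sub>R h x \<partial>lebesgue_on \<Omega>)"
    unfolding scaleR_diff_right by (intro Bochner_Integration.integral_diff L2_scaleR_integrable g sq)
  ultimately show "(\<integral>x. (u x - v x) *\<^sub>R classical_gradient \<psi> x \<partial>lebesgue_on \<Omega>)
     = - (\<integral>x. \<psi> x *\<^sub>R (g x - h x) \<partial>lebesgue_on \<Omega>)"
    using w \<psi> by (simp add: has_weak_gradient_def)
qed

lemma H1_norm_diff_test_function: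
  assumes \<Omega>: "open \<Omega>" and g: "u \<in> L2 \<Omega>" "g \<in> L2 \<Omega>" "has_weak_gradient \<Omega> u g" and \<phi>: "\<phi> \<in> test_functions \<Omega>"
  shows "(H1_norm \<Omega> (\<lambda>x. u x - \<phi> x))\<^sup>2 = sqnorm \<Omega> (\<lambda>x. u x - \<phi> x) + sqnorm \<Omega> (\<lambda>x. g x - classical_gradient \<phi> x)"
proof -
  note sq = test_function_sqnorm[OF \<Omega> \<phi>]
  have "AE x in lebesgue_on \<Omega>. weak_gradient \<Omega> (\<lambda>x. u x - \<phi> x) x = g x - classical_gradient \<phi> x"
    by (intro weak_gradient_AE_eq \<Omega> has_weak_gradient_diff g sq test_function_has_weak_gradient \<phi>)
  then have "sqnorm \<Omega> (weak_gradient \<Omega> (\<lambda>x. u x - \<phi> x)) = sqnorm \<Omega> (\<lambda>x. g x - classical_gradient \<phi> x)"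
    by (intro sqnorm_cong_AE \<Omega> L2_diff g sq)
  then show ?thesis by (simp add: H1_norm_def)
qed

lemma H10_approx_gradient:
  assumes \<Omega>: "open \<Omega>" and a: "H10_approx \<Omega> \<phi> u g"
  shows "u \<in> H10 \<Omega>" "AE x in lebesgue_on \<Omega>. weak_gradient \<Omega> u x = g x"
proof -
  have L2: "u \<in> L2 \<Omega>" "g \<in> L2 \<Omega>" and \<phi>: "\<And>k. \<phi> k \<in> test_functions \<Omega>"
    and lim: "(\<lambda>k. sqnorm \<Omega> (\<lambda>x. u x - \<phi> k x)) \<longlonglongrightarrow> 0"
     "(\<lambda>k. sqnorm \<Omega> (\<lambda>x. g x - classical_gradient (\<phi> k) x)) \<longlonglongrightarrow> 0"
    using a by (auto simp: H10_approx_def)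
  have w: "has_weak_gradient \<Omega> u g" by (rule H10_approx_weak_gradient[OF assms])
  then show "AE x in lebesgue_on \<Omega>. weak_gradient \<Omega> u x = g x" by (rule weak_gradient_AE_eq[OF \<Omega>])
  have "(\<lambda>k. sqrt (sqnorm \<Omega> (\<lambda>x. u x - \<phi> k x) + sqnorm \<Omega> (\<lambda>x. g x - classical_gradient (\<phi> k) x))) \<longlonglongrightarrow> sqrt (0 + 0)"
    by (intro tendsto_intros lim)
  moreover have "sqrt (sqnorm \<Omega> (\<lambda>x. u x - \<phi> k x) + sqnorm \<Omega> (\<lambda>x. g x - classical_gradient (\<phi> k) x)) = H1_norm \<Omega> (\<lambda>x. u x - \<phi> k x)" for k
    unfolding H1_norm_diff_test_function[OF \<Omega> L2 w \<phi>, symmetric] by (simp add: H1_norm_def)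
  ultimately have "(\<lambda>k. H1_norm \<Omega> (\<lambda>x. u x - \<phi> k x)) \<longlonglongrightarrow> 0" by simp
  then show "u \<in> H10 \<Omega>" unfolding H10_def H1_def using L2 w \<phi> by auto
qed

lemma H10_obtain_approx:
  assumes \<Omega>: "open \<Omega>" and u: "u \<in> H10 \<Omega>"
  obtains \<phi> where "H10_approx \<Omega> \<phi> u (weak_gradient \<Omega> u)"
proof -
  obtain g \<phi> where L2: "u \<in> L2 \<Omega>" "g \<in> L2 \<Omega>" and w: "has_weak_gradient \<Omega> u g"
    and \<phi>: "\<And>k. \<phi> k \<in> test_functions \<Omega>" and lim: "(\<lambda>k::nat. H1_norm \<Omega> (\<lambda>x. u x - \<phi> k x)) \<longlonglongrightarrow> 0"
    using u unfolding H10_def H1_def by auto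
  let ?g = "weak_gradient \<Omega> u"
  have ae: "AE x in lebesgue_on \<Omega>. ?g x = g x" by (rule weak_gradient_AE_eq[OF \<Omega> w])
  have gL2: "?g \<in> L2 \<Omega>" by (rule L2_cong_AE[OF \<Omega> L2(2) ae])
  have w': "has_weak_gradient \<Omega> u ?g" unfolding weak_gradient_def by (rule someI[of "has_weak_gradient \<Omega> u", OF w])
  have "(\<lambda>k. (H1_norm \<Omega> (\<lambda>x. u x - \<phi> k x))\<^sup>2) \<longlonglongrightarrow> 0\<^sup>2" by (intro tendsto_intros lim)
  then have l: "(\<lambda>k. sqnorm \<Omega> (\<lambda>x. u x - \<phi> k x) + sqnorm \<Omega> (\<lambda>x. ?g x - classical_gradient (\<phi> k) x)) \<longlonglongrightarrow> 0"
    by (simp add: H1_norm_diff_test_function[OF \<Omega> L2(1) gL2 w' \<phi>])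
  have "(\<lambda>k. sqnorm \<Omega> (\<lambda>x. u x - \<phi> k x)) \<longlonglongrightarrow> 0"
    by (rule tendsto_sandwich[OF _ _ tendsto_const l]) (auto intro!: always_eventually)
  moreover have "(\<lambda>k. sqnorm \<Omega> (\<lambda>x. ?g x - classical_gradient (\<phi> k) x)) \<longlonglongrightarrow> 0"
    by (rule tendsto_sandwich[OF _ _ tendsto_const l]) (auto intro!: always_eventually)
  ultimately show ?thesis using L2(1) gL2 \<phi> by (intro that[of \<phi>]) (auto simp: H10_approx_def)
qed

lemma H10_L2:
  assumes "open \<Omega>" "u \<in> H10 \<Omega>"
  shows "u \<in> L2 \<Omega>" "weak_gradient \<Omega> u \<in> L2 \<Omega>"
  using H10_obtain_approx[OF assms] by (auto simp: H10_approx_def)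

lemma L2_limit_linear_combination:
  fixes f f' :: "real^'n \<Rightarrow> 'b::euclidean_space" and F F' :: "nat \<Rightarrow> real^'n \<Rightarrow> 'b"
  assumes L: "f \<in> L2 \<Omega>" "f' \<in> L2 \<Omega>" "\<And>k. F k \<in> L2 \<Omega>" "\<And>k. F' k \<in> L2 \<Omega>"
    and l: "(\<lambda>k. sqnorm \<Omega> (\<lambda>x. f x - F k x)) \<longlonglongrightarrow> 0" "(\<lambda>k. sqnorm \<Omega> (\<lambda>x. f' x - F' k x)) \<longlonglongrightarrow> 0"
  shows "(\<lambda>k. sqnorm \<Omega> (\<lambda>x. (c *\<^sub>R f x + e *\<^sub>R f' x) - (c *\<^sub>R F k x + e *\<^sub>R F' k x))) \<longlonglongrightarrow> 0"
proof (rule tendsto_sandwich[OF _ _ tendsto_const])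
  have "(\<lambda>k. 2 * (c\<^sup>2 * sqnorm \<Omega> (\<lambda>x. f x - F k x)) + 2 * (e\<^sup>2 * sqnorm \<Omega> (\<lambda>x. f' x - F' k x))) \<longlonglongrightarrow> 2 * (c\<^sup>2 * 0) + 2 * (e\<^sup>2 * 0)"
    by (intro tendsto_intros l)
  then show "(\<lambda>k. 2 * (c\<^sup>2 * sqnorm \<Omega> (\<lambda>x. f x - F k x)) + 2 * (e\<^sup>2 * sqnorm \<Omega> (\<lambda>x. f' x - F' k x))) \<longlonglongrightarrow> 0" by simp
  show "\<forall>\<^sub>F k in sequentially. sqnorm \<Omega> (\<lambda>x. (c *\<^sub>R f x + e *\<^sub>R f' x) - (c *\<^sub>R F k x + e *\<^sub>R F' k x))
     \<le> 2 * (c\<^sup>2 * sqnorm \<Omega> (\<lambda>x. f x - F k x)) + 2 * (e\<^sup>2 * sqnorm \<Omega> (\<lambda>x. f' x - F' k x))"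
  proof (rule always_eventually, rule allI)
    fix k
    note d = L2_diff[OF L(1) L(3)[of k]] L2_diff[OF L(2) L(4)[of k]]
    have "sqnorm \<Omega> (\<lambda>x. (c *\<^sub>R f x + e *\<^sub>R f' x) - (c *\<^sub>R F k x + e *\<^sub>R F' k x))
      = sqnorm \<Omega> (\<lambda>x. c *\<^sub>R (f x - F k x) + e *\<^sub>R (f' x - F' k x))"
      by (simp add: algebra_simps)
    \<comment> \<open>Expanding this square, which has the opposite sign, bounds the cross
      term.\<close>
    moreover have "0 \<le> sqnorm \<Omega> (\<lambda>x. c *\<^sub>R (f x - F k x) + (- e) *\<^sub>R (f' x - F' k x))" by simp
    ultimately show "sqnorm \<Omega> (\<lambda>x. (c *\<^sub>R f x + e *\<^sub>R f' x) - (c *\<^sub>R F k x + e *\<^sub>R F' k x))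
       \<le> 2 * (c\<^sup>2 * sqnorm \<Omega> (\<lambda>x. f x - F k x)) + 2 * (e\<^sup>2 * sqnorm \<Omega> (\<lambda>x. f' x - F' k x))"
      unfolding sqnorm_linear_combination[OF d] by simp
  qed
qed (auto intro!: always_eventually)

lemma H10_approx_linear_combination:
  assumes \<Omega>: "open \<Omega>" and a: "H10_approx \<Omega> \<phi> u g" "H10_approx \<Omega> \<psi> v h"
  shows "H10_approx \<Omega> (\<lambda>k x. c * \<phi> k x + e * \<psi> k x) (\<lambda>x. c * u x + e * v x) (\<lambda>x. c *\<^sub>R g x + e *\<^sub>R h x)"
proof -
  have t: "\<And>k. \<phi> k \<in> test_functions \<Omega>" "\<And>k. \<psi> k \<in> test_functions \<Omega>"
    using a by (auto simp: H10_approx_def)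
  note sq = test_function_sqnorm[OF \<Omega> t(1)] test_function_sqnorm[OF \<Omega> t(2)]
  have "(\<lambda>k. sqnorm \<Omega> (\<lambda>x. (c *\<^sub>R u x + e *\<^sub>R v x) - (c *\<^sub>R \<phi> k x + e *\<^sub>R \<psi> k x))) \<longlonglongrightarrow> 0"
    using a sq by (intro L2_limit_linear_combination) (auto simp: H10_approx_def)
  moreover have "(\<lambda>k. sqnorm \<Omega> (\<lambda>x. (c *\<^sub>R g x + e *\<^sub>R h x) - (c *\<^sub>R classical_gradient (\<phi> k) x + e *\<^sub>R classical_gradient (\<psi> k) x))) \<longlonglongrightarrow> 0"
    using a sq by (intro L2_limit_linear_combination) (auto simp: H10_approx_def)
  ultimately show ?thesis
    using a t unfolding H10_approx_def
    by (auto intro!: L2_linear_combination L2_real_linear_combination test_functions_linear_combination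
        simp: classical_gradient_linear_combination[OF t])
qed

text \<open>Each gradient is a separate choice, hence linearity only almost everywhere.\<close>

lemma H10_linear_combination:
  assumes \<Omega>: "open \<Omega>" and "u \<in> H10 \<Omega>" "v \<in> H10 \<Omega>"
  shows "(\<lambda>x. c * u x + e * v x) \<in> H10 \<Omega>"
    "AE x in lebesgue_on \<Omega>. weak_gradient \<Omega> (\<lambda>x. c * u x + e * v x) x = c *\<^sub>R weak_gradient \<Omega> u x + e *\<^sub>R weak_gradient \<Omega> v x"
proof -
  obtain \<phi> \<psi> where "H10_approx \<Omega> \<phi> u (weak_gradient \<Omega> u)" "H10_approx \<Omega> \<psi> v (weak_gradient \<Omega> v)"
    using assms H10_obtain_approx by metis
  from H10_approx_gradient[OF \<Omega> H10_approx_linear_combination[OF \<Omega> this, of c e]]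
  show "(\<lambda>x. c * u x + e * v x) \<in> H10 \<Omega>"
    "AE x in lebesgue_on \<Omega>. weak_gradient \<Omega> (\<lambda>x. c * u x + e * v x) x = c *\<^sub>R weak_gradient \<Omega> u x + e *\<^sub>R weak_gradient \<Omega> v x" .
qed

lemma test_function_H10_approx:
  assumes "open \<Omega>" "\<phi> \<in> test_functions \<Omega>"
  shows "H10_approx \<Omega> (\<lambda>_. \<phi>) \<phi> (classical_gradient \<phi>)"
  using test_function_sqnorm[OF assms] assms(2) by (simp add: H10_approx_def)

subsection \<open>The constants\<close>

text \<open>AM-GM with weights m/(m+1) and 1/(m+1) for the numbers (m+1)/m X and (m+1) Y \<tau>. The
  hypothesis is the resulting condition on \<open>c\<close>, raised to the power m+1. AM-GM is an
  equality for one positive \<tau>, so the criterion is sharp.\<close>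

lemma weighted_am_gm_powr:
  fixes X Y c m :: real
  assumes m: "m > 0" and XY: "X > 0" "Y > 0" and c: "c > 0" and \<tau>: "\<tau> > 0"
  shows "((m + 1) / m * X) powr m * ((m + 1) * Y) \<ge> c powr (m + 1) \<Longrightarrow> X + Y * \<tau> \<ge> c * \<tau> powr (1 / (m + 1))"
    and "((m + 1) / m * X) powr m * ((m + 1) * Y) > c powr (m + 1) \<Longrightarrow> X + Y * \<tau> > c * \<tau> powr (1 / (m + 1))"
proof -
  define \<theta> where "\<theta> = 1 / (m + 1)"
  have \<theta>: "0 < \<theta>" "\<theta> < 1" "1 - \<theta> = m * \<theta>" "(m + 1) * \<theta> = 1" "1 - \<theta> = m / (m + 1)"
    using m by (auto simp: \<theta>_def field_simps)
  define x y where "x = (m + 1) / m * X" and "y = (m + 1) * Y"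
  have xy: "x > 0" "y > 0" using XY m by (auto simp: x_def y_def)
  have "x powr (1 - \<theta>) * (y * \<tau>) powr \<theta> \<le> (1 - \<theta>) * x + \<theta> * (y * \<tau>)"
    using \<theta> xy \<tau> by (intro Youngs_inequality_0) auto
  also have "(1 - \<theta>) * x + \<theta> * (y * \<tau>) = X + Y * \<tau>"
    unfolding \<theta>(5) using m by (simp add: x_def y_def \<theta>_def)
  also have "x powr (1 - \<theta>) * (y * \<tau>) powr \<theta> = (x powr m * y) powr \<theta> * \<tau> powr \<theta>"
    using xy \<tau> by (simp add: \<theta>(3) powr_mult powr_powr)
  finally have main: "(x powr m * y) powr \<theta> * \<tau> powr \<theta> \<le> X + Y * \<tau>" .
  have c': "(c powr (m + 1)) powr \<theta> = c" using c \<theta>(4) by (simp add: powr_powr)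
  show "X + Y * \<tau> \<ge> c * \<tau> powr (1 / (m + 1))" if "((m + 1) / m * X) powr m * ((m + 1) * Y) \<ge> c powr (m + 1)"
  proof -
    have "c \<le> (x powr m * y) powr \<theta>"
      using powr_mono2[of \<theta> "c powr (m + 1)" "x powr m * y"] that \<theta> c' by (simp add: x_def y_def)
    then have "c * \<tau> powr \<theta> \<le> (x powr m * y) powr \<theta> * \<tau> powr \<theta>" by (rule mult_right_mono) simp
    then show ?thesis using main by (simp add: \<theta>_def)
  qed
  show "X + Y * \<tau> > c * \<tau> powr (1 / (m + 1))" if "((m + 1) / m * X) powr m * ((m + 1) * Y) > c powr (m + 1)"
  proof -
    have "c < (x powr m * y) powr \<theta>"
      using powr_less_mono2[of \<theta> "c powr (m + 1)" "x powr m * y"] that \<theta> c' by (simp add: x_def y_def)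
    then have "c * \<tau> powr \<theta> < (x powr m * y) powr \<theta> * \<tau> powr \<theta>" using \<tau> by simp
    then show ?thesis using main by (simp add: \<theta>_def)
  qed
qed

lemma two_star_props:
  assumes "d \<ge> 4"
  shows "two_star d > 2" "two_star d \<le> 4"
  using assms by (auto simp: two_star_def field_simps)

text \<open>For d > 4 this is AM-GM with X = a/2, Y = b/4 and \<open>c\<close> the Sobolev factor
  divided by \<open>p\<close>; \<open>L_const\<close> is the criterion solved for a^m b. For d = 4
  one has m = 0 and AM-GM degenerates, but then the right side is linear in \<tau> and can be
  compared directly.\<close>

lemma L_const_inequality:
  assumes d: "d \<ge> 4" and ab: "a > 0" "b > 0" and S: "S > 0" and \<tau>: "\<tau> \<ge> 0"
    and L: "a powr ((real d - 4) / 2) * b \<ge> L_const d S"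
  defines "p \<equiv> two_star d"
  shows "a / 2 + b / 4 * \<tau> \<ge> S powr (- p / 2) / p * \<tau> powr (p / 2 - 1)"
proof (cases "\<tau> = 0 \<or> d = 4")
  case True
  then show ?thesis
  proof
    assume "d = 4"
    then have "b \<ge> 1 / S\<^sup>2" using L ab by (simp add: L_const_def)
    moreover have "S powr (- 2) = 1 / S\<^sup>2" using S by (simp add: powr_minus divide_inverse)
    ultimately have "b * \<tau> \<ge> S powr (- 2) * \<tau>" using \<tau> by (intro mult_right_mono) auto
    then show ?thesis using \<open>d = 4\<close> ab \<tau> by (simp add: p_def two_star_def)
  qed (use ab in auto)
next
  case False
  then have d4: "d > 4" and \<tau>: "\<tau> > 0" using d \<tau> by auto
  define D where "D = real d"
  have D: "D > 4" using d4 by (simp add: D_def)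
  \<comment> \<open>Chosen so that the exponent p/2 - 1 = 2/(d-2) becomes 1/(m+1).\<close>
  define m where "m = (D - 4) / 2"
  have m: "m > 0" "D = 2 * m + 4" using D by (auto simp: m_def field_simps)
  have eqs: "(D - 4) / 2 = m" "(D - 2) / 2 = m + 1" "D / 2 = m + 2" "D - 4 = 2 * m" "D - 2 = 2 * m + 2" "D + 2 = 2 * m + 6"
    using D by (auto simp: m_def field_simps)
  have Sp: "(S powr (- p / 2)) powr (m + 1) = S powr (- (m + 2))"
  proof -
    have "p / 2 * (m + 1) = m + 2" using m D by (simp add: p_def two_star_def D_def[symmetric] field_simps)
    then have "- p / 2 * (m + 1) = - (m + 2)" by (simp only: minus_divide_left[symmetric] mult_minus_left)
    then show ?thesis by (simp only: powr_powr)
  qed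
  have halves: "2 * m / 2 = m" "(2 * m + 2) / 2 = m + 1" by auto
  have nd: "d \<noteq> 4" using d4 by simp
  have p: "p = (2 * m + 4) / (m + 1)" using m by (simp add: p_def two_star_def D_def[symmetric] field_simps)
  have pp: "p > 0" "p / 2 - 1 = 1 / (m + 1)" "p / 2 * (m + 1) = m + 2" using m by (auto simp: p field_simps)
  have "a powr m * b \<ge> 4 * (2 * m) powr m / ((2 * m + 4) powr (m + 1) * S powr (m + 2))"
    using L[unfolded L_const_def if_not_P[OF nd] D_def[symmetric], unfolded eqs, unfolded m(2) halves] .
  \<comment> \<open>Multiplication by \<open>?f\<close> turns the bound on a^m b into the left side
    of the AM-GM criterion; what remains is to recognize the other side as \<open>c\<close> to the
    power m+1.\<close>
  then have "((m + 1) / m * (a / 2)) powr m * ((m + 1) * (b / 4))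
     \<ge> (4 * (2 * m) powr m / ((2 * m + 4) powr (m + 1) * S powr (m + 2))) * (((m + 1) / (2 * m)) powr m * ((m + 1) / 4))"
    (is "?l \<ge> ?r * ?f")
  proof -
    assume "a powr m * b \<ge> ?r"
    then have "?r * ?f \<le> a powr m * b * ?f" using m by (intro mult_right_mono) auto
    also have "a powr m * b * ?f = (a * ((m + 1) / (2 * m))) powr m * ((m + 1) * (b / 4))"
      using m ab by (subst powr_mult) auto
    also have "a * ((m + 1) / (2 * m)) = (m + 1) / m * (a / 2)" using m by (simp add: field_simps)
    finally show ?thesis .
  qed
  also have "?r * ?f = (S powr (- p / 2) / p) powr (m + 1)"
  proof -
    have "(S powr (- p / 2) / p) powr (m + 1) = S powr (- (m + 2)) / p powr (m + 1)"
      unfolding Sp[symmetric] using pp by (simp add: powr_divide del: powr_powr)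
    also have "\<dots> = S powr (- (m + 2)) * ((m + 1) powr (m + 1) / (2 * m + 4) powr (m + 1))"
      using m by (simp add: p powr_divide)
    also have "\<dots> = ?r * ?f"
    proof -
      have 1: "(m + 1) powr (m + 1) = (m + 1) powr m * (m + 1)" using m by (simp add: powr_add)
      have 2: "((m + 1) / (2 * m)) powr m = (m + 1) powr m / (2 * m) powr m" using m by (simp add: powr_divide)
      define k where "k = m + 1"
      define A B E T where "A = (2 * m) powr m" and "B = (m + 1) powr m" and "E = (2 * m + 4) powr (m + 1)"
        and "T = S powr (m + 2)"
      have pos: "A > 0" "B > 0" "E > 0" "T > 0" "k > 0" using m S by (auto simp: A_def B_def E_def T_def k_def)
      show ?thesis unfolding 1 2 powr_minus
        unfolding A_def[symmetric] B_def[symmetric] E_def[symmetric] T_def[symmetric] k_def[symmetric]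
        using pos by (simp add: field_simps)
    qed
    finally show ?thesis by simp
  qed
  finally have "((m + 1) / m * (a / 2)) powr m * ((m + 1) * (b / 4)) \<ge> (S powr (- p / 2) / p) powr (m + 1)" .
  from weighted_am_gm_powr(1)[OF m(1) _ _ _ \<tau> this] show ?thesis
    using ab S pp by simp
qed

text \<open>The same argument with X = a, Y = b and \<open>c\<close> the Sobolev factor times p - 1
  = (d+2)/(d-2), which explains the powers of d+2 and d-2 in \<open>C_const\<close>.\<close>

lemma C_const_inequality:
  assumes d: "d \<ge> 4" and ab: "a > 0" "b > 0" and S: "S > 0" and \<tau>: "\<tau> \<ge> 0"
    and C: "a powr ((real d - 4) / 2) * b > C_const d S"
  defines "p \<equiv> two_star d"
  shows "a + b * \<tau> > (p - 1) * S powr (- p / 2) * \<tau> powr (p / 2 - 1)"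
proof (cases "\<tau> = 0 \<or> d = 4")
  case True
  then show ?thesis
  proof
    assume "d = 4"
    then have "b \<ge> 3 / S\<^sup>2" using C ab by (simp add: C_const_def)
    moreover have "S powr (- 2) = 1 / S\<^sup>2" using S by (simp add: powr_minus divide_inverse)
    \<comment> \<open>A weak inequality suffices here; strictness comes from a > 0.\<close>
    ultimately have "b * \<tau> \<ge> 3 * S powr (- 2) * \<tau>" using \<tau> by (intro mult_right_mono) auto
    then show ?thesis using \<open>d = 4\<close> ab \<tau> by (simp add: p_def two_star_def)
  qed (use ab in auto)
next
  case False
  then have d4: "d > 4" and \<tau>: "\<tau> > 0" using d \<tau> by auto
  define D where "D = real d"
  have D: "D > 4" using d4 by (simp add: D_def)
  define m where "m = (D - 4) / 2"
  have m: "m > 0" "D = 2 * m + 4" using D by (auto simp: m_def field_simps)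
  have eqs: "(D - 4) / 2 = m" "(D - 2) / 2 = m + 1" "D / 2 = m + 2" "D - 4 = 2 * m" "D - 2 = 2 * m + 2" "D + 2 = 2 * m + 6"
    using D by (auto simp: m_def field_simps)
  have Sp: "(S powr (- p / 2)) powr (m + 1) = S powr (- (m + 2))"
  proof -
    have "p / 2 * (m + 1) = m + 2" using m D by (simp add: p_def two_star_def D_def[symmetric] field_simps)
    then have "- p / 2 * (m + 1) = - (m + 2)" by (simp only: minus_divide_left[symmetric] mult_minus_left)
    then show ?thesis by (simp only: powr_powr)
  qed
  have halves: "2 * m / 2 = m" "(2 * m + 2) / 2 = m + 1" by auto
  have nd: "d \<noteq> 4" using d4 by simp
  have p: "p = (2 * m + 4) / (m + 1)" using m by (simp add: p_def two_star_def D_def[symmetric] field_simps)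
  have pp: "p > 0" "p / 2 - 1 = 1 / (m + 1)" "p / 2 * (m + 1) = m + 2" using m by (auto simp: p field_simps)
  have p1: "p - 1 = (2 * m + 6) / (2 * m + 2)" using m by (simp add: p field_simps)
  have "a powr m * b > 2 * (2 * m) powr m * (2 * m + 6) powr (m + 1) / ((2 * m + 2) powr (2 * m + 2) * S powr (m + 2))"
    using C[unfolded C_const_def if_not_P[OF nd] D_def[symmetric], unfolded eqs, unfolded m(2) halves] .
  then have "((m + 1) / m * a) powr m * ((m + 1) * b)
     > (2 * (2 * m) powr m * (2 * m + 6) powr (m + 1) / ((2 * m + 2) powr (2 * m + 2) * S powr (m + 2))) * (((2 * m + 2) / (2 * m)) powr m * (m + 1))"
    (is "?l > ?r * ?f")
  proof -
    assume "a powr m * b > ?r"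
    then have "?r * ?f < a powr m * b * ?f" using m by (intro mult_strict_right_mono) auto
    also have "a powr m * b * ?f = (a * ((2 * m + 2) / (2 * m))) powr m * ((m + 1) * b)"
      using m ab by (subst powr_mult) auto
    also have "a * ((2 * m + 2) / (2 * m)) = (m + 1) / m * a" using m by (simp add: field_simps)
    finally show ?thesis .
  qed
  also have "?r * ?f = ((p - 1) * S powr (- p / 2)) powr (m + 1)"
  proof -
    have "((p - 1) * S powr (- p / 2)) powr (m + 1) = (p - 1) powr (m + 1) * S powr (- (m + 2))"
      unfolding Sp[symmetric] by (rule powr_mult)
    also have "\<dots> = S powr (- (m + 2)) * ((2 * m + 6) powr (m + 1) / (2 * m + 2) powr (m + 1))"
      using m by (simp add: p1 powr_divide)
    also have "\<dots> = ?r * ?f"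
    proof -
      \<comment> \<open>Split into the denominator of (p-1)^(m+1) and two factors that cancel
        against \<open>?f\<close> and the constant 2.\<close>
      have "(2 * m + 2) powr (2 * m + 2) = (2 * m + 2) powr ((m + 1) + m + 1)"
        by (rule arg_cong[where f = "\<lambda>e. (2 * m + 2) powr e"]) simp
      also have "\<dots> = (2 * m + 2) powr (m + 1) * (2 * m + 2) powr m * (2 * m + 2)"
        using m by (simp only: powr_add) simp
      finally have 1: "(2 * m + 2) powr (2 * m + 2) = (2 * m + 2) powr (m + 1) * (2 * m + 2) powr m * (2 * m + 2)" .
      have 2: "((2 * m + 2) / (2 * m)) powr m = (2 * m + 2) powr m / (2 * m) powr m" using m by (simp add: powr_divide)
      define k where "k = m + 1"
      have k: "k > 0" and two_k: "2 * m + 2 = 2 * k" using m by (auto simp: k_def)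
      define A B E F T where "A = (2 * m) powr m" and "B = (2 * m + 2) powr m" and "E = (2 * m + 2) powr (m + 1)"
        and "F = (2 * m + 6) powr (m + 1)" and "T = S powr (m + 2)"
      have pos: "A > 0" "B > 0" "E > 0" "T > 0" using m S by (auto simp: A_def B_def E_def T_def)
      show ?thesis unfolding 1 2 powr_minus
        unfolding A_def[symmetric] B_def[symmetric] E_def[symmetric] F_def[symmetric] T_def[symmetric]
        using pos k unfolding two_k k_def[symmetric] by (simp add: field_simps)
    qed
    finally show ?thesis by simp
  qed
  finally have "((m + 1) / m * a) powr m * ((m + 1) * b) > ((p - 1) * S powr (- p / 2)) powr (m + 1)" .
  from weighted_am_gm_powr(2)[OF m(1) _ _ _ \<tau> this] show ?thesis
    using ab S pp m p1 by simp
qed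

text \<open>Gives existence in the regime of \<open>C_const\<close>. The hypothesis at \<tau>/2,
  halved, has exactly the required side with \<open>a\<close> and \<open>b\<close>; the loss
  2^\<theta> in the power is covered by 2 * 2^\<theta> \<le> 2 + 2 \<theta> = p \<le> (p-1)
  p.\<close>

lemma strict_inequality_imp_weak:
  fixes p s a b :: real
  assumes p: "2 < p" "p \<le> 4" and s: "s \<ge> 0" and ab: "a > 0" "b > 0" and \<tau>: "\<tau> \<ge> 0"
    and C: "\<And>\<sigma>. \<sigma> \<ge> 0 \<Longrightarrow> a + b * \<sigma> > (p - 1) * s * \<sigma> powr (p / 2 - 1)"
  shows "a / 2 + b / 4 * \<tau> \<ge> s / p * \<tau> powr (p / 2 - 1)"
proof -
  define \<theta> where "\<theta> = p / 2 - 1"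
  have \<theta>: "0 < \<theta>" "\<theta> \<le> 1" "p = 2 + 2 * \<theta>" using p by (auto simp: \<theta>_def)
  have "2 powr \<theta> * 1 powr (1 - \<theta>) \<le> \<theta> * 2 + (1 - \<theta>) * 1"
    using \<theta> by (intro Youngs_inequality_0) auto
  then have "2 powr \<theta> \<le> 1 + \<theta>" by simp
  then have "2 * 2 powr \<theta> \<le> p" using \<theta> by simp
  also have "\<dots> \<le> (p - 1) * p" using p mult_right_mono[of 1 "p - 1" p] by simp
  finally have k: "1 / p \<le> (p - 1) / (2 * 2 powr \<theta>)" using p by (simp add: field_simps)
  have "s / p * \<tau> powr \<theta> = s * \<tau> powr \<theta> * (1 / p)" by simp
  also have "\<dots> \<le> s * \<tau> powr \<theta> * ((p - 1) / (2 * 2 powr \<theta>))"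
    using k s by (intro mult_left_mono) auto
  also have "\<dots> = ((p - 1) * s * (\<tau> / 2) powr \<theta>) / 2"
    using \<tau> by (simp add: powr_divide mult_ac)
  also have "\<dots> \<le> (a + b * (\<tau> / 2)) / 2"
    using C[of "\<tau> / 2"] \<tau> by (simp add: \<theta>_def)
  finally show ?thesis by (simp add: \<theta>_def field_simps)
qed

subsection \<open>Functional inequalities on a bounded domain\<close>

locale bounded_domain =
  fixes \<Omega> :: "(real^'n) set"
  assumes dim: "CARD('n) \<ge> 4"
    and open_domain: "open \<Omega>" and nonempty_domain: "\<Omega> \<noteq> {}" and bounded_domain: "bounded \<Omega>"
begin

abbreviation "M \<equiv> lebesgue_on \<Omega>"
abbreviation "wg \<equiv> weak_gradient \<Omega>"
abbreviation "cg \<equiv> classical_gradient :: (real^'n \<Rightarrow> real) \<Rightarrow> real^'n \<Rightarrow> real^'n"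
abbreviation "TF \<equiv> test_functions \<Omega>"

definition "p = two_star CARD('n)"

lemma p_bounds: "p > 2" "p \<le> 4"
  using two_star_props[OF dim] by (auto simp: p_def)

lemma H10_norm_eq: "(H10_norm \<Omega> u)\<^sup>2 = sqnorm \<Omega> (wg u)"
  by (simp add: H10_norm_def)

lemma test_H10: "\<phi> \<in> TF \<Longrightarrow> \<phi> \<in> H10 \<Omega>"
  "\<phi> \<in> TF \<Longrightarrow> AE x in M. wg \<phi> x = cg \<phi> x"
  using H10_approx_gradient[OF open_domain test_function_H10_approx[OF open_domain]] by auto

lemma test_wg_sqnorm: "\<phi> \<in> TF \<Longrightarrow> sqnorm \<Omega> (wg \<phi>) = sqnorm \<Omega> (cg \<phi>)"
  by (intro sqnorm_cong_AE open_domain test_H10 test_function_sqnorm)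

lemma finite_domain: "emeasure M (space M) < \<infinity>"
proof -
  have "emeasure M (space M) = emeasure lborel \<Omega>"
    using open_domain by (simp add: emeasure_restrict_space open_sets_lebesgue borel_open)
  also have "\<dots> < \<infinity>" by (rule emeasure_bounded_finite[OF bounded_domain])
  finally show ?thesis .
qed

lemma integrable_const_domain: "integrable M (\<lambda>_. c::real)"
  using finite_domain by (simp add: integrable_iff_bounded ennreal_mult_less_top)

lemma poincare_test:
  obtains C where "C > 0" "\<And>\<phi>. \<phi> \<in> TF \<Longrightarrow> sqnorm \<Omega> \<phi> \<le> C * sqnorm \<Omega> (cg \<phi>)"
proof -
  obtain R where R: "R > 0" "\<And>x. x \<in> \<Omega> \<Longrightarrow> norm x \<le> R"
    using bounded_domain unfolding bounded_pos by auto
  have "sqnorm \<Omega> \<phi> \<le> (2*R+1)\<^sup>2 * sqnorm \<Omega> (cg \<phi>)" if "\<phi> \<in> TF" for \<phi>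
  proof -
    have "\<phi> x = 0" if "norm x > R" for x
      using test_functions_support[OF \<open>\<phi> \<in> TF\<close>, of x] R(2)[of x] that by auto
    then show ?thesis
      unfolding test_function_sqnorm[OF open_domain that]
      using C1c_poincare[OF C1c_test_function[OF that], of R] R by simp
  qed
  moreover have "(2*R+1)\<^sup>2 > 0" using R by simp
  ultimately show ?thesis by (intro that)
qed

text \<open>Passes from test functions to the closure. It controls the linear term of the energy and
  lets a vanishing gradient force a vanishing function.\<close>

lemma poincare:
  obtains C where "C > 0" "\<And>u. u \<in> H10 \<Omega> \<Longrightarrow> sqnorm \<Omega> u \<le> C * sqnorm \<Omega> (wg u)"
proof -
  obtain C where C: "C > 0" "\<And>\<phi>. \<phi> \<in> TF \<Longrightarrow> sqnorm \<Omega> \<phi> \<le> C * sqnorm \<Omega> (cg \<phi>)"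
    using poincare_test by blast
  have "sqnorm \<Omega> u \<le> C * sqnorm \<Omega> (wg u)" if u: "u \<in> H10 \<Omega>" for u
  proof -
    obtain \<phi> where a: "H10_approx \<Omega> \<phi> u (wg u)" using H10_obtain_approx[OF open_domain u] .
    then have t: "\<And>k. \<phi> k \<in> TF" by (auto simp: H10_approx_def)
    note sq = test_function_sqnorm[OF open_domain t]
    have "(\<lambda>k. sqnorm \<Omega> (\<phi> k)) \<longlonglongrightarrow> sqnorm \<Omega> u"
      using a sq by (intro L2_limit_sqnorm_self) (auto simp: H10_approx_def)
    moreover have "(\<lambda>k. C * sqnorm \<Omega> (cg (\<phi> k))) \<longlonglongrightarrow> C * sqnorm \<Omega> (wg u)"
      using a sq by (intro tendsto_mult tendsto_const L2_limit_sqnorm_self) (auto simp: H10_approx_def)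
    ultimately show ?thesis by (rule LIMSEQ_le) (use C(2) t in auto)
  qed
  with C(1) show ?thesis by (rule that)
qed

lemma powr_integral_test:
  assumes "\<phi> \<in> TF"
  shows "integrable M (\<lambda>x. \<bar>\<phi> x\<bar> powr p)" "(\<integral>x. \<bar>\<phi> x\<bar> powr p \<partial>M) = (\<integral>x. \<bar>\<phi> x\<bar> powr p \<partial>lborel)"
proof -
  note [measurable] = test_function_borel[OF assms]
  have S: "\<Omega> \<in> sets lebesgue" by (rule open_sets_lebesgue[OF open_domain])
  show "(\<integral>x. \<bar>\<phi> x\<bar> powr p \<partial>M) = (\<integral>x. \<bar>\<phi> x\<bar> powr p \<partial>lborel)"
    by (rule integrable_lebesgue_on_iff_lborel(2)[OF S]) (auto simp: test_functions_support[OF assms])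
  have c: "C1c \<phi> (cg \<phi>)" by (rule C1c_test_function[OF assms])
  obtain R where "\<And>x. norm x > R \<Longrightarrow> \<phi> x = 0" using C1c_support[OF c] by metis
  then have "integrable lborel (\<lambda>x. \<bar>\<phi> x\<bar> powr p)"
    using p_bounds C1c_continuous(1)[OF c]
    by (intro integrable_bounded_support[of _ R] continuous_on_powr' continuous_intros) auto
  then show "integrable M (\<lambda>x. \<bar>\<phi> x\<bar> powr p)"
    by (subst integrable_lebesgue_on_iff_lborel(1)[OF S]) (auto simp: test_functions_support[OF assms])
qed

text \<open>The approximants converge in the quadratic norms only, so for the power \<open>p\<close>
  one takes a subsequence converging almost everywhere and applies Fatou's lemma. The bounds may
  vary with \<open>k\<close>, which serves both the Sobolev inequality and lower bounds for the
  energy.\<close>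

lemma H10_fatou:
  assumes a: "H10_approx \<Omega> \<phi> u g" and B: "\<And>k. (\<integral>x. \<bar>\<phi> k x\<bar> powr p \<partial>M) \<le> B k" "B \<longlonglongrightarrow> B'"
  shows "integrable M (\<lambda>x. \<bar>u x\<bar> powr p)" "(\<integral>x. \<bar>u x\<bar> powr p \<partial>M) \<le> B'"
proof -
  have t: "\<And>k. \<phi> k \<in> TF" and uL2: "u \<in> L2 \<Omega>" using a by (auto simp: H10_approx_def)
  note sq = test_function_sqnorm[OF open_domain t]
  note [measurable] = L2_D(1)[OF uL2] L2_D(1)[OF sq(3)]
  obtain r :: "nat \<Rightarrow> nat" where r: "strict_mono r" "AE x in M. (\<lambda>k. \<phi> (r k) x) \<longlonglongrightarrow> u x"
    using a sq by (rule_tac L2_subseq_AE[of \<phi> \<Omega> u]) (auto simp: H10_approx_def)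
  have "(\<integral>\<^sup>+x. ennreal (\<bar>u x\<bar> powr p) \<partial>M) = (\<integral>\<^sup>+x. liminf (\<lambda>k. ennreal (\<bar>\<phi> (r k) x\<bar> powr p)) \<partial>M)"
  proof (rule nn_integral_cong_AE)
    show "AE x in M. ennreal (\<bar>u x\<bar> powr p) = liminf (\<lambda>k. ennreal (\<bar>\<phi> (r k) x\<bar> powr p))"
      using r(2)
    proof eventually_elim
      case (elim x)
      then have "(\<lambda>k. ennreal (\<bar>\<phi> (r k) x\<bar> powr p)) \<longlonglongrightarrow> ennreal (\<bar>u x\<bar> powr p)"
        using p_bounds by (intro tendsto_ennrealI tendsto_powr' tendsto_rabs tendsto_const) auto
      then show ?case by (rule lim_imp_Liminf[OF sequentially_bot, symmetric])
    qed
  qed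
  also have "\<dots> \<le> liminf (\<lambda>k. \<integral>\<^sup>+x. ennreal (\<bar>\<phi> (r k) x\<bar> powr p) \<partial>M)"
    by (intro nn_integral_liminf) measurable
  also have "\<dots> \<le> liminf (\<lambda>k. ennreal (B (r k)))"
  proof (intro Liminf_mono always_eventually allI)
    fix k
    show "(\<integral>\<^sup>+x. ennreal (\<bar>\<phi> (r k) x\<bar> powr p) \<partial>M) \<le> ennreal (B (r k))"
      using powr_integral_test(1)[OF t] B(1) by (subst nn_integral_eq_integral) (auto intro: ennreal_leI)
  qed
  also have "\<dots> = ennreal B'"
    by (rule lim_imp_Liminf[OF sequentially_bot])
       (intro tendsto_ennrealI LIMSEQ_subseq_LIMSEQ[OF B(2) r(1), unfolded o_def])
  finally have nn: "(\<integral>\<^sup>+x. ennreal (\<bar>u x\<bar> powr p) \<partial>M) \<le> ennreal B'" .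
  have "0 \<le> B k" for k using order_trans[OF _ B(1)[of k], of 0] by simp
  then have B0: "B' \<ge> 0" using B(2) by (intro LIMSEQ_le_const) auto
  show i: "integrable M (\<lambda>x. \<bar>u x\<bar> powr p)"
  proof (rule integrableI_bounded)
    show "(\<integral>\<^sup>+x. ennreal (norm (\<bar>u x\<bar> powr p)) \<partial>M) < \<infinity>"
      using order.strict_trans1[OF nn, of \<infinity>] by simp
  qed measurable
  show "(\<integral>x. \<bar>u x\<bar> powr p \<partial>M) \<le> B'"
    using nn i B0 by (subst (asm) nn_integral_eq_integral) auto
qed

text \<open>Shows that p-th powers are integrable and that the quotients defining the sharp constant
  stay away from zero.\<close>

lemma sobolev_some_constant:
  obtains K where "K > 0" "\<And>u. u \<in> H10 \<Omega> \<Longrightarrow> integrable M (\<lambda>x. \<bar>u x\<bar> powr p)"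
    "\<And>u. u \<in> H10 \<Omega> \<Longrightarrow> (\<integral>x. \<bar>u x\<bar> powr p \<partial>M) \<le> K * (sqnorm \<Omega> (wg u)) powr (p / 2)"
proof -
  have "DIM(real^'n) > 2" using dim by simp
  from C1c_sobolev[OF this] obtain K where K: "K > 0"
    "\<And>(f :: real^'n \<Rightarrow> real) G. C1c f G \<Longrightarrow> (\<integral>x. \<bar>f x\<bar> powr p \<partial>lborel) \<le> K * (\<integral>x. (norm (G x))\<^sup>2 \<partial>lborel) powr (p / 2)"
    by (auto simp: p_def)
  have "integrable M (\<lambda>x. \<bar>u x\<bar> powr p) \<and> (\<integral>x. \<bar>u x\<bar> powr p \<partial>M) \<le> K * (sqnorm \<Omega> (wg u)) powr (p / 2)"
    if u: "u \<in> H10 \<Omega>" for u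
  proof -
    obtain \<phi> where a: "H10_approx \<Omega> \<phi> u (wg u)" using H10_obtain_approx[OF open_domain u] .
    then have t: "\<And>k. \<phi> k \<in> TF" by (auto simp: H10_approx_def)
    note sq = test_function_sqnorm[OF open_domain t]
    have "(\<integral>x. \<bar>\<phi> k x\<bar> powr p \<partial>M) \<le> K * sqnorm \<Omega> (cg (\<phi> k)) powr (p / 2)" for k
      unfolding powr_integral_test(2)[OF t] sq(2) by (rule K(2)[OF C1c_test_function[OF t]])
    moreover have "(\<lambda>k. sqnorm \<Omega> (cg (\<phi> k))) \<longlonglongrightarrow> sqnorm \<Omega> (wg u)"
      using a sq by (intro L2_limit_sqnorm_self) (auto simp: H10_approx_def)
    then have "(\<lambda>k. K * sqnorm \<Omega> (cg (\<phi> k)) powr (p / 2)) \<longlonglongrightarrow> K * sqnorm \<Omega> (wg u) powr (p / 2)"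
      using p_bounds by (intro tendsto_mult tendsto_const tendsto_powr') auto
    ultimately show ?thesis
      using H10_fatou[OF a, of "\<lambda>k. K * sqnorm \<Omega> (cg (\<phi> k)) powr (p / 2)"] by simp
  qed
  with K(1) show ?thesis by (intro that) auto
qed

lemma powr_integrable: "u \<in> H10 \<Omega> \<Longrightarrow> integrable M (\<lambda>x. \<bar>u x\<bar> powr p)"
  using sobolev_some_constant by blast

definition "S = sobolev_const \<Omega>"

lemma powr_integral_eq_0_iff:
  assumes "u \<in> H10 \<Omega>"
  shows "(\<integral>x. \<bar>u x\<bar> powr p \<partial>M) = 0 \<longleftrightarrow> eq_ae \<Omega> u (\<lambda>_. 0)"
  unfolding eq_ae_def using integral_nonneg_eq_0_iff_AE[OF powr_integrable[OF assms]] by simp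

lemma Lp_norm_square: "(Lp_norm p \<Omega> u)\<^sup>2 = (\<integral>x. \<bar>u x\<bar> powr p \<partial>M) powr (2 / p)"
proof -
  have "(\<integral>x. \<bar>u x\<bar> powr p \<partial>M) \<ge> 0" by simp
  then show ?thesis
    unfolding Lp_norm_def
    by (cases "(\<integral>x. \<bar>u x\<bar> powr p \<partial>M) = 0") (auto simp: powr_powr simp flip: powr_realpow)
qed

text \<open>Every quotient is at least \<open>K powr (- 2 / p)\<close>. A box bump is exhibited to
  make the set of quotients nonempty; otherwise its infimum would carry no information.\<close>

lemma S_pos: "S > 0"
proof -
  obtain K where K: "K > 0" 
    "\<And>u. u \<in> H10 \<Omega> \<Longrightarrow> (\<integral>x. \<bar>u x\<bar> powr p \<partial>M) \<le> K * (sqnorm \<Omega> (wg u)) powr (p / 2)"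
    using sobolev_some_constant by metis
  obtain x where x: "x \<in> \<Omega>" using nonempty_domain by blast
  obtain c d where cd: "x \<in> box c d" "cbox c d \<subseteq> \<Omega>"
    using open_contains_cbox x open_domain by metis
  define v where "v = box_bump 1 c d"
  have v: "v \<in> TF" unfolding v_def by (rule box_bump_test_function[OF cd(2)])
  have "\<not> eq_ae \<Omega> v (\<lambda>_. 0)"
  proof
    assume "eq_ae \<Omega> v (\<lambda>_. 0)"
    then have "AE x in lebesgue. x \<in> \<Omega> \<longrightarrow> v x = 0"
      using open_sets_lebesgue[OF open_domain] by (simp add: eq_ae_def AE_restrict_space_iff)
    then have "AE x in lebesgue. x \<notin> box c d"
    proof eventually_elim
      case (elim y)
      show ?case
      proof
        assume "y \<in> box c d"
        then have "v y > 0" "y \<in> \<Omega>" using box_bump_pos[of y c d 1] cd(2) box_subset_cbox[of c d] by (auto simp: v_def)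
        then show False using elim by simp
      qed
    qed
    then have "box c d \<in> null_sets lebesgue" by (subst AE_iff_null_sets) (auto simp: sets_completionI_sets)
    then have "negligible (box c d)" by (simp add: negligible_iff_null_sets)
    then show False using cd(1) open_not_negligible[of "box c d"] by auto
  qed
  then have ne: "{(H10_norm \<Omega> u)\<^sup>2 / (Lp_norm (two_star CARD('n)) \<Omega> u)\<^sup>2 |u.
            u \<in> H10 \<Omega> \<and> \<not> eq_ae \<Omega> u (\<lambda>_. 0)} \<noteq> {}"
    using test_H10(1)[OF v] by auto
  have "K powr (- 2 / p) \<le> S"
    unfolding S_def sobolev_const_def
  proof (rule cInf_greatest[OF ne])
    fix z assume "z \<in> {(H10_norm \<Omega> u)\<^sup>2 / (Lp_norm (two_star CARD('n)) \<Omega> u)\<^sup>2 |u.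
            u \<in> H10 \<Omega> \<and> \<not> eq_ae \<Omega> u (\<lambda>_. 0)}"
    then obtain u where u: "u \<in> H10 \<Omega>" "\<not> eq_ae \<Omega> u (\<lambda>_. 0)"
      and z: "z = sqnorm \<Omega> (wg u) / (\<integral>x. \<bar>u x\<bar> powr p \<partial>M) powr (2 / p)"
      by (auto simp: H10_norm_eq Lp_norm_square p_def[symmetric])
    define P where "P = (\<integral>x. \<bar>u x\<bar> powr p \<partial>M)"
    define D where "D = sqnorm \<Omega> (wg u)"
    have "P \<ge> 0" "D \<ge> 0" by (auto simp: P_def D_def)
    then have P: "P > 0" using u powr_integral_eq_0_iff[OF u(1)] by (simp add: P_def less_le)
    have "P \<le> K * D powr (p / 2)" using K(2)[OF u(1)] by (simp add: P_def D_def)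
    then have "P powr (2 / p) \<le> (K * D powr (p / 2)) powr (2 / p)"
      using P p_bounds by (intro powr_mono2) auto
    also have "\<dots> = K powr (2 / p) * D"
      using K(1) \<open>D \<ge> 0\<close> p_bounds by (simp add: powr_mult powr_powr)
    finally show "K powr (- 2 / p) \<le> z"
      using P K(1) unfolding z P_def[symmetric] D_def[symmetric]
      by (simp add: powr_minus field_simps)
  qed
  moreover have "K powr (- 2 / p) > 0" using K(1) by simp
  ultimately show ?thesis by linarith
qed

text \<open>Unfolds the infimum. A function vanishing almost everywhere is treated apart because it
  is excluded from the quotients.\<close>

lemma sobolev:
  assumes u: "u \<in> H10 \<Omega>"
  shows "(\<integral>x. \<bar>u x\<bar> powr p \<partial>M) \<le> S powr (- p / 2) * sqnorm \<Omega> (wg u) powr (p / 2)"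
proof (cases "eq_ae \<Omega> u (\<lambda>_. 0)")
  case True
  then show ?thesis using powr_integral_eq_0_iff[OF u] by simp
next
  case False
  define P where "P = (\<integral>x. \<bar>u x\<bar> powr p \<partial>M)"
  define D where "D = sqnorm \<Omega> (wg u)"
  have "P \<ge> 0" "D \<ge> 0" by (auto simp: P_def D_def)
  then have P: "P > 0" using False powr_integral_eq_0_iff[OF u] by (simp add: P_def less_le)
  have "S \<le> D / P powr (2 / p)"
    unfolding S_def sobolev_const_def
  proof (rule cInf_lower)
    show "D / P powr (2 / p) \<in> {(H10_norm \<Omega> u)\<^sup>2 / (Lp_norm (two_star CARD('n)) \<Omega> u)\<^sup>2 |u.
            u \<in> H10 \<Omega> \<and> \<not> eq_ae \<Omega> u (\<lambda>_. 0)}"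
      using u False by (auto simp: H10_norm_eq Lp_norm_square p_def[symmetric] P_def D_def)
    show "bdd_below {(H10_norm \<Omega> u)\<^sup>2 / (Lp_norm (two_star CARD('n)) \<Omega> u)\<^sup>2 |u.
            u \<in> H10 \<Omega> \<and> \<not> eq_ae \<Omega> u (\<lambda>_. 0)}"
      by (rule bdd_belowI[of _ 0]) auto
  qed
  then have "P powr (2 / p) \<le> D / S" using P S_pos by (simp add: field_simps)
  then have "(P powr (2 / p)) powr (p / 2) \<le> (D / S) powr (p / 2)"
    using p_bounds by (intro powr_mono2) auto
  also have "\<dots> = S powr (- p / 2) * D powr (p / 2)"
    using S_pos \<open>D \<ge> 0\<close> by (simp add: powr_divide powr_minus field_simps)
  finally show ?thesis using P p_bounds by (simp add: powr_powr P_def D_def)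
qed

end

subsection \<open>Compactness\<close>

text \<open>Bolzano-Weierstrass for each index, followed by a diagonal sequence. It is applied to
  integrals over grid cells and to inner products of gradients.\<close>

lemma bounded_real_family_convergent_subseq:
  fixes L :: "'i::countable \<Rightarrow> nat \<Rightarrow> real"
  assumes "\<And>i. bounded (range (L i))"
  obtains r where "strict_mono (r :: nat \<Rightarrow> nat)" "\<And>i. convergent (\<lambda>n. L i (r n))"
proof -
  define P where "P n s \<longleftrightarrow> convergent (\<lambda>k. L (from_nat n) (s k))" for n :: nat and s :: "nat \<Rightarrow> nat"
  interpret subseqs P
  proof
    fix n and s :: "nat \<Rightarrow> nat" assume "strict_mono s"
    have "bounded (range (\<lambda>k. L (from_nat n) (s k)))"
      by (rule bounded_subset[OF assms[of "from_nat n"]]) auto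
    then obtain l r where "strict_mono r" "((\<lambda>k. L (from_nat n) (s k)) \<circ> r) \<longlonglongrightarrow> l"
      using bounded_imp_convergent_subsequence by blast
    then show "\<exists>r'. strict_mono r' \<and> P n (s \<circ> r')"
      by (auto simp: P_def o_def convergent_def)
  qed
  have st: "P n (s \<circ> r)" if "strict_mono r" "P n s" for r s n
    using that convergent_subseq_convergent[of "\<lambda>k. L (from_nat n) (s k)" r] by (simp add: P_def o_def)
  have "convergent (\<lambda>n. L i (diagseq n))" for i
  proof -
    have "P (to_nat i) (diagseq \<circ> ((+) (Suc (to_nat i))))"
      by (rule diagseq_holds) (rule st)
    then have "convergent (\<lambda>n. L i (diagseq (n + Suc (to_nat i))))" by (simp add: P_def o_def add.commute)
    then show ?thesis by (rule convergent_ignore_initial_segment[THEN iffD1])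
  qed
  with subseq_diagseq show ?thesis by (rule that)
qed

section \<open>Grid cells and cell averages\<close>

text \<open>For N > 0 the classes are half-open cubes of side 1/N. A relation on points is used
  instead of a list of cubes, so that averages are functions of the point.\<close>

definition same_cell :: "real \<Rightarrow> real^'n \<Rightarrow> real^'n \<Rightarrow> bool" where
  "same_cell N x y \<longleftrightarrow> (\<forall>i. \<lfloor>N * x $ i\<rfloor> = \<lfloor>N * y $ i\<rfloor>)"

text \<open>The prefactor is the reciprocal of the cell volume.\<close>

definition cell_average :: "real \<Rightarrow> (real^'n \<Rightarrow> real) \<Rightarrow> real^'n \<Rightarrow> real" where
  "cell_average N f x = N ^ CARD('n) * (\<integral>y. indicator {y. same_cell N x y} y * f y \<partial>lborel)"

lemma same_cell_measurable [measurable]: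
  "Measurable.pred (borel \<Otimes>\<^sub>M borel) (\<lambda>(x, y). same_cell N x (y :: real^'n))"
proof -
  have [measurable]: "(\<lambda>x. x $ i) \<in> borel_measurable borel" for i :: 'n
    by (intro borel_measurable_continuous_onI continuous_intros)
  show ?thesis unfolding same_cell_def split_beta' by measurable
qed

lemma same_cell_measurable' [measurable]: "{y. same_cell N x y} \<in> sets (borel :: (real^'n) measure)"
proof -
  have "Measurable.pred borel (\<lambda>y::real^'n. case (x, y) of (x, y) \<Rightarrow> same_cell N x y)"
    by (rule measurable_compose[OF _ same_cell_measurable]) measurable
  then show ?thesis by (simp add: pred_def)
qed

text \<open>The cell lies between an open and a closed box of equal measure.\<close>

lemma cell_measure:
  fixes x :: "real^'n"
  assumes N: "N > 0"
  shows "emeasure lborel {y. same_cell N x y} = ennreal (1 / N ^ CARD('n))"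
proof -
  define a where "a = (\<chi> i. \<lfloor>N * x $ i\<rfloor> / N)"
  define b where "b = (\<chi> i. (\<lfloor>N * x $ i\<rfloor> + 1) / N)"
  let ?Q = "{y. same_cell N x y}"
  have "a $ i < b $ i" for i using N by (simp add: a_def b_def divide_strict_right_mono)
  then have ne: "cbox a b \<noteq> {}" by (auto simp: interval_eq_empty_cart not_less intro: less_imp_le)
  have c: "measure lborel (cbox a b) = 1 / N ^ CARD('n)"
    by (subst content_cbox_cart[OF ne]) (simp add: a_def b_def diff_divide_distrib[symmetric] power_one_over)
  have Q: "y \<in> ?Q \<longleftrightarrow> (\<forall>i. a $ i \<le> y $ i \<and> y $ i < b $ i)" for y
  proof -
    have "\<lfloor>N * x $ i\<rfloor> = \<lfloor>N * y $ i\<rfloor> \<longleftrightarrow> a $ i \<le> y $ i \<and> y $ i < b $ i" for i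
    proof -
      have "\<lfloor>N * x $ i\<rfloor> = \<lfloor>N * y $ i\<rfloor> \<longleftrightarrow> \<lfloor>N * x $ i\<rfloor> \<le> N * y $ i \<and> N * y $ i < \<lfloor>N * x $ i\<rfloor> + 1"
        using floor_eq_iff[of "N * y $ i" "\<lfloor>N * x $ i\<rfloor>"] by auto
      then show ?thesis using N by (simp add: a_def b_def field_simps)
    qed
    then show ?thesis by (simp add: same_cell_def)
  qed
  have sub: "box a b \<subseteq> ?Q" "?Q \<subseteq> cbox a b"
    unfolding subset_iff Q mem_box_cart by (auto intro: less_imp_le)
  have eb: "emeasure lborel (box a b) = emeasure lborel (cbox a b)"
    by (simp add: emeasure_lborel_box_eq emeasure_lborel_cbox_eq)
  have "emeasure lborel ?Q = emeasure lborel (cbox a b)"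
    using emeasure_mono[OF sub(1), of lborel] emeasure_mono[OF sub(2), of lborel] eb by (simp add: antisym)
  also have "\<dots> = ennreal (1 / N ^ CARD('n))"
    unfolding c[symmetric] using emeasure_bounded_finite[OF bounded_cbox, of a b]
    by (intro emeasure_eq_ennreal_measure) auto
  finally show ?thesis .
qed

lemma same_cell_dist:
  fixes x h :: "real^'n"
  assumes N: "N > 0" and s: "same_cell N x (x + h)"
  shows "norm h \<le> CARD('n) / N"
proof -
  have "\<bar>h $ i\<bar> \<le> 1 / N" for i
  proof -
    have "\<lfloor>N * x $ i\<rfloor> = \<lfloor>N * x $ i + N * h $ i\<rfloor>"
      using s by (simp add: same_cell_def algebra_simps)
    then have "\<bar>N * h $ i\<bar> \<le> 1" by linarith
    then show ?thesis using N by (simp add: abs_mult field_simps)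
  qed
  then have "(\<Sum>i\<in>UNIV. \<bar>h $ i\<bar>) \<le> (\<Sum>i\<in>(UNIV::'n set). 1 / N)" by (intro sum_mono)
  then show ?thesis using norm_le_l1_cart[of h] by simp
qed

text \<open>Again the square of a mean is at most the mean of the squares. The shifted cell is then
  enlarged to a ball around 0, so that the range of \<open>h\<close> no longer depends on
  \<open>x\<close> and the integrals can be exchanged.\<close>

lemma cell_average_deviation:
  fixes f :: "real^'n \<Rightarrow> real"
  assumes N: "N > 0" and fG: "C1c f G"
  shows "ennreal ((f x - cell_average N f x)\<^sup>2)
    \<le> (\<integral>\<^sup>+h. indicator (cball 0 (CARD('n) / N)) h * ennreal (N ^ CARD('n) * (f (x + h) - f x)\<^sup>2) \<partial>lborel)"
proof -
  have cont: "continuous_on UNIV f" by (rule C1c_continuous(1)[OF fG])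
  then have [measurable]: "f \<in> borel_measurable borel" by (rule borel_measurable_continuous_onI)
  obtain R where R: "\<And>x. norm x > R \<Longrightarrow> f x = 0" using C1c_support[OF fG] by metis
  let ?Q = "{y. same_cell N x y}" and ?n = "N ^ CARD('n)"
  define c where "c = f x - cell_average N f x"
  define g where "g y = f x - f y" for y
  have n: "?n > 0" using N by simp
  have I0: "integrable lborel (indicator ?Q :: _ \<Rightarrow> real)" "(\<integral>y. indicator ?Q y \<partial>lborel) = 1 / ?n"
    using cell_measure[OF N, of x] n by (auto simp: measure_def)
  have If: "integrable lborel (\<lambda>y. indicator ?Q y * f y)" "integrable lborel (\<lambda>y. indicator ?Q y * (f y)\<^sup>2)"
    using integrable_mult_indicator[of ?Q lborel f] integrable_bounded_support[OF cont R]
      integrable_mult_indicator[of ?Q lborel "\<lambda>y. (f y)\<^sup>2"] C1c_integrable_square(1)[OF fG] by auto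
  have Ig: "(\<lambda>y. indicator ?Q y * g y) = (\<lambda>y. f x * indicator ?Q y - indicator ?Q y * f y)"
    "(\<lambda>y. indicator ?Q y * (g y)\<^sup>2) = (\<lambda>y. (f x)\<^sup>2 * indicator ?Q y - 2 * f x * (indicator ?Q y * f y) + indicator ?Q y * (f y)\<^sup>2)"
    by (auto simp: g_def fun_eq_iff power2_eq_square algebra_simps)
  have Ig': "integrable lborel (\<lambda>y. indicator ?Q y * g y)" "integrable lborel (\<lambda>y. indicator ?Q y * (g y)\<^sup>2)"
    unfolding Ig using I0(1) If by auto
  have cg: "(\<integral>y. indicator ?Q y * g y \<partial>lborel) = c / ?n"
    unfolding Ig using I0 If n N by (simp add: c_def cell_average_def diff_divide_distrib)
  have "0 \<le> (\<integral>y. indicator ?Q y * (g y - c)\<^sup>2 \<partial>lborel)" by simp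
  also have "(\<lambda>y. indicator ?Q y * (g y - c)\<^sup>2) = (\<lambda>y. indicator ?Q y * (g y)\<^sup>2 - 2 * c * (indicator ?Q y * g y) + c\<^sup>2 * indicator ?Q y)"
    by (auto simp: fun_eq_iff power2_eq_square algebra_simps)
  also have "(\<integral>y. indicator ?Q y * (g y)\<^sup>2 - 2 * c * (indicator ?Q y * g y) + c\<^sup>2 * indicator ?Q y \<partial>lborel)
     = (\<integral>y. indicator ?Q y * (g y)\<^sup>2 \<partial>lborel) - 2 * c * (c / ?n) + c\<^sup>2 * (1 / ?n)"
    using Ig' I0 cg by simp
  finally have "c\<^sup>2 / ?n \<le> (\<integral>y. indicator ?Q y * (g y)\<^sup>2 \<partial>lborel)" by (simp add: power2_eq_square)
  then have "c\<^sup>2 \<le> (\<integral>y. ?n * (indicator ?Q y * (g y)\<^sup>2) \<partial>lborel)" using n by (simp add: field_simps)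
  then have "ennreal (c\<^sup>2) \<le> (\<integral>\<^sup>+y. ennreal (?n * (indicator ?Q y * (g y)\<^sup>2)) \<partial>lborel)"
    using Ig' n by (subst nn_integral_eq_integral) (auto intro: ennreal_leI)
  also have "\<dots> = (\<integral>\<^sup>+h. ennreal (?n * (indicator ?Q (h + x) * (g (h + x))\<^sup>2)) \<partial>lborel)"
    unfolding g_def by (rule nn_integral_lborel_translation[symmetric]) measurable
  also have "\<dots> \<le> (\<integral>\<^sup>+h. indicator (cball 0 (CARD('n) / N)) h * ennreal (?n * (f (x + h) - f x)\<^sup>2) \<partial>lborel)"
  proof (rule nn_integral_mono)
    fix h
    show "ennreal (?n * (indicator ?Q (h + x) * (g (h + x))\<^sup>2)) \<le> indicator (cball 0 (CARD('n) / N)) h * ennreal (?n * (f (x + h) - f x)\<^sup>2)"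
      using same_cell_dist[OF N, of x h]
      by (auto simp: indicator_def g_def add.commute power2_commute)
  qed
  finally show ?thesis by (simp add: c_def)
qed

lemma cell_average_measurable [measurable]:
  fixes f :: "real^'n \<Rightarrow> real"
  assumes [measurable]: "f \<in> borel_measurable borel"
  shows "cell_average N f \<in> borel_measurable borel"
proof -
  have "(\<lambda>x::real^'n. \<integral>y. (if same_cell N x y then f y else 0) \<partial>lborel) \<in> borel_measurable borel"
    by (rule lborel.borel_measurable_lebesgue_integral) measurable
  moreover have "indicator {y. same_cell N x y} y * f y = (if same_cell N x y then f y else 0)" for x y
    by (simp add: indicator_def)
  ultimately show ?thesis unfolding cell_average_def by simp
qed

text \<open>Only shifts in a ball of radius d/N occur. The N^d in the denominator of its volume
  cancels the normalization of the average, and the translation estimate contributes (d/N)^2, so the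
  unit ball volume times d^(d+2) remains over N^2.\<close>

lemma cell_average_L2_deviation:
  fixes f :: "real^'n \<Rightarrow> real"
  assumes N: "N > 0" and fG: "C1c f G"
  defines "C \<equiv> unit_ball_vol (real CARD('n)) * real CARD('n) ^ (CARD('n) + 2)"
  shows "(\<integral>\<^sup>+x. ennreal ((f x - cell_average N f x)\<^sup>2) \<partial>lborel)
    \<le> ennreal (C / N\<^sup>2 * (\<integral>x. (norm (G x))\<^sup>2 \<partial>lborel))"
proof -
  have [measurable]: "f \<in> borel_measurable borel"
    using C1c_continuous(1)[OF fG] by (rule borel_measurable_continuous_onI)
  define d where "d = CARD('n)"
  define \<omega> where "\<omega> = unit_ball_vol (real d)"
  have \<omega>: "\<omega> \<ge> 0" by (simp add: \<omega>_def)
  define \<Gamma> where "\<Gamma> = (\<integral>x. (norm (G x))\<^sup>2 \<partial>lborel)"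
  have \<Gamma>: "\<Gamma> \<ge> 0" by (simp add: \<Gamma>_def)
  let ?B = "cball (0::real^'n) (d / N)"
  have [measurable]: "?B \<in> sets borel" by simp
  let ?F = "\<lambda>x h. indicator ?B h * ennreal (N ^ d * (f (x + h) - f x)\<^sup>2)"
  have "(\<integral>\<^sup>+x. ennreal ((f x - cell_average N f x)\<^sup>2) \<partial>lborel) \<le> (\<integral>\<^sup>+x. (\<integral>\<^sup>+h. ?F x h \<partial>lborel) \<partial>lborel)"
    using cell_average_deviation[OF N fG] by (intro nn_integral_mono) (simp add: d_def)
  also have "\<dots> = (\<integral>\<^sup>+h. (\<integral>\<^sup>+x. ?F x h \<partial>lborel) \<partial>lborel)"
    by (rule lborel_pair.Fubini') simp
  also have "\<dots> \<le> (\<integral>\<^sup>+h. indicator ?B h * ennreal (N ^ d * ((d / N)\<^sup>2 * \<Gamma>)) \<partial>lborel)"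
  proof (rule nn_integral_mono)
    fix h
    show "(\<integral>\<^sup>+x. ?F x h \<partial>lborel) \<le> indicator ?B h * ennreal (N ^ d * ((d / N)\<^sup>2 * \<Gamma>))"
    proof (cases "h \<in> ?B")
      case True
      have "(\<integral>\<^sup>+x. ?F x h \<partial>lborel) = ennreal (N ^ d) * (\<integral>\<^sup>+x. ennreal ((f (x + h) - f x)\<^sup>2) \<partial>lborel)"
        using True N by (subst nn_integral_cmult[symmetric]) (auto simp: ennreal_mult)
      also have "\<dots> \<le> ennreal (N ^ d) * ennreal ((norm h)\<^sup>2 * \<Gamma>)"
        unfolding \<Gamma>_def by (intro mult_left_mono C1c_translation_estimate[OF fG]) simp
      also have "\<dots> \<le> ennreal (N ^ d) * ennreal ((d / N)\<^sup>2 * \<Gamma>)"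
        using True \<Gamma> by (intro mult_left_mono ennreal_leI mult_right_mono power_mono) auto
      also have "\<dots> = ennreal (N ^ d * ((d / N)\<^sup>2 * \<Gamma>))" using N \<Gamma> by (simp add: ennreal_mult)
      finally show ?thesis using True by simp
    qed simp
  qed
  also have "\<dots> = emeasure lborel ?B * ennreal (N ^ d * ((d / N)\<^sup>2 * \<Gamma>))"
    by (subst nn_integral_multc) auto
  also have "\<dots> = ennreal (\<omega> * (d / N) ^ d) * ennreal (N ^ d * ((d / N)\<^sup>2 * \<Gamma>))"
    using N by (subst emeasure_cball) (auto simp: \<omega>_def d_def)
  also have "\<dots> = ennreal (\<omega> * (d / N) ^ d * (N ^ d * ((d / N)\<^sup>2 * \<Gamma>)))"
    using N \<Gamma> \<omega> by (subst ennreal_mult) auto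
  also have "\<omega> * (d / N) ^ d * (N ^ d * ((d / N)\<^sup>2 * \<Gamma>)) = C / N\<^sup>2 * \<Gamma>"
    using N by (simp add: C_def \<omega>_def d_def power_divide power_add power2_eq_square field_simps)
  finally show ?thesis by (simp add: \<Gamma>_def)
qed

section \<open>Rellich's theorem\<close>

context bounded_domain
begin

lemma bounded_L2:
  fixes f :: "real^'n \<Rightarrow> real"
  assumes "f \<in> borel_measurable M" "\<And>x. \<bar>f x\<bar> \<le> C"
  shows "f \<in> L2 \<Omega>"
proof (rule L2_I[OF assms(1)])
  show "integrable M (\<lambda>x. (norm (f x))\<^sup>2)"
  proof (rule Bochner_Integration.integrable_bound[OF integrable_const_domain[of "C\<^sup>2"]])
    show "AE x in M. norm ((norm (f x))\<^sup>2) \<le> norm (C\<^sup>2)"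
      using assms(2) by (intro AE_I2) (auto intro: order_trans[OF _ abs_ge_self] simp flip: abs_le_square_iff)
  qed (use assms(1) in measurable)
qed

lemma L1_le_L2:
  fixes f :: "real^'n \<Rightarrow> real"
  assumes "f \<in> L2 \<Omega>"
  shows "integrable M (\<lambda>x. \<bar>f x\<bar>)" "(\<integral>x. \<bar>f x\<bar> \<partial>M) \<le> sqrt (measure M (space M)) * sqrt (sqnorm \<Omega> f)"
proof -
  have 1: "(\<lambda>_. 1::real) \<in> L2 \<Omega>" by (rule bounded_L2[of _ 1]) auto
  show "integrable M (\<lambda>x. \<bar>f x\<bar>)" using L2_mult_integrable[OF 1 assms] by simp
  show "(\<integral>x. \<bar>f x\<bar> \<partial>M) \<le> sqrt (measure M (space M)) * sqrt (sqnorm \<Omega> f)"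
    using L2_Cauchy_Schwarz_norm[OF 1 assms] by simp
qed

lemma test_function_cell_average:
  assumes \<phi>: "\<phi> \<in> TF"
  shows "\<bar>\<integral>y. indicator {y. same_cell N x y} y * \<phi> y \<partial>lborel\<bar> \<le> sqrt (measure M (space M)) * sqrt (sqnorm \<Omega> \<phi>)"
proof -
  note [measurable] = test_function_borel[OF \<phi>]
  note S = open_sets_lebesgue[OF open_domain]
  have i: "integrable lborel (\<lambda>x. \<bar>\<phi> x\<bar>)" "(\<integral>x. \<bar>\<phi> x\<bar> \<partial>M) = (\<integral>x. \<bar>\<phi> x\<bar> \<partial>lborel)"
    using integrable_lebesgue_on_iff_lborel[OF S, of "\<lambda>x. \<bar>\<phi> x\<bar>"] L1_le_L2(1)[OF test_function_sqnorm(3)[OF open_domain \<phi>]]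
      test_functions_support[OF \<phi>] by auto
  have "\<bar>\<integral>y. indicator {y. same_cell N x y} y * \<phi> y \<partial>lborel\<bar> \<le> (\<integral>y. \<bar>indicator {y. same_cell N x y} y * \<phi> y\<bar> \<partial>lborel)"
    by (rule integral_abs_bound)
  also have "\<dots> \<le> (\<integral>y. \<bar>\<phi> y\<bar> \<partial>lborel)"
  proof (rule integral_mono[OF _ i(1)])
    show "integrable lborel (\<lambda>y. \<bar>indicator {y. same_cell N x y} y * \<phi> y\<bar>)"
      by (rule Bochner_Integration.integrable_bound[OF i(1)]) (auto simp: indicator_def)
  qed (auto simp: indicator_def)
  also have "\<dots> \<le> sqrt (measure M (space M)) * sqrt (sqnorm \<Omega> \<phi>)"
    using L1_le_L2(2)[OF test_function_sqnorm(3)[OF open_domain \<phi>]] i(2) by simp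
  finally show ?thesis .
qed

text \<open>For a fixed grid the averages are determined by countably many bounded integrals, so one
  diagonal subsequence makes them converge for all grids at once. The squared distance to the
  averages is at most a constant over N^2, uniformly along the sequence, so the subsequence is
  Cauchy.\<close>

theorem rellich:
  fixes \<phi> :: "nat \<Rightarrow> real^'n \<Rightarrow> real"
  assumes \<phi>: "\<And>n. \<phi> n \<in> TF" and R: "\<And>n. sqnorm \<Omega> (cg (\<phi> n)) \<le> R"
  obtains r u where "strict_mono (r :: nat \<Rightarrow> nat)" "u \<in> L2 \<Omega>" "(\<lambda>n. sqnorm \<Omega> (\<lambda>x. u x - \<phi> (r n) x)) \<longlonglongrightarrow> 0"
proof -
  note sq = test_function_sqnorm[OF open_domain \<phi>]
  note S = open_sets_lebesgue[OF open_domain]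
  have R0: "R \<ge> 0" using R[of 0] sqnorm_nonneg order_trans by blast
  obtain P where P: "P > 0" "\<And>\<phi>. \<phi> \<in> TF \<Longrightarrow> sqnorm \<Omega> \<phi> \<le> P * sqnorm \<Omega> (cg \<phi>)"
    using poincare_test by blast
  define B where "B = sqrt (measure M (space M)) * sqrt (P * R)"
  have B: "\<bar>\<integral>y. indicator {y. same_cell N x y} y * \<phi> n y \<partial>lborel\<bar> \<le> B" for N x n
  proof -
    have "sqnorm \<Omega> (\<phi> n) \<le> P * R"
      using P(2)[OF \<phi>[of n]] mult_left_mono[OF R[of n], of P] P(1) by linarith
    then have "sqrt (measure M (space M)) * sqrt (sqnorm \<Omega> (\<phi> n)) \<le> B"
      unfolding B_def by (intro mult_left_mono real_sqrt_le_mono) auto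
    then show ?thesis using test_function_cell_average[OF \<phi>[of n], of N x] by linarith
  qed
  \<comment> \<open>Cells are indexed by grid size and integer coordinates, a countable type,
    instead of by the points they contain.\<close>
  define L where "L i n = (\<integral>y. indicator {y. \<forall>j. \<lfloor>real (fst i) * y $ j\<rfloor> = snd i $ j} y * \<phi> n y \<partial>lborel)"
    for i :: "nat \<times> (int^'n)" and n
  have cell: "{y. same_cell (real N) x y} = {y. \<forall>j. \<lfloor>real N * y $ j\<rfloor> = (\<chi> j. \<lfloor>real N * x $ j\<rfloor>) $ j}" for N x
    by (auto simp: same_cell_def)
  have "bounded (range (L i))" for i
  proof (cases "\<exists>x. \<forall>j. \<lfloor>real (fst i) * x $ j\<rfloor> = snd i $ j")
    case True
    then obtain x where "\<forall>j. \<lfloor>real (fst i) * x $ j\<rfloor> = snd i $ j" by blast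
    then have "{y. \<forall>j. \<lfloor>real (fst i) * y $ j\<rfloor> = snd i $ j} = {y. same_cell (real (fst i)) x y}"
      by (auto simp: same_cell_def)
    then have "\<bar>L i n\<bar> \<le> B" for n unfolding L_def using B by simp
    then show ?thesis unfolding bounded_iff by (auto intro!: exI[of _ B])
  next
    \<comment> \<open>Occurs only for grid size 0 with a nonzero integer vector.\<close>
    case False
    then have "{y. \<forall>j. \<lfloor>real (fst i) * y $ j\<rfloor> = snd i $ j} = {}" by auto
    then have "L i n = 0" for n unfolding L_def by simp
    then show ?thesis by (simp add: image_constant_conv)
  qed
  then obtain r where r: "strict_mono r" "\<And>i. convergent (\<lambda>n. L i (r n))"
    using bounded_real_family_convergent_subseq by blast
  define A where "A N n = cell_average (real N) (\<phi> (r n))" for N n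
  define F where "F N x = lim (\<lambda>n. A N n x)" for N x
  have AF: "(\<lambda>n. A N n x) \<longlonglongrightarrow> F N x" for N x
  proof -
    have "A N n x = real N ^ CARD('n) * L (N, \<chi> j. \<lfloor>real N * x $ j\<rfloor>) (r n)" for n
      unfolding A_def cell_average_def L_def cell by simp
    moreover obtain l where "(\<lambda>n. L (N, \<chi> j. \<lfloor>real N * x $ j\<rfloor>) (r n)) \<longlonglongrightarrow> l"
      using r(2) unfolding convergent_def by blast
    then have "(\<lambda>n. real N ^ CARD('n) * L (N, \<chi> j. \<lfloor>real N * x $ j\<rfloor>) (r n)) \<longlonglongrightarrow> real N ^ CARD('n) * l"
      by (rule tendsto_mult_left)
    ultimately have "convergent (\<lambda>n. A N n x)" by (auto simp: convergent_def)
    then show ?thesis unfolding F_def by (rule convergent_LIMSEQ_iff[THEN iffD1])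
  qed
  have Am: "A N n \<in> borel_measurable M" for N n
    unfolding A_def by (intro borel_measurable_lebesgue_onI cell_average_measurable test_function_borel[OF \<phi>])
  have AB: "\<bar>A N n x\<bar> \<le> real N ^ CARD('n) * B" for N n x
    unfolding A_def cell_average_def abs_mult using B by (simp add: mult_left_mono)
  have Fm: "F N \<in> borel_measurable M" for N
    by (rule borel_measurable_LIMSEQ_real[OF AF Am])
  have FB: "\<bar>F N x\<bar> \<le> real N ^ CARD('n) * B" for N x
    by (rule LIMSEQ_le_const2[OF tendsto_rabs[OF AF]]) (use AB in auto)
  have AL2: "A N n \<in> L2 \<Omega>" and FL2: "F N \<in> L2 \<Omega>" for N n
    using bounded_L2[OF Am AB] bounded_L2[OF Fm FB] by auto
  have AFL: "(\<lambda>n. sqnorm \<Omega> (\<lambda>x. A N n x - F N x)) \<longlonglongrightarrow> 0" for N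
  proof -
    have "(\<lambda>n. sqnorm \<Omega> (\<lambda>x. A N n x - F N x)) \<longlonglongrightarrow> (\<integral>x. 0 \<partial>M)"
    proof (rule integral_dominated_convergence[where w="\<lambda>_. (2 * (real N ^ CARD('n) * B))\<^sup>2"])
      show "AE x in M. (\<lambda>n. (norm (A N n x - F N x))\<^sup>2) \<longlonglongrightarrow> 0"
      proof (rule AE_I2)
        fix x
        have "(\<lambda>n. (norm (A N n x - F N x))\<^sup>2) \<longlonglongrightarrow> (norm (F N x - F N x))\<^sup>2"
          by (intro tendsto_intros AF)
        then show "(\<lambda>n. (norm (A N n x - F N x))\<^sup>2) \<longlonglongrightarrow> 0" by simp
      qed
      show "AE x in M. norm ((norm (A N n x - F N x))\<^sup>2) \<le> (2 * (real N ^ CARD('n) * B))\<^sup>2" for n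
      proof (rule AE_I2)
        fix x
        have "\<bar>A N n x - F N x\<bar> \<le> 2 * (real N ^ CARD('n) * B)" using AB[of N n x] FB[of N x] by linarith
        then have "\<bar>A N n x - F N x\<bar>\<^sup>2 \<le> (2 * (real N ^ CARD('n) * B))\<^sup>2" by (intro power_mono) auto
        then show "norm ((norm (A N n x - F N x))\<^sup>2) \<le> (2 * (real N ^ CARD('n) * B))\<^sup>2" by simp
      qed
      show "(\<lambda>x. (norm (A N n x - F N x))\<^sup>2) \<in> borel_measurable M" for n
        using Am[of N n] Fm[of N] by measurable
    qed (simp, rule integrable_const_domain)
    then show ?thesis by simp
  qed
  define C where "C = unit_ball_vol (real CARD('n)) * real CARD('n) ^ (CARD('n) + 2)"
  have dev: "sqnorm \<Omega> (\<lambda>x. \<phi> (r n) x - A N n x) \<le> C / (real N)\<^sup>2 * R" if N: "N > 0" for N n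
  proof -
    let ?f = "\<phi> (r n)"
    note [measurable] = test_function_borel[OF \<phi>[of "r n"]]
    have C0: "C \<ge> 0" by (simp add: C_def)
    have A': "A N n \<in> borel_measurable borel" unfolding A_def by measurable
    have "ennreal (sqnorm \<Omega> (\<lambda>x. ?f x - A N n x)) = (\<integral>\<^sup>+x. ennreal ((?f x - A N n x)\<^sup>2) \<partial>M)"
      using L2_D(2)[OF L2_diff[OF sq(3) AL2]] by (subst nn_integral_eq_integral) auto
    also have "\<dots> \<le> (\<integral>\<^sup>+x. ennreal ((?f x - A N n x)\<^sup>2) \<partial>lebesgue)"
      using S by (subst nn_integral_restrict_space) (auto intro!: nn_integral_mono simp: indicator_def)
    also have "\<dots> = (\<integral>\<^sup>+x. ennreal ((?f x - A N n x)\<^sup>2) \<partial>lborel)"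
      by (rule nn_integral_completion)
    also have "\<dots> \<le> ennreal (C / (real N)\<^sup>2 * (\<integral>x. (norm (cg ?f x))\<^sup>2 \<partial>lborel))"
      unfolding A_def C_def using N by (intro cell_average_L2_deviation C1c_test_function[OF \<phi>]) simp
    also have "\<dots> \<le> ennreal (C / (real N)\<^sup>2 * R)"
      unfolding sq(2)[symmetric] using C0 R by (intro ennreal_leI mult_left_mono) auto
    finally show ?thesis using C0 R0 by (subst (asm) ennreal_le_iff) auto
  qed
  have cauchy: "\<exists>K. \<forall>m\<ge>K. \<forall>n\<ge>K. sqnorm \<Omega> (\<lambda>x. \<phi> (r m) x - \<phi> (r n) x) < e" if e: "e > 0" for e
  proof -
    have "(\<lambda>N. C / (real N)\<^sup>2 * R) \<longlonglongrightarrow> 0"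
    proof -
      have "(\<lambda>N. C * R * (inverse (real N))\<^sup>2) \<longlonglongrightarrow> C * R * 0\<^sup>2" by (intro tendsto_intros lim_inverse_n)
      then show ?thesis by (simp add: field_simps)
    qed
    \<comment> \<open>The triangle inequality for squares doubles both terms and is used twice: from
      e/16 to e/4, then from e/4 to e.\<close>
    then have "eventually (\<lambda>N. C / (real N)\<^sup>2 * R < e / 16) sequentially"
      by (rule order_tendstoD) (use e in simp)
    then obtain N where N: "N > 0" "C / (real N)\<^sup>2 * R < e / 16"
      using eventually_conj[OF _ eventually_gt_at_top[of "0::nat"]] by (metis (no_types, lifting) eventually_happens' sequentially_bot)
    have "eventually (\<lambda>n. sqnorm \<Omega> (\<lambda>x. A N n x - F N x) < e / 16) sequentially"
      by (rule order_tendstoD[OF AFL]) (use e in simp)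
    then obtain K where K: "\<And>n. n \<ge> K \<Longrightarrow> sqnorm \<Omega> (\<lambda>x. A N n x - F N x) < e / 16"
      by (auto simp: eventually_sequentially)
    have one: "sqnorm \<Omega> (\<lambda>x. \<phi> (r n) x - F N x) < e / 4" if "n \<ge> K" for n
      using sqnorm_triangle[OF sq(3) AL2 FL2, of "r n" N N n] dev[OF N(1), of n] N(2) K[OF that] by linarith
    have "sqnorm \<Omega> (\<lambda>x. \<phi> (r m) x - \<phi> (r n) x) < e" if "m \<ge> K" "n \<ge> K" for m n
      using sqnorm_triangle[OF sq(3)[of "r m"] FL2[of N] sq(3)[of "r n"]] one[OF that(1)] one[OF that(2)]
        sqnorm_commute[of \<Omega> "F N" "\<phi> (r n)"] by linarith
    then show ?thesis by blast
  qed
  obtain u where "u \<in> L2 \<Omega>" "(\<lambda>n. sqnorm \<Omega> (\<lambda>x. u x - \<phi> (r n) x)) \<longlonglongrightarrow> 0"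
    using L2_complete[of "\<lambda>n. \<phi> (r n)" \<Omega>] sq(3) cauchy by blast
  with r(1) show ?thesis by (rule that)
qed

end

section \<open>Midpoint hulls and weak limits\<close>

text \<open>Stands in for the convex hull: the parallelogram law needs only midpoints, and every
  closure property becomes a short induction.\<close>

inductive_set midpoint_hull :: "('a \<Rightarrow> real) set \<Rightarrow> ('a \<Rightarrow> real) set" for A where
  base: "f \<in> A \<Longrightarrow> f \<in> midpoint_hull A"
| mid: "f \<in> midpoint_hull A \<Longrightarrow> g \<in> midpoint_hull A \<Longrightarrow> (\<lambda>x. 1/2 * f x + 1/2 * g x) \<in> midpoint_hull A"

lemma midpoint_hull_mono: "A \<subseteq> B \<Longrightarrow> midpoint_hull A \<subseteq> midpoint_hull B"
proof
  fix f assume "A \<subseteq> B" "f \<in> midpoint_hull A"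
  from this(2,1) show "f \<in> midpoint_hull B"
  proof induction
    case (mid f g)
    then show ?case by (intro midpoint_hull.mid)
  qed (auto intro: midpoint_hull.base)
qed

lemma sqnorm_midpoint_le:
  assumes "f \<in> L2 \<Omega>" "g \<in> L2 \<Omega>" "sqnorm \<Omega> f \<le> e" "sqnorm \<Omega> g \<le> e"
  shows "sqnorm \<Omega> (\<lambda>x. (1/2) *\<^sub>R f x + (1/2) *\<^sub>R g x) \<le> e"
proof -
  have "sqnorm \<Omega> (\<lambda>x. (1/2) *\<^sub>R f x + (1/2) *\<^sub>R g x) = (sqnorm \<Omega> f + 2 * ip \<Omega> f g + sqnorm \<Omega> g) / 4"
    by (subst sqnorm_linear_combination[OF assms(1,2)]) (simp add: power2_eq_square)
  moreover have "0 \<le> sqnorm \<Omega> f - 2 * ip \<Omega> f g + sqnorm \<Omega> g"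
    using sqnorm_nonneg[of \<Omega> "\<lambda>x. f x - g x"] unfolding sqnorm_diff[OF assms(1,2)] .
  moreover have "x \<le> e" if "x = (a + 2 * b + c) / 4" "0 \<le> a - 2 * b + c" "a \<le> e" "c \<le> e" for x a b c :: real
    using that by (simp add: field_simps)
  ultimately show ?thesis using assms(3,4) by blast
qed

lemma ip_linear_combination_left:
  assumes "f \<in> L2 \<Omega>" "g \<in> L2 \<Omega>" "h \<in> L2 \<Omega>"
  shows "ip \<Omega> (\<lambda>x. c *\<^sub>R f x + e *\<^sub>R g x) h = c * ip \<Omega> f h + e * ip \<Omega> g h"
  using assms by (simp add: inner_add_left L2_inner_integrable)

lemma ip_commute: "ip \<Omega> f g = ip \<Omega> g f"
  by (simp add: inner_commute)

lemma ip_self: "ip \<Omega> f f = sqnorm \<Omega> f"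
  by (simp add: power2_norm_eq_inner)

context bounded_domain
begin

lemma test_L2: "\<phi> \<in> TF \<Longrightarrow> \<phi> \<in> L2 \<Omega>" "\<phi> \<in> TF \<Longrightarrow> cg \<phi> \<in> L2 \<Omega>"
  using test_function_sqnorm[OF open_domain] by auto

lemma midpoint_hull_TF:
  assumes "v \<in> midpoint_hull A" "A \<subseteq> TF"
  shows "v \<in> TF"
  using assms
proof induction
  case (mid f g)
  then show ?case by (intro test_functions_linear_combination)
qed auto

lemma cg_mid:
  "f \<in> TF \<Longrightarrow> g \<in> TF \<Longrightarrow> cg (\<lambda>x. 1/2 * f x + 1/2 * g x) = (\<lambda>x. (1/2) *\<^sub>R cg f x + (1/2) *\<^sub>R cg g x)"
  by (rule classical_gradient_linear_combination)

text \<open>Balls are convex, so the L2 limit of a sequence is also the limit of any choice of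
  elements from its tail hulls.\<close>

lemma midpoint_hull_sqnorm_le:
  assumes v: "v \<in> midpoint_hull A" and A: "A \<subseteq> TF" and u: "u \<in> L2 \<Omega>"
    and e: "\<And>f. f \<in> A \<Longrightarrow> sqnorm \<Omega> (\<lambda>x. u x - f x) \<le> e"
  shows "sqnorm \<Omega> (\<lambda>x. u x - v x) \<le> e"
  using v
proof induction
  case (mid f g)
  note L = test_L2(1)[OF midpoint_hull_TF[OF mid(1) A]] test_L2(1)[OF midpoint_hull_TF[OF mid(2) A]]
  have eq: "u x - (1/2 * f x + 1/2 * g x) = (1/2) *\<^sub>R (u x - f x) + (1/2) *\<^sub>R (u x - g x)" for x
    by (simp add: diff_divide_distrib)
  show ?case
    unfolding eq by (rule sqnorm_midpoint_le[OF L2_diff[OF u L(1)] L2_diff[OF u L(2)] mid.IH])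
qed (rule e)

text \<open>Slabs are convex as well: the limit of inner products along a sequence persists for
  elements of its tail hulls.\<close>

lemma midpoint_hull_ip_le:
  assumes v: "v \<in> midpoint_hull A" and A: "A \<subseteq> TF" and h: "h \<in> L2 \<Omega>"
    and e: "\<And>f. f \<in> A \<Longrightarrow> \<bar>ip \<Omega> (cg f) h - l\<bar> \<le> e"
  shows "\<bar>ip \<Omega> (cg v) h - l\<bar> \<le> e"
  using v
proof induction
  case (mid f g)
  note t = midpoint_hull_TF[OF mid(1) A] midpoint_hull_TF[OF mid(2) A]
  have "ip \<Omega> (cg (\<lambda>x. 1/2 * f x + 1/2 * g x)) h = 1/2 * ip \<Omega> (cg f) h + 1/2 * ip \<Omega> (cg g) h"
    unfolding cg_mid[OF t] by (rule ip_linear_combination_left[OF test_L2(2)[OF t(1)] test_L2(2)[OF t(2)] h])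
  then show ?case using mid.IH by linarith
qed (rule e)

text \<open>An almost minimal element of each tail hull; by the parallelogram law these form a Cauchy
  sequence, and its limit is the weak limit. This replaces weak compactness of balls.\<close>

lemma midpoint_hull_cauchy:
  fixes \<phi> :: "nat \<Rightarrow> real^'n \<Rightarrow> real"
  assumes \<phi>: "\<And>n. \<phi> n \<in> TF" and R: "\<And>n. sqnorm \<Omega> (cg (\<phi> n)) \<le> R"
  obtains v where "\<And>n. v n \<in> midpoint_hull (\<phi> ` {n..})"
    "\<And>e. e > 0 \<Longrightarrow> \<exists>N. \<forall>m\<ge>N. \<forall>n\<ge>N. sqnorm \<Omega> (\<lambda>x. cg (v m) x - cg (v n) x) < e"
proof -
  define K where "K n = midpoint_hull (\<phi> ` {n..})" for n
  have tails: "\<phi> ` {n..} \<subseteq> TF" for n using \<phi> by auto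
  have KT: "v \<in> TF" if "v \<in> K n" for v n
    using midpoint_hull_TF[OF _ tails] that unfolding K_def by blast
  have Kmono: "K m \<subseteq> K n" if "n \<le> m" for m n
    unfolding K_def by (rule midpoint_hull_mono) (use that in auto)
  have \<phi>K: "\<phi> n \<in> K n" for n unfolding K_def by (rule midpoint_hull.base) simp
  define Q where "Q v = sqnorm \<Omega> (cg v)" for v
  \<comment> \<open>The tail hulls shrink, so these infima increase; they are bounded by
    \<open>R\<close> and therefore converge.\<close>
  define \<delta> where "\<delta> n = Inf (Q ` K n)" for n
  have bdd: "bdd_below (Q ` K n)" for n by (rule bdd_belowI[of _ 0]) (auto simp: Q_def)
  have \<delta>_le: "\<delta> n \<le> Q v" if "v \<in> K n" for v n
    unfolding \<delta>_def by (rule cInf_lower[OF _ bdd]) (use that in auto)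
  have \<delta>_mono: "\<delta> n \<le> \<delta> m" if "n \<le> m" for m n
    unfolding \<delta>_def by (rule cInf_superset_mono[OF _ bdd image_mono[OF Kmono[OF that]]]) (use \<phi>K in auto)
  have "\<delta> n \<le> R" for n using order_trans[OF \<delta>_le[OF \<phi>K] R[of n, folded Q_def]] .
  then obtain D where D: "\<delta> \<longlonglongrightarrow> D" "\<And>n. \<delta> n \<le> D"
    using incseq_convergent[of \<delta> R] \<delta>_mono unfolding incseq_def by blast
  have "\<exists>v\<in>K n. Q v < \<delta> n + 1 / real (Suc n)" for n
  proof -
    have "Inf (Q ` K n) < \<delta> n + 1 / real (Suc n)" unfolding \<delta>_def by simp
    then show ?thesis using cInf_lessD[of "Q ` K n"] \<phi>K by blast
  qed
  then obtain v where v: "\<And>n. v n \<in> K n" "\<And>n. Q (v n) < \<delta> n + 1 / real (Suc n)" by metis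
  have "\<exists>N. \<forall>m\<ge>N. \<forall>n\<ge>N. sqnorm \<Omega> (\<lambda>x. cg (v m) x - cg (v n) x) < e" if e: "e > 0" for e
  proof -
    have "(\<lambda>N. 4 * (D - \<delta> N) + 4 * (1 / real (Suc N))) \<longlonglongrightarrow> 4 * (D - D) + 4 * 0"
      by (intro tendsto_intros D LIMSEQ_Suc lim_1_over_n)
    then have "eventually (\<lambda>N. 4 * (D - \<delta> N) + 4 * (1 / real (Suc N)) < e) sequentially"
      by (rule order_tendstoD) (use e in simp)
    then obtain N where N: "4 * (D - \<delta> N) + 4 * (1 / real (Suc N)) < e" by (auto simp: eventually_sequentially)
    have "sqnorm \<Omega> (\<lambda>x. cg (v m) x - cg (v n) x) < e" if mn: "m \<ge> N" "n \<ge> N" for m n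
    proof -
      have t: "v m \<in> TF" "v n \<in> TF" using v(1) KT by auto
      have Kmn: "v m \<in> K N" "v n \<in> K N" using v(1) Kmono[OF mn(1)] Kmono[OF mn(2)] by auto
      then have "(\<lambda>x. 1/2 * v m x + 1/2 * v n x) \<in> K N"
        unfolding K_def by (rule midpoint_hull.mid)
      \<comment> \<open>The midpoint still lies in the hull of the tail from \<open>N\<close>, so
        its norm cannot drop much below those of \<open>v m\<close> and \<open>v n\<close>; by the
        parallelogram law the two are close.\<close>
      then have "\<delta> N \<le> Q (\<lambda>x. 1/2 * v m x + 1/2 * v n x)" by (rule \<delta>_le)
      also have "\<dots> = (Q (v m) + 2 * ip \<Omega> (cg (v m)) (cg (v n)) + Q (v n)) / 4"
        unfolding Q_def cg_mid[OF t] 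
        by (subst sqnorm_linear_combination[OF test_L2(2)[OF t(1)] test_L2(2)[OF t(2)]]) (simp add: power2_eq_square)
      finally have 1: "4 * \<delta> N \<le> Q (v m) + 2 * ip \<Omega> (cg (v m)) (cg (v n)) + Q (v n)" by simp
      have 2: "sqnorm \<Omega> (\<lambda>x. cg (v m) x - cg (v n) x) = Q (v m) - 2 * ip \<Omega> (cg (v m)) (cg (v n)) + Q (v n)"
        unfolding Q_def by (rule sqnorm_diff[OF test_L2(2)[OF t(1)] test_L2(2)[OF t(2)]])
      have 3: "1 / real (Suc m) \<le> 1 / real (Suc N)" "1 / real (Suc n) \<le> 1 / real (Suc N)"
        using mn by (simp_all add: frac_le)
      show ?thesis using 1 2 3 N v(2)[of m] v(2)[of n] D(2)[of m] D(2)[of n] by argo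
    qed
    then show ?thesis by blast
  qed
  with v(1) show ?thesis unfolding K_def by (intro that)
qed

text \<open>Rellich supplies the strong L2 limit \<open>u\<close>. Almost minimal elements of the
  tail hulls converge to \<open>u\<close> in L2, and their gradients converge strongly to some
  \<open>g\<close>, so \<open>u\<close> lies in \<open>H10\<close> with gradient \<open>g\<close>.
  Weak convergence is claimed only against \<open>wg u\<close>, which is what expanding a squared
  distance to \<open>u\<close> requires.\<close>

theorem weak_compactness:
  fixes \<phi> :: "nat \<Rightarrow> real^'n \<Rightarrow> real"
  assumes \<phi>: "\<And>n. \<phi> n \<in> TF" and R: "\<And>n. sqnorm \<Omega> (cg (\<phi> n)) \<le> R"
  obtains r u where "strict_mono (r :: nat \<Rightarrow> nat)" "u \<in> H10 \<Omega>"
    "(\<lambda>n. sqnorm \<Omega> (\<lambda>x. u x - \<phi> (r n) x)) \<longlonglongrightarrow> 0"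
    "(\<lambda>n. ip \<Omega> (cg (\<phi> (r n))) (wg u)) \<longlonglongrightarrow> sqnorm \<Omega> (wg u)"
proof -
  have R0: "R \<ge> 0" using R[of 0] sqnorm_nonneg order_trans by blast
  obtain r1 u where r1: "strict_mono r1" and u: "u \<in> L2 \<Omega>" "(\<lambda>n. sqnorm \<Omega> (\<lambda>x. u x - \<phi> (r1 n) x)) \<longlonglongrightarrow> 0"
    using rellich[of \<phi> R] \<phi> R by blast
  \<comment> \<open>A second extraction makes the inner products with each gradient of the sequence
    converge; their limits are identified below.\<close>
  define L where "L m n = ip \<Omega> (cg (\<phi> (r1 n))) (cg (\<phi> m))" for m n
  have "bounded (range (L m))" for m
  proof -
    have "\<bar>L m n\<bar> \<le> sqrt R * sqrt R" for n
    proof -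
      have "\<bar>L m n\<bar> \<le> sqrt (sqnorm \<Omega> (cg (\<phi> (r1 n)))) * sqrt (sqnorm \<Omega> (cg (\<phi> m)))"
        unfolding L_def by (rule L2_Cauchy_Schwarz[OF test_L2(2)[OF \<phi>] test_L2(2)[OF \<phi>]])
      also have "\<dots> \<le> sqrt R * sqrt R"
        using R R0 by (intro mult_mono real_sqrt_le_mono) auto
      finally show ?thesis .
    qed
    then show ?thesis unfolding bounded_iff by (auto intro!: exI[of _ "sqrt R * sqrt R"])
  qed
  then obtain r2 where r2: "strict_mono r2" "\<And>m. convergent (\<lambda>n. L m (r2 n))"
    using bounded_real_family_convergent_subseq by blast
  define r where "r = r1 \<circ> r2"
  have r: "strict_mono r" unfolding r_def using r1 r2(1) by (rule strict_mono_o)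
  define \<psi> where "\<psi> n = \<phi> (r n)" for n
  have \<psi>: "\<psi> n \<in> TF" "sqnorm \<Omega> (cg (\<psi> n)) \<le> R" for n using \<phi> R by (auto simp: \<psi>_def)
  note \<psi>L = test_L2[OF \<psi>(1)]
  have u\<psi>: "(\<lambda>n. sqnorm \<Omega> (\<lambda>x. u x - \<psi> n x)) \<longlonglongrightarrow> 0"
    using LIMSEQ_subseq_LIMSEQ[OF u(2) r2(1)] by (simp add: \<psi>_def r_def o_def)
  define l where "l m = lim (\<lambda>n. L (r m) (r2 n))" for m
  have l: "(\<lambda>n. ip \<Omega> (cg (\<psi> n)) (cg (\<psi> m))) \<longlonglongrightarrow> l m" for m
    using r2(2)[of "r m", unfolded convergent_LIMSEQ_iff] by (simp add: l_def L_def \<psi>_def r_def)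
  obtain v where v: "\<And>n. v n \<in> midpoint_hull (\<psi> ` {n..})"
    and cauchy: "\<And>e. e > 0 \<Longrightarrow> \<exists>N. \<forall>m\<ge>N. \<forall>n\<ge>N. sqnorm \<Omega> (\<lambda>x. cg (v m) x - cg (v n) x) < e"
    by (rule midpoint_hull_cauchy[of \<psi> R, OF \<psi>], rule that)
  have tails: "\<psi> ` {n..} \<subseteq> TF" for n using \<psi> by auto
  have vT: "v n \<in> TF" for n by (rule midpoint_hull_TF[OF v tails])
  note vL = test_L2[OF vT]
  obtain g where g: "g \<in> L2 \<Omega>" "(\<lambda>n. sqnorm \<Omega> (\<lambda>x. g x - cg (v n) x)) \<longlonglongrightarrow> 0"
    using L2_complete[of "\<lambda>n. cg (v n)" \<Omega>] vL cauchy by blast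
  have uv: "(\<lambda>n. sqnorm \<Omega> (\<lambda>x. u x - v n x)) \<longlonglongrightarrow> 0"
  proof (rule LIMSEQ_I)
    fix e :: real assume e: "e > 0"
    have "eventually (\<lambda>n. sqnorm \<Omega> (\<lambda>x. u x - \<psi> n x) < e / 2) sequentially"
      by (rule order_tendstoD[OF u\<psi>]) (use e in simp)
    then obtain N where N: "\<And>n. n \<ge> N \<Longrightarrow> sqnorm \<Omega> (\<lambda>x. u x - \<psi> n x) < e / 2" by (auto simp: eventually_sequentially)
    have le: "sqnorm \<Omega> (\<lambda>x. u x - v n x) \<le> e / 2" if "n \<ge> N" for n
    proof (rule midpoint_hull_sqnorm_le[OF v tails u(1)])
      fix f assume "f \<in> \<psi> ` {n..}"
      then obtain k where "k \<ge> n" "f = \<psi> k" by auto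
      then show "sqnorm \<Omega> (\<lambda>x. u x - f x) \<le> e / 2" using N[of k] that by simp
    qed
    have "norm (sqnorm \<Omega> (\<lambda>x. u x - v n x) - 0) < e" if "n \<ge> N" for n
    proof -
      have "sqnorm \<Omega> (\<lambda>x. u x - v n x) < e" using le[OF that] e by linarith
      then show ?thesis by simp
    qed
    then show "\<exists>no. \<forall>n\<ge>no. norm (sqnorm \<Omega> (\<lambda>x. u x - v n x) - 0) < e" by blast
  qed
  have a: "H10_approx \<Omega> v u g" using u g uv vT by (simp add: H10_approx_def)
  \<comment> \<open>The inner products of the hull elements have both limits: one by strong
    convergence to \<open>g\<close>, the other because elements of late tail hulls inherit the limit
    along the sequence.\<close>
  have gl: "ip \<Omega> g (cg (\<psi> m)) = l m" for m
  proof (rule LIMSEQ_unique)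
    show "(\<lambda>n. ip \<Omega> (cg (v n)) (cg (\<psi> m))) \<longlonglongrightarrow> ip \<Omega> g (cg (\<psi> m))"
      by (rule L2_limit_sqnorm[OF vL(2) g \<psi>L(2)])
    show "(\<lambda>n. ip \<Omega> (cg (v n)) (cg (\<psi> m))) \<longlonglongrightarrow> l m"
    proof (rule LIMSEQ_I)
      fix e :: real assume e: "e > 0"
      then obtain N where N: "\<And>n. n \<ge> N \<Longrightarrow> \<bar>ip \<Omega> (cg (\<psi> n)) (cg (\<psi> m)) - l m\<bar> < e / 2"
        using LIMSEQ_D[OF l[of m], of "e / 2"] by auto
      have le: "\<bar>ip \<Omega> (cg (v n)) (cg (\<psi> m)) - l m\<bar> \<le> e / 2" if "n \<ge> N" for n
      proof (rule midpoint_hull_ip_le[OF v tails \<psi>L(2)])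
        fix f assume "f \<in> \<psi> ` {n..}"
        then obtain k where "k \<ge> n" "f = \<psi> k" by auto
        then show "\<bar>ip \<Omega> (cg f) (cg (\<psi> m)) - l m\<bar> \<le> e / 2" using N[of k] that by simp
      qed
      have "norm (ip \<Omega> (cg (v n)) (cg (\<psi> m)) - l m) < e" if "n \<ge> N" for n
        using le[OF that] e unfolding real_norm_def by linarith
      then show "\<exists>no. \<forall>n\<ge>no. norm (ip \<Omega> (cg (v n)) (cg (\<psi> m)) - l m) < e" by blast
    qed
  qed
  have hull: "(\<lambda>k. ip \<Omega> (cg (\<psi> k)) (cg w)) \<longlonglongrightarrow> ip \<Omega> g (cg w)" if "w \<in> midpoint_hull (\<psi> ` {n..})" for w n
    using that
  proof induction
    case (base f)
    then obtain m where "f = \<psi> m" by auto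
    then show ?case using l[of m] gl[of m] by simp
  next
    case (mid f h)
    note t = midpoint_hull_TF[OF mid(1) tails] midpoint_hull_TF[OF mid(2) tails]
    have eq: "ip \<Omega> z (cg (\<lambda>x. 1/2 * f x + 1/2 * h x)) = 1/2 * ip \<Omega> z (cg f) + 1/2 * ip \<Omega> z (cg h)" if "z \<in> L2 \<Omega>" for z
      unfolding cg_mid[OF t] ip_commute[of \<Omega> z]
      by (rule ip_linear_combination_left[OF test_L2(2)[OF t(1)] test_L2(2)[OF t(2)] that])
    show ?case unfolding eq[OF \<psi>L(2)] eq[OF g(1)]
      by (intro tendsto_add tendsto_mult_left mid.IH)
  qed
  have wgg: "AE x in M. wg u x = g x" and uH: "u \<in> H10 \<Omega>"
    using H10_approx_gradient[OF open_domain a] by auto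
  \<comment> \<open>\<open>g\<close> is approximated by the gradient of one fixed hull element, for
    which the limit is known; the error is uniform in \<open>k\<close> because the gradients are
    bounded.\<close>
  have main: "(\<lambda>k. ip \<Omega> (cg (\<psi> k)) g) \<longlonglongrightarrow> sqnorm \<Omega> g"
  proof (rule LIMSEQ_I)
    fix e :: real assume e: "e > 0"
    have lim0: "(\<lambda>n. (sqrt R + sqrt (sqnorm \<Omega> g)) * sqrt (sqnorm \<Omega> (\<lambda>x. g x - cg (v n) x))) \<longlonglongrightarrow> (sqrt R + sqrt (sqnorm \<Omega> g)) * sqrt 0"
      by (intro tendsto_intros g)
    have "eventually (\<lambda>n. (sqrt R + sqrt (sqnorm \<Omega> g)) * sqrt (sqnorm \<Omega> (\<lambda>x. g x - cg (v n) x)) < e / 2) sequentially"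
      by (rule order_tendstoD[OF lim0]) (use e in simp)
    then obtain n where n: "(sqrt R + sqrt (sqnorm \<Omega> g)) * sqrt (sqnorm \<Omega> (\<lambda>x. g x - cg (v n) x)) < e / 2"
      by (auto simp: eventually_sequentially)
    obtain N where N: "\<And>k. k \<ge> N \<Longrightarrow> \<bar>ip \<Omega> (cg (\<psi> k)) (cg (v n)) - ip \<Omega> g (cg (v n))\<bar> < e / 2"
      using LIMSEQ_D[OF hull[OF v[of n]], of "e / 2"] e by auto
    have "\<bar>ip \<Omega> (cg (\<psi> k)) g - sqnorm \<Omega> g\<bar> < e" if "k \<ge> N" for k
    proof -
      let ?d = "\<lambda>x. g x - cg (v n) x"
      note d = L2_diff[OF g(1) vL(2)[of n]]
      have 1: "ip \<Omega> z ?d = ip \<Omega> z g - ip \<Omega> z (cg (v n))" if "z \<in> L2 \<Omega>" for z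
        using that g vL by (simp add: inner_diff_right L2_inner_integrable)
      have "\<bar>ip \<Omega> (cg (\<psi> k)) ?d\<bar> \<le> sqrt R * sqrt (sqnorm \<Omega> ?d)"
        using L2_Cauchy_Schwarz[OF \<psi>L(2) d, of k] \<psi>(2)[of k]
        by (rule_tac order_trans) (auto intro!: mult_right_mono)
      moreover have "\<bar>ip \<Omega> g ?d\<bar> \<le> sqrt (sqnorm \<Omega> g) * sqrt (sqnorm \<Omega> ?d)"
        by (rule L2_Cauchy_Schwarz[OF g(1) d])
      ultimately have "\<bar>ip \<Omega> (cg (\<psi> k)) ?d\<bar> + \<bar>ip \<Omega> g ?d\<bar> < e / 2"
        using n by (simp add: distrib_right)
      then show ?thesis
        using N[OF that] unfolding 1[OF \<psi>L(2)] 1[OF g(1)] ip_self by linarith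
    qed
    then show "\<exists>no. \<forall>k\<ge>no. norm (ip \<Omega> (cg (\<psi> k)) g - sqnorm \<Omega> g) < e" by auto
  qed
  have sg: "sqnorm \<Omega> (wg u) = sqnorm \<Omega> g" by (rule sqnorm_cong_AE[OF open_domain g(1) wgg])
  have ig: "ip \<Omega> (cg (\<psi> k)) (wg u) = ip \<Omega> (cg (\<psi> k)) g" for k
  proof (rule integral_cong_AE)
    show "AE x in M. cg (\<psi> k) x \<bullet> wg u x = cg (\<psi> k) x \<bullet> g x" using wgg by eventually_elim simp
  qed (use \<psi>L(2)[of k] H10_L2(2)[OF open_domain uH] g(1) in \<open>auto dest!: L2_D(1) intro!: borel_measurable_inner\<close>)
  show ?thesis
    by (rule that[OF r uH]) (use u\<psi> main in \<open>simp_all add: ig[unfolded \<psi>_def] sg \<psi>_def\<close>)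
qed

end

subsection \<open>Minimizing the energy\<close>

lemma abs_add_powr_le:
  fixes p \<epsilon> :: real
  assumes p: "p > 0" and \<epsilon>: "\<epsilon> > 0"
  obtains C where "C > 0" "\<And>x y. \<bar>x + y\<bar> powr p \<le> (1 + \<epsilon>) * \<bar>x\<bar> powr p + C * \<bar>y\<bar> powr p"
proof -
  \<comment> \<open>Chosen so that (1 + \<eta>)^p = 1 + \<epsilon>: a small \<open>y\<close> is
    absorbed by the first term, and for a large \<open>y\<close> the second term dominates.\<close>
  define \<eta> where "\<eta> = (1 + \<epsilon>) powr (1 / p) - 1"
  have "1 powr (1 / p) < (1 + \<epsilon>) powr (1 / p)" using p \<epsilon> by (intro powr_less_mono2) auto
  then have \<eta>: "\<eta> > 0" by (simp add: \<eta>_def)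
  have \<eta>p: "(1 + \<eta>) powr p = 1 + \<epsilon>" using p \<epsilon> by (simp add: \<eta>_def powr_powr)
  define C where "C = (1 / \<eta> + 1) powr p"
  have "\<bar>x + y\<bar> powr p \<le> (1 + \<epsilon>) * \<bar>x\<bar> powr p + C * \<bar>y\<bar> powr p" for x y
  proof (cases "\<bar>y\<bar> \<le> \<eta> * \<bar>x\<bar>")
    case True
    then have "\<bar>x + y\<bar> \<le> (1 + \<eta>) * \<bar>x\<bar>" by (simp add: algebra_simps)
    then have "\<bar>x + y\<bar> powr p \<le> ((1 + \<eta>) * \<bar>x\<bar>) powr p" using p by (intro powr_mono2) auto
    also have "\<dots> = (1 + \<epsilon>) * \<bar>x\<bar> powr p" using \<eta> by (simp add: powr_mult \<eta>p)
    also have "\<dots> \<le> (1 + \<epsilon>) * \<bar>x\<bar> powr p + C * \<bar>y\<bar> powr p" by (simp add: C_def)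
    finally show ?thesis .
  next
    case False
    then have "\<bar>x\<bar> \<le> 1 / \<eta> * \<bar>y\<bar>" using \<eta> by (simp add: field_simps)
    then have "\<bar>x + y\<bar> \<le> (1 / \<eta> + 1) * \<bar>y\<bar>" by (simp add: algebra_simps)
    then have "\<bar>x + y\<bar> powr p \<le> ((1 / \<eta> + 1) * \<bar>y\<bar>) powr p" using p by (intro powr_mono2) auto
    also have "\<dots> = C * \<bar>y\<bar> powr p" unfolding C_def using \<eta> by (intro powr_mult)
    also have "\<dots> \<le> (1 + \<epsilon>) * \<bar>x\<bar> powr p + C * \<bar>y\<bar> powr p" using \<epsilon> by simp
    finally show ?thesis .
  qed
  moreover have "1 / \<eta> + 1 > 0" using \<eta> by (intro add_pos_pos) auto
  then have "C > 0" unfolding C_def by simp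
  ultimately show ?thesis by (intro that)
qed

text \<open>The half of the Brezis-Lieb lemma that lower semicontinuity needs.\<close>

lemma brezis_lieb_upper:
  fixes f :: "nat \<Rightarrow> 'a \<Rightarrow> real"
  assumes p: "p > 0" and \<epsilon>: "\<epsilon> > 0"
    and meas [measurable]: "\<And>n. f n \<in> borel_measurable M" "u \<in> borel_measurable M"
    and int: "\<And>n. integrable M (\<lambda>x. \<bar>f n x\<bar> powr p)" "integrable M (\<lambda>x. \<bar>u x\<bar> powr p)"
      "\<And>n. integrable M (\<lambda>x. \<bar>f n x - u x\<bar> powr p)"
    and lim: "AE x in M. (\<lambda>n. f n x) \<longlonglongrightarrow> u x"
  obtains \<delta> where "\<delta> \<longlonglongrightarrow> 0"
    "\<And>n. (\<integral>x. \<bar>f n x\<bar> powr p \<partial>M) \<le> (\<integral>x. \<bar>u x\<bar> powr p \<partial>M) + (1 + \<epsilon>) * (\<integral>x. \<bar>f n x - u x\<bar> powr p \<partial>M) + \<delta> n"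
proof -
  obtain C where C: "C > 0" "\<And>x y. \<bar>x + y\<bar> powr p \<le> (1 + \<epsilon>) * \<bar>x\<bar> powr p + C * \<bar>y\<bar> powr p"
    by (rule abs_add_powr_le[OF p \<epsilon>], rule that)
  \<comment> \<open>The excess over the two main terms, cut off at 0. It tends to 0 almost
    everywhere and is dominated by a multiple of |u|^p that does not depend on
    \<open>n\<close>.\<close>
  define Z where "Z n x = max 0 (\<bar>f n x\<bar> powr p - (1 + \<epsilon>) * \<bar>f n x - u x\<bar> powr p - \<bar>u x\<bar> powr p)" for n x
  have Z: "0 \<le> Z n x" "Z n x \<le> C * \<bar>u x\<bar> powr p" for n x
  proof -
    have "\<bar>f n x\<bar> powr p \<le> (1 + \<epsilon>) * \<bar>f n x - u x\<bar> powr p + C * \<bar>u x\<bar> powr p"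
      using C(2)[of "f n x - u x" "u x"] by simp
    moreover have "0 \<le> C * \<bar>u x\<bar> powr p" "0 \<le> \<bar>u x\<bar> powr p" using C(1) by auto
    ultimately show "Z n x \<le> C * \<bar>u x\<bar> powr p" unfolding Z_def by linarith
  qed (simp add: Z_def)
  have Zi: "integrable M (Z n)" for n unfolding Z_def using int by auto
  have "(\<lambda>n. \<integral>x. Z n x \<partial>M) \<longlonglongrightarrow> (\<integral>x. 0 \<partial>M)"
  proof (rule integral_dominated_convergence[where w="\<lambda>x. C * \<bar>u x\<bar> powr p"])
    show "AE x in M. (\<lambda>n. Z n x) \<longlonglongrightarrow> 0"
      using lim
    proof eventually_elim
      case (elim x)
      have "(\<lambda>n. Z n x) \<longlonglongrightarrow> max 0 (\<bar>u x\<bar> powr p - (1 + \<epsilon>) * \<bar>u x - u x\<bar> powr p - \<bar>u x\<bar> powr p)"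
        unfolding Z_def using p
        by (intro tendsto_max tendsto_diff tendsto_mult tendsto_powr' tendsto_rabs tendsto_const elim) auto
      then show ?case by simp
    qed
    show "AE x in M. norm (Z n x) \<le> C * \<bar>u x\<bar> powr p" for n using Z by (intro AE_I2) auto
  qed (use Zi int in auto)
  then have 1: "(\<lambda>n. \<integral>x. Z n x \<partial>M) \<longlonglongrightarrow> 0" by simp
  have 2: "(\<integral>x. \<bar>f n x\<bar> powr p \<partial>M) \<le> (\<integral>x. \<bar>u x\<bar> powr p \<partial>M) + (1 + \<epsilon>) * (\<integral>x. \<bar>f n x - u x\<bar> powr p \<partial>M) + (\<integral>x. Z n x \<partial>M)" for n
  proof -
    have "(\<integral>x. \<bar>f n x\<bar> powr p \<partial>M) \<le> (\<integral>x. \<bar>u x\<bar> powr p + (1 + \<epsilon>) * \<bar>f n x - u x\<bar> powr p + Z n x \<partial>M)"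
      using int Zi by (intro integral_mono) (auto simp: Z_def)
    then show ?thesis using int Zi by simp
  qed
  from 1 2 show ?thesis by (rule that)
qed

text \<open>For \<open>p < 4\<close> the quartic term dominates; for \<open>p = 4\<close> the hypothesis forces \<open>s \<le> b\<close>.\<close>

lemma coercivity_inequality:
  fixes a b s p :: real
  assumes p: "2 < p" "p \<le> 4" and ab: "a > 0" "b > 0" and s: "s > 0"
    and K: "\<And>\<tau>. \<tau> \<ge> 0 \<Longrightarrow> s / p * \<tau> powr (p / 2 - 1) \<le> a / 2 + b / 4 * \<tau>"
  obtains C where "C \<ge> 0" "\<And>D. D \<ge> 0 \<Longrightarrow> s / p * D powr (p / 2) \<le> b / 4 * D\<^sup>2 + C"
proof (cases "p = 4")
  case True
  have "s \<le> b"
  proof (rule ccontr)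
    assume "\<not> s \<le> b"
    then have sb: "s - b > 0" by simp
    \<comment> \<open>At this \<tau> the linear terms would differ by \<open>a\<close>, more than
      the available \<open>a / 2\<close>.\<close>
    define \<tau> where "\<tau> = 4 * a / (s - b)"
    have \<tau>: "\<tau> > 0" "(s - b) * \<tau> = 4 * a" using sb ab by (auto simp: \<tau>_def)
    have "s / 4 * \<tau> \<le> a / 2 + b / 4 * \<tau>" using K[of \<tau>] True \<tau> by simp
    then have "(s - b) * \<tau> \<le> 2 * a" by (simp add: field_simps)
    then show False using \<tau> ab by simp
  qed
  have "s / p * D powr (p / 2) \<le> b / 4 * D\<^sup>2 + 0" if "D \<ge> 0" for D
  proof -
    have "D powr 2 = D\<^sup>2" using that by (cases "D = 0") (auto simp: powr_numeral)
    then show ?thesis using \<open>s \<le> b\<close> True by (simp add: mult_right_mono)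
  qed
  then show ?thesis by (intro that[of 0]) auto
next
  case False
  then have p4: "p < 4" using p by simp
  define q where "q = p / 2"
  have q: "1 < q" "q < 2" using p p4 by (auto simp: q_def)
  \<comment> \<open>The point where the power and the quadratic term are equal; beyond it the
    quadratic term wins because q < 2.\<close>
  define T where "T = (4 * s / (p * b)) powr (1 / (2 - q))"
  have T: "T > 0" using s ab p by (simp add: T_def)
  define C where "C = s / p * T powr q"
  have "s / p * D powr q \<le> b / 4 * D\<^sup>2 + C" if D: "D \<ge> 0" for D
  proof (cases "D \<le> T")
    case True
    then have "s / p * D powr q \<le> C"
      unfolding C_def using D s p q by (intro mult_left_mono powr_mono2) auto
    then show ?thesis using ab by (smt (verit) mult_nonneg_nonneg zero_le_power2 divide_nonneg_pos)
  next
    case False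
    then have D: "D > T" "D > 0" using T by auto
    have "4 * s / (p * b) = T powr (2 - q)" using s ab p q by (simp add: T_def powr_powr)
    also have "\<dots> \<le> D powr (2 - q)" using D T q by (intro powr_mono2) auto
    finally have "s / p \<le> b / 4 * D powr (2 - q)" using ab p by (simp add: field_simps)
    then have "s / p * D powr q \<le> b / 4 * D powr (2 - q) * D powr q" by (rule mult_right_mono) simp
    also have "\<dots> = b / 4 * D\<^sup>2" using D by (simp add: powr_add[symmetric] mult.assoc powr_numeral)
    also have "\<dots> \<le> b / 4 * D\<^sup>2 + C" using s p by (simp add: C_def)
    finally show ?thesis .
  qed
  then show ?thesis unfolding q_def by (intro that[of C]) (use s p in \<open>auto simp: C_def\<close>)
qed

section \<open>Coercivity and weak lower semicontinuity of the energy\<close>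

locale kirchhoff = bounded_domain \<Omega> for \<Omega> :: "(real^'n) set" +
  fixes a b :: real and h :: "real^'n \<Rightarrow> real"
  assumes ab: "a > 0" "b > 0" and h: "h \<in> Linfty \<Omega>"
begin

lemma h_L2: "h \<in> L2 \<Omega>"
proof (rule L2_I)
  show m: "h \<in> borel_measurable M" using h by (simp add: Linfty_def)
  obtain C where C: "AE x in M. \<bar>h x\<bar> \<le> C" using h by (auto simp: Linfty_def)
  show "integrable M (\<lambda>x. (norm (h x))\<^sup>2)"
  proof (rule Bochner_Integration.integrable_bound[OF integrable_const_domain[of "C\<^sup>2"]])
    show "AE x in M. norm ((norm (h x))\<^sup>2) \<le> norm (C\<^sup>2)"
      using C by eventually_elim (auto intro: order_trans[OF _ abs_ge_self] simp flip: abs_le_square_iff)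
  qed (use m in measurable)
qed

definition energy :: "(real^'n \<Rightarrow> real) \<Rightarrow> real" where
  "energy u = a / 2 * sqnorm \<Omega> (wg u) + b / 4 * (sqnorm \<Omega> (wg u))\<^sup>2
     - (\<integral>x. \<bar>u x\<bar> powr p \<partial>M) / p - (\<integral>x. h x * u x \<partial>M)"

definition "s = S powr (- p / 2)"

lemma s_pos: "s > 0" using S_pos by (simp add: s_def)

text \<open>The condition for weak lower semicontinuity. With \<tau> the squared gradient norm of
  the part lost in a weak limit, it says that the energy of this part divided by \<tau> is not
  negative.\<close>

definition wlsc :: bool where
  "wlsc \<longleftrightarrow> (\<forall>\<tau>\<ge>0. s / p * \<tau> powr (p / 2 - 1) \<le> a / 2 + b / 4 * \<tau>)"

lemma wlscD:
  assumes wlsc "D \<ge> 0"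
  shows "s / p * D powr (p / 2) \<le> a / 2 * D + b / 4 * D\<^sup>2"
proof (cases "D = 0")
  case False
  then have D: "D > 0" using assms by simp
  have "s / p * D powr (p / 2) = s / p * D powr (p / 2 - 1) * D"
    using D by (simp add: powr_diff)
  also have "\<dots> \<le> (a / 2 + b / 4 * D) * D" using assms D by (intro mult_right_mono) (auto simp: wlsc_def)
  also have "\<dots> = a / 2 * D + b / 4 * D\<^sup>2" by (simp add: power2_eq_square algebra_simps)
  finally show ?thesis .
qed simp

text \<open>The quartic term absorbs the critical power up to a constant. Half of the quadratic term
  then controls the linear one by completing a square, and the other half remains.\<close>

lemma energy_coercive:
  assumes wlsc
  obtains C where "\<And>u. u \<in> H10 \<Omega> \<Longrightarrow> energy u \<ge> a / 4 * sqnorm \<Omega> (wg u) - C"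
proof -
  obtain C1 where C1: "C1 \<ge> 0" "\<And>D. D \<ge> 0 \<Longrightarrow> s / p * D powr (p / 2) \<le> b / 4 * D\<^sup>2 + C1"
    using coercivity_inequality[OF p_bounds ab s_pos] assms unfolding wlsc_def by blast
  obtain P where P: "P > 0" "\<And>u. u \<in> H10 \<Omega> \<Longrightarrow> sqnorm \<Omega> u \<le> P * sqnorm \<Omega> (wg u)"
    using poincare by blast
  define k where "k = sqrt (sqnorm \<Omega> h) * sqrt P"
  have "energy u \<ge> a / 4 * sqnorm \<Omega> (wg u) - (C1 + k\<^sup>2 / a)" if u: "u \<in> H10 \<Omega>" for u
  proof -
    define D where "D = sqnorm \<Omega> (wg u)"
    have D0: "D \<ge> 0" by (simp add: D_def)
    have "(\<integral>x. h x * u x \<partial>M) \<le> sqrt (sqnorm \<Omega> h) * sqrt (sqnorm \<Omega> u)"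
      using L2_Cauchy_Schwarz[OF h_L2 H10_L2(1)[OF open_domain u]] by simp
    also have "\<dots> \<le> sqrt (sqnorm \<Omega> h) * sqrt (P * D)"
      unfolding D_def using P(2)[OF u] by (intro mult_left_mono real_sqrt_le_mono) auto
    also have "\<dots> = k * sqrt D" by (simp add: k_def real_sqrt_mult)
    finally have H: "(\<integral>x. h x * u x \<partial>M) \<le> k * sqrt D" .
    have "k * sqrt D \<le> a / 4 * D + k\<^sup>2 / a"
    proof -
      have "0 \<le> (sqrt D * a / 2 - k)\<^sup>2 / a" using ab by simp
      also have "\<dots> = ((sqrt D)\<^sup>2 * a / 4 - k * sqrt D + k\<^sup>2 / a)"
        using ab by (simp add: power2_eq_square field_simps)
      finally show ?thesis using D0 by (simp add: mult.commute)
    qed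
    moreover have "(\<integral>x. \<bar>u x\<bar> powr p \<partial>M) / p \<le> b / 4 * D\<^sup>2 + C1"
    proof -
      have "(\<integral>x. \<bar>u x\<bar> powr p \<partial>M) / p \<le> s * D powr (p / 2) / p"
        using sobolev[OF u] p_bounds by (intro divide_right_mono) (auto simp: s_def D_def)
      also have "\<dots> \<le> b / 4 * D\<^sup>2 + C1" using C1(2)[OF D0] by simp
      finally show ?thesis .
    qed
    ultimately show ?thesis using H unfolding energy_def D_def[symmetric] by argo
  qed
  then show ?thesis by (rule that)
qed

lemma test_functions_nonempty: "TF \<noteq> {}"
proof -
  \<comment> \<open>An empty box gives the zero function as a bump, admissible in every
    domain.\<close>
  have "cbox (1::real^'n) 0 = {}" by (simp add: interval_eq_empty_cart)
  then have "box_bump 0 1 0 \<in> TF" by (intro box_bump_test_function) simp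
  then show ?thesis by blast
qed

text \<open>The critical power enters the energy with a minus sign. A lower bound for the energy is
  thus an upper bound for the p-th powers of the approximants, which is what Fatou's lemma carries
  to the limit.\<close>

lemma energy_lower_bound_from_tests:
  assumes m: "\<And>\<phi>. \<phi> \<in> TF \<Longrightarrow> m \<le> energy \<phi>" and u: "u \<in> H10 \<Omega>"
  shows "m \<le> energy u"
proof -
  obtain \<phi> where appr: "H10_approx \<Omega> \<phi> u (wg u)" using H10_obtain_approx[OF open_domain u] .
  then have t: "\<And>k. \<phi> k \<in> TF" by (auto simp: H10_approx_def)
  define D where "D k = sqnorm \<Omega> (cg (\<phi> k))" for k
  have D: "D \<longlonglongrightarrow> sqnorm \<Omega> (wg u)"
    unfolding D_def using appr test_L2[OF t] by (intro L2_limit_sqnorm_self) (auto simp: H10_approx_def)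
  have H: "(\<lambda>k. \<integral>x. h x * \<phi> k x \<partial>M) \<longlonglongrightarrow> (\<integral>x. h x * u x \<partial>M)"
    using L2_limit_sqnorm[of \<phi> \<Omega> u h] appr test_L2[OF t] h_L2 by (simp add: H10_approx_def mult.commute)
  define B where "B k = p * (a / 2 * D k + b / 4 * (D k)\<^sup>2 - (\<integral>x. h x * \<phi> k x \<partial>M) - m)" for k
  have "(\<integral>x. \<bar>\<phi> k x\<bar> powr p \<partial>M) \<le> B k" for k
    using m[OF t[of k]] p_bounds unfolding energy_def test_wg_sqnorm[OF t] B_def D_def by (simp add: field_simps)
  moreover have "B \<longlonglongrightarrow> p * (a / 2 * sqnorm \<Omega> (wg u) + b / 4 * (sqnorm \<Omega> (wg u))\<^sup>2 - (\<integral>x. h x * u x \<partial>M) - m)"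
    unfolding B_def by (intro tendsto_intros D H)
  ultimately have "(\<integral>x. \<bar>u x\<bar> powr p \<partial>M) \<le> p * (a / 2 * sqnorm \<Omega> (wg u) + b / 4 * (sqnorm \<Omega> (wg u))\<^sup>2 - (\<integral>x. h x * u x \<partial>M) - m)"
    by (rule H10_fatou(2)[OF appr])
  then show ?thesis using p_bounds unfolding energy_def by (simp add: field_simps)
qed

text \<open>With \<open>t n\<close> the squared gradient distance to \<open>u\<close>, weak
  convergence splits the squared norm into \<open>A + t n\<close> up to a vanishing error, and
  Brezis-Lieb splits the p-th power with a loss \<epsilon>. By \<open>wlscD\<close> the part carried
  by \<open>t n\<close> has no negative energy.\<close>

lemma energy_lsc:
  fixes \<phi> :: "nat \<Rightarrow> real^'n \<Rightarrow> real"
  assumes w: wlsc and \<phi>: "\<And>n. \<phi> n \<in> TF" and R: "\<And>n. sqnorm \<Omega> (cg (\<phi> n)) \<le> R" and u: "u \<in> H10 \<Omega>"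
    and L2lim: "(\<lambda>n. sqnorm \<Omega> (\<lambda>x. u x - \<phi> n x)) \<longlonglongrightarrow> 0"
    and weak: "(\<lambda>n. ip \<Omega> (cg (\<phi> n)) (wg u)) \<longlonglongrightarrow> sqnorm \<Omega> (wg u)"
    and ae: "AE x in M. (\<lambda>n. \<phi> n x) \<longlonglongrightarrow> u x"
    and m: "(\<lambda>n. energy (\<phi> n)) \<longlonglongrightarrow> m"
  shows "energy u \<le> m"
proof -
  note uL2 = H10_L2[OF open_domain u]
  define A where "A = sqnorm \<Omega> (wg u)"
  define D where "D n = sqnorm \<Omega> (cg (\<phi> n))" for n
  define t where "t n = sqnorm \<Omega> (\<lambda>x. cg (\<phi> n) x - wg u x)" for n
  define \<rho> where "\<rho> n = ip \<Omega> (cg (\<phi> n)) (wg u) - A" for n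
  define H where "H n = (\<integral>x. h x * \<phi> n x \<partial>M)" for n
  define Hu where "Hu = (\<integral>x. h x * u x \<partial>M)"
  define P where "P n = (\<integral>x. \<bar>\<phi> n x\<bar> powr p \<partial>M)" for n
  define Pu where "Pu = (\<integral>x. \<bar>u x\<bar> powr p \<partial>M)"
  define W where "W n = (\<integral>x. \<bar>\<phi> n x - u x\<bar> powr p \<partial>M)" for n
  have A0: "A \<ge> 0" and t0: "t n \<ge> 0" and D0: "D n \<ge> 0" and DR: "D n \<le> R" for n
    using R by (auto simp: A_def t_def D_def)
  have \<rho>: "\<rho> \<longlonglongrightarrow> 0" unfolding \<rho>_def A_def using weak by (rule LIM_zero)
  have HH: "H \<longlonglongrightarrow> Hu"
    unfolding H_def Hu_def using L2_limit_sqnorm[OF test_L2(1)[OF \<phi>] uL2(1) L2lim h_L2] by (simp add: mult.commute)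
  have Dt: "D n = A + t n + 2 * \<rho> n" for n
    unfolding D_def t_def \<rho>_def A_def by (subst sqnorm_diff[OF test_L2(2)[OF \<phi>] uL2(2)]) simp
  have tR: "t n \<le> 2 * R + 2 * A" for n
  proof -
    have "\<bar>ip \<Omega> (cg (\<phi> n)) (wg u)\<bar> \<le> sqrt (D n) * sqrt A"
      unfolding D_def A_def by (rule L2_Cauchy_Schwarz[OF test_L2(2)[OF \<phi>] uL2(2)])
    moreover have "sqrt (D n) * sqrt A \<le> (D n + A) / 2"
      using arith_geo_mean_sqrt[OF D0 A0] by (simp add: real_sqrt_mult)
    ultimately have "- (2 * \<rho> n) \<le> D n + 3 * A" by (simp add: \<rho>_def)
    then show ?thesis using Dt[of n] DR[of n] by linarith
  qed
  have diff: "(\<lambda>x. \<phi> n x - u x) \<in> H10 \<Omega>" "sqnorm \<Omega> (wg (\<lambda>x. \<phi> n x - u x)) = t n" for n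
  proof -
    note lc = H10_linear_combination[OF open_domain test_H10(1)[OF \<phi>[of n]] u, of 1 "-1"]
    show "(\<lambda>x. \<phi> n x - u x) \<in> H10 \<Omega>" using lc(1) by simp
    have "AE x in M. wg (\<lambda>x. \<phi> n x - u x) x = cg (\<phi> n) x - wg u x"
      using lc(2) test_H10(2)[OF \<phi>[of n]] by eventually_elim simp
    then show "sqnorm \<Omega> (wg (\<lambda>x. \<phi> n x - u x)) = t n"
      unfolding t_def by (intro sqnorm_cong_AE open_domain L2_diff test_L2 \<phi> uL2)
  qed
  have Ws: "W n \<le> s * t n powr (p / 2)" for n
    using sobolev[OF diff(1)[of n]] unfolding W_def diff(2) s_def .
  define T where "T = 2 * R + 2 * A"
  \<comment> \<open>Bounds the share multiplied by \<epsilon> uniformly in \<open>n\<close>, so that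
    \<epsilon> can go to 0 after \<open>n\<close> has gone to infinity.\<close>
  define c where "c = s * T powr (p / 2) / p"
  have bound: "energy u \<le> m + \<epsilon> * c" if \<epsilon>: "\<epsilon> > 0" for \<epsilon>
  proof -
    obtain \<delta> where \<delta>: "\<delta> \<longlonglongrightarrow> 0" "\<And>n. P n \<le> Pu + (1 + \<epsilon>) * W n + \<delta> n"
      unfolding P_def Pu_def W_def
    proof (rule brezis_lieb_upper[of p \<epsilon> \<phi> M u])
      show "integrable M (\<lambda>x. \<bar>\<phi> n x - u x\<bar> powr p)" for n by (rule powr_integrable[OF diff(1)])
      show "\<phi> n \<in> borel_measurable M" for n using test_L2(1)[OF \<phi>] by (rule L2_D(1))
    qed (use p_bounds \<epsilon> u uL2 \<phi> ae powr_integrable test_H10(1) in \<open>auto dest: L2_D(1)\<close>)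
    have "energy u \<le> energy (\<phi> n) + \<epsilon> * c + (\<delta> n / p + (H n - Hu) - (a + b * (A + t n)) * \<rho> n)" for n
    proof -
      have En: "energy (\<phi> n) = a / 2 * D n + b / 4 * (D n)\<^sup>2 - P n / p - H n"
        unfolding energy_def test_wg_sqnorm[OF \<phi>] D_def P_def H_def ..
      have Eu: "energy u = a / 2 * A + b / 4 * A\<^sup>2 - Pu / p - Hu"
        unfolding energy_def A_def Pu_def Hu_def ..
      have "t n powr (p / 2) \<le> T powr (p / 2)"
        using tR t0 p_bounds by (intro powr_mono2) (auto simp: T_def)
      then have tT: "\<epsilon> * (s * t n powr (p / 2) / p) \<le> \<epsilon> * c"
        unfolding c_def using \<epsilon> s_pos p_bounds by (intro mult_left_mono divide_right_mono) auto
      have "P n / p \<le> (Pu + (1 + \<epsilon>) * (s * t n powr (p / 2)) + \<delta> n) / p"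
        using \<delta>(2)[of n] mult_left_mono[OF Ws[of n], of "1 + \<epsilon>"] \<epsilon> p_bounds
        by (intro divide_right_mono) linarith+
      also have "\<dots> = Pu / p + s / p * t n powr (p / 2) + \<epsilon> * (s * t n powr (p / 2) / p) + \<delta> n / p"
        using p_bounds by (simp add: field_simps)
      also have "\<dots> \<le> Pu / p + (a / 2 * t n + b / 4 * (t n)\<^sup>2) + \<epsilon> * c + \<delta> n / p"
        using wlscD[OF w t0[of n]] tT by linarith
      finally have Pn: "P n / p \<le> Pu / p + (a / 2 * t n + b / 4 * (t n)\<^sup>2) + \<epsilon> * c + \<delta> n / p" .
      have "(D n)\<^sup>2 = A\<^sup>2 + (t n)\<^sup>2 + 2 * A * t n + 4 * (A + t n) * \<rho> n + 4 * (\<rho> n)\<^sup>2"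
        unfolding Dt by (simp add: power2_eq_square algebra_simps)
      moreover have "0 \<le> 2 * A * t n + 4 * (\<rho> n)\<^sup>2" using A0 t0 by simp
      ultimately have "A\<^sup>2 + (t n)\<^sup>2 + 4 * (A + t n) * \<rho> n \<le> (D n)\<^sup>2" by linarith
      then have "b / 4 * (A\<^sup>2 + (t n)\<^sup>2 + 4 * (A + t n) * \<rho> n) \<le> b / 4 * (D n)\<^sup>2"
        using ab by (intro mult_left_mono) auto
      then have "b / 4 * A\<^sup>2 + b / 4 * (t n)\<^sup>2 + b * (A + t n) * \<rho> n \<le> b / 4 * (D n)\<^sup>2" by (simp add: algebra_simps)
      moreover have "a / 2 * D n = a / 2 * A + a / 2 * t n + a * \<rho> n" unfolding Dt by (simp add: algebra_simps)
      moreover have "(a + b * (A + t n)) * \<rho> n = a * \<rho> n + b * (A + t n) * \<rho> n" by (simp add: distrib_right)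
      ultimately show ?thesis using Pn unfolding En Eu by linarith
    qed
    moreover have "(\<lambda>n. energy (\<phi> n) + \<epsilon> * c + (\<delta> n / p + (H n - Hu) - (a + b * (A + t n)) * \<rho> n)) \<longlonglongrightarrow> m + \<epsilon> * c + (0 / p + (Hu - Hu) - 0)"
    proof (intro tendsto_add tendsto_diff tendsto_const tendsto_divide m \<delta>(1) HH)
      have "(\<lambda>n. (a + b * (A + T)) * \<bar>\<rho> n\<bar>) \<longlonglongrightarrow> (a + b * (A + T)) * \<bar>0\<bar>" by (intro tendsto_intros \<rho>)
      then have l: "(\<lambda>n. (a + b * (A + T)) * \<bar>\<rho> n\<bar>) \<longlonglongrightarrow> 0" by simp
      show "(\<lambda>n. (a + b * (A + t n)) * \<rho> n) \<longlonglongrightarrow> 0"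
      proof (rule Lim_null_comparison[OF always_eventually l], rule allI)
        fix n
        have "0 \<le> a + b * (A + t n)" using ab A0 t0 by simp
        moreover have "a + b * (A + t n) \<le> a + b * (A + T)" using ab tR[of n] unfolding T_def by (intro add_left_mono mult_left_mono) auto
        ultimately show "norm ((a + b * (A + t n)) * \<rho> n) \<le> (a + b * (A + T)) * \<bar>\<rho> n\<bar>"
          by (simp add: abs_mult mult_right_mono)
      qed
    qed (use p_bounds in auto)
    ultimately have "energy u \<le> m + \<epsilon> * c + (0 / p + (Hu - Hu) - 0)"
      by (intro LIMSEQ_le_const) auto
    then show ?thesis by simp
  qed
  have "c \<ge> 0" using s_pos p_bounds by (simp add: c_def)
  show ?thesis
  proof (rule field_le_epsilon)
    fix e :: real assume e: "e > 0"
    have "energy u \<le> m + e / (c + 1) * c" using e \<open>c \<ge> 0\<close> by (intro bound) simp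
    also have "e / (c + 1) * c \<le> e" using e \<open>c \<ge> 0\<close> by (simp add: field_simps)
    finally show "energy u \<le> m + e" by simp
  qed
qed

text \<open>The minimizing sequence is taken among test functions, to which the compactness results
  apply; their infimum is a lower bound on all of \<open>H10\<close> by density.\<close>

theorem minimizer_exists:
  assumes w: wlsc
  obtains u where "u \<in> H10 \<Omega>" "\<And>v. v \<in> H10 \<Omega> \<Longrightarrow> energy u \<le> energy v"
proof -
  obtain C where C: "\<And>u. u \<in> H10 \<Omega> \<Longrightarrow> energy u \<ge> a / 4 * sqnorm \<Omega> (wg u) - C"
    by (rule energy_coercive[OF w], rule that)
  have lb: "- C \<le> energy \<phi>" if "\<phi> \<in> TF" for \<phi>
  proof -
    have "0 \<le> a / 4 * sqnorm \<Omega> (wg \<phi>)" using ab by simp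
    then show ?thesis using C[OF test_H10(1)[OF that]] by linarith
  qed
  define m where "m = Inf (energy ` TF)"
  have bdd: "bdd_below (energy ` TF)" by (rule bdd_belowI[of _ "- C"]) (use lb in auto)
  have m: "m \<le> energy \<phi>" if "\<phi> \<in> TF" for \<phi>
    unfolding m_def by (rule cInf_lower[OF _ bdd]) (use that in auto)
  have "\<exists>\<phi>\<in>TF. energy \<phi> < m + 1 / real (Suc n)" for n
  proof -
    have "Inf (energy ` TF) < m + 1 / real (Suc n)" unfolding m_def by simp
    then show ?thesis using cInf_lessD[of "energy ` TF"] test_functions_nonempty by blast
  qed
  then obtain \<phi> where \<phi>: "\<And>n. \<phi> n \<in> TF" "\<And>n. energy (\<phi> n) < m + 1 / real (Suc n)" by metis
  have Em: "(\<lambda>n. energy (\<phi> n)) \<longlonglongrightarrow> m"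
  proof (rule tendsto_sandwich[OF _ _ tendsto_const])
    have "(\<lambda>n. m + 1 / real (Suc n)) \<longlonglongrightarrow> m + 0" by (intro tendsto_intros LIMSEQ_Suc lim_1_over_n)
    then show "(\<lambda>n. m + 1 / real (Suc n)) \<longlonglongrightarrow> m" by simp
  qed (use m \<phi> in \<open>auto intro!: always_eventually less_imp_le\<close>)
  define R where "R = 4 * (m + 1 + C) / a"
  have R: "sqnorm \<Omega> (cg (\<phi> n)) \<le> R" for n
  proof -
    have "1 / real (Suc n) \<le> 1" by simp
    then have "a / 4 * sqnorm \<Omega> (cg (\<phi> n)) \<le> m + 1 + C"
      using C[OF test_H10(1)[OF \<phi>(1)[of n]]] \<phi>(2)[of n] unfolding test_wg_sqnorm[OF \<phi>(1)] by linarith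
    then show ?thesis using ab by (simp add: R_def field_simps)
  qed
  obtain r u where r: "strict_mono r" and u: "u \<in> H10 \<Omega>" 
    and L2lim: "(\<lambda>n. sqnorm \<Omega> (\<lambda>x. u x - \<phi> (r n) x)) \<longlonglongrightarrow> 0"
    and weak: "(\<lambda>n. ip \<Omega> (cg (\<phi> (r n))) (wg u)) \<longlonglongrightarrow> sqnorm \<Omega> (wg u)"
    by (rule weak_compactness[of \<phi> R, OF \<phi>(1) R], rule that)
  obtain r' :: "nat \<Rightarrow> nat" where r': "strict_mono r'" "AE x in M. (\<lambda>n. \<phi> (r (r' n)) x) \<longlonglongrightarrow> u x"
    by (rule L2_subseq_AE[of "\<lambda>n. \<phi> (r n)" \<Omega> u, OF test_L2(1)[OF \<phi>(1)] H10_L2(1)[OF open_domain u] L2lim], rule that)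
  have "energy u \<le> m"
  proof (rule energy_lsc[of "\<lambda>n. \<phi> (r (r' n))" R])
    show "(\<lambda>n. sqnorm \<Omega> (\<lambda>x. u x - \<phi> (r (r' n)) x)) \<longlonglongrightarrow> 0"
      using LIMSEQ_subseq_LIMSEQ[OF L2lim r'(1)] by (simp add: o_def)
    show "(\<lambda>n. ip \<Omega> (cg (\<phi> (r (r' n)))) (wg u)) \<longlonglongrightarrow> sqnorm \<Omega> (wg u)"
      using LIMSEQ_subseq_LIMSEQ[OF weak r'(1)] by (simp add: o_def)
    show "(\<lambda>n. energy (\<phi> (r (r' n)))) \<longlonglongrightarrow> m"
      using LIMSEQ_subseq_LIMSEQ[OF Em strict_mono_o[OF r r'(1)]] by (simp add: o_def)
  qed (use w \<phi> R u r' in auto)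
  then have "energy u \<le> energy v" if "v \<in> H10 \<Omega>" for v
    using energy_lower_bound_from_tests[OF m that] by linarith
  with u show ?thesis by (rule that)
qed

end

subsection \<open>Critical points\<close>

text \<open>The mean value theorem bounds the difference quotients by \<open>w\<close>, so dominated
  convergence applies along every sequence of increments.\<close>

lemma DERIV_integral_dominated:
  fixes f f' :: "real \<Rightarrow> 'a \<Rightarrow> real"
  assumes int: "\<And>t. integrable M (f t)" and meas: "f' t0 \<in> borel_measurable M"
    and der: "\<And>t x. ((\<lambda>t. f t x) has_real_derivative f' t x) (at t)"
    and bound: "\<And>t x. \<bar>t - t0\<bar> \<le> 1 \<Longrightarrow> \<bar>f' t x\<bar> \<le> w x" and w: "integrable M w"
  shows "((\<lambda>t. \<integral>x. f t x \<partial>M) has_real_derivative (\<integral>x. f' t0 x \<partial>M)) (at t0)"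
  unfolding DERIV_def tendsto_at_iff_sequentially
proof (intro allI impI)
  fix X :: "nat \<Rightarrow> real" assume X: "\<forall>i. X i \<in> UNIV - {0}" "X \<longlonglongrightarrow> 0"
  have "eventually (\<lambda>i. \<bar>X i\<bar> < 1) sequentially"
    using order_tendstoD(2)[OF tendsto_rabs[OF X(2)], of 1] by simp
  then obtain N where N: "\<And>i. i \<ge> N \<Longrightarrow> \<bar>X i\<bar> < 1" by (auto simp: eventually_sequentially)
  \<comment> \<open>An initial segment is dropped so that all increments stay in the interval where
    \<open>w\<close> dominates the derivative.\<close>
  define Y where "Y i = X (i + N)" for i
  have Y: "Y i \<noteq> 0" "\<bar>Y i\<bar> < 1" for i using X(1) N[of "i + N"] by (auto simp: Y_def)
  have Y0: "Y \<longlonglongrightarrow> 0" unfolding Y_def by (rule LIMSEQ_ignore_initial_segment[OF X(2)])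
  have "(\<lambda>i. \<integral>x. (f (t0 + Y i) x - f t0 x) / Y i \<partial>M) \<longlonglongrightarrow> (\<integral>x. f' t0 x \<partial>M)"
  proof (rule integral_dominated_convergence[OF meas _ w])
    show "(\<lambda>x. (f (t0 + Y i) x - f t0 x) / Y i) \<in> borel_measurable M" for i
      using int[of "t0 + Y i"] int[of t0] by (intro borel_measurable_divide borel_measurable_diff) auto
    show "AE x in M. (\<lambda>i. (f (t0 + Y i) x - f t0 x) / Y i) \<longlonglongrightarrow> f' t0 x"
    proof (rule AE_I2)
      fix x
      have "((\<lambda>h. (f (t0 + h) x - f t0 x) / h) \<longlongrightarrow> f' t0 x) (at 0)"
        using der[of x t0] by (simp add: DERIV_def)
      then show "(\<lambda>i. (f (t0 + Y i) x - f t0 x) / Y i) \<longlonglongrightarrow> f' t0 x"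
        by (rule filterlim_compose) (use Y Y0 in \<open>auto simp: filterlim_at\<close>)
    qed
    show "AE x in M. norm ((f (t0 + Y i) x - f t0 x) / Y i) \<le> w x" for i
    proof (rule AE_I2)
      fix x
      have "norm (f (t0 + Y i) x - f t0 x) \<le> w x * norm (t0 + Y i - t0)"
      proof (rule field_differentiable_bound[of "cball t0 1"])
        show "((\<lambda>t. f t x) has_field_derivative f' z x) (at z within cball t0 1)" for z
          by (rule has_field_derivative_at_within[OF der])
        show "norm (f' z x) \<le> w x" if "z \<in> cball t0 1" for z
          using that bound[of z x] by (simp add: dist_real_def abs_minus_commute)
      qed (use Y(2)[of i] in \<open>auto simp: dist_real_def\<close>)
      then show "norm ((f (t0 + Y i) x - f t0 x) / Y i) \<le> w x"
        using Y(1)[of i] by (simp add: field_simps)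
    qed
  qed
  moreover have "(\<integral>x. (f (t0 + Y i) x - f t0 x) / Y i \<partial>M) = ((\<integral>x. f (t0 + Y i) x \<partial>M) - (\<integral>x. f t0 x \<partial>M)) / Y i" for i
    by (simp only: integral_divide_zero Bochner_Integration.integral_diff[OF int int])
  ultimately have "(\<lambda>i. ((\<integral>x. f (t0 + Y i) x \<partial>M) - (\<integral>x. f t0 x \<partial>M)) / Y i) \<longlonglongrightarrow> (\<integral>x. f' t0 x \<partial>M)"
    by (simp only:)
  then have "(\<lambda>i. ((\<integral>x. f (t0 + X (i + N)) x \<partial>M) - (\<integral>x. f t0 x \<partial>M)) / X (i + N)) \<longlonglongrightarrow> (\<integral>x. f' t0 x \<partial>M)"
    unfolding Y_def .
  then show "((\<lambda>h. ((\<integral>x. f (t0 + h) x \<partial>M) - (\<integral>x. f t0 x \<partial>M)) / h) \<circ> X) \<longlonglongrightarrow> (\<integral>x. f' t0 x \<partial>M)"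
    unfolding o_def by (rule LIMSEQ_offset)
qed

lemma DERIV_abs_powr:
  fixes r x :: real
  assumes r: "r > 1"
  shows "((\<lambda>x. \<bar>x\<bar> powr r) has_real_derivative r * (\<bar>x\<bar> powr (r - 2) * x)) (at x)"
proof (cases x "0::real" rule: linorder_cases)
  case less
  have "((\<lambda>x. (- x) powr r) has_real_derivative r * (- x) powr (r - 1) * (- 1)) (at x)"
    using less by (intro DERIV_chain2[OF has_real_derivative_powr]) (auto intro!: derivative_eq_intros)
  moreover have "(- x) powr (r - 1) = (- x) powr (r - 2) * (- x)"
    using less powr_add[of "- x" "r - 2" 1] by simp
  ultimately have "((\<lambda>x. (- x) powr r) has_real_derivative r * (\<bar>x\<bar> powr (r - 2) * x)) (at x)"
    using less by simp
  then show ?thesis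
    by (rule DERIV_cong_ev[OF refl _ refl, THEN iffD1, rotated])
       (use less in \<open>auto intro!: eventually_mono[OF eventually_nhds_in_open[of "{..<0}"]]\<close>)
next
  case equal
  have "((\<lambda>h::real. \<bar>h\<bar> powr r / h) \<longlongrightarrow> 0) (at 0)"
  proof (rule Lim_null_comparison)
    show "\<forall>\<^sub>F h in at (0::real). norm (\<bar>h\<bar> powr r / h) \<le> \<bar>h\<bar> powr (r - 1)"
      by (rule always_eventually) (auto simp: powr_diff)
    have "((\<lambda>h::real. \<bar>h\<bar> powr (r - 1)) \<longlongrightarrow> \<bar>0\<bar> powr (r - 1)) (at 0)"
      using r by (intro tendsto_powr' tendsto_rabs tendsto_ident_at tendsto_const) auto
    then show "((\<lambda>h::real. \<bar>h\<bar> powr (r - 1)) \<longlongrightarrow> 0) (at 0)" by simp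
  qed
  with equal show ?thesis by (simp add: has_field_derivative_iff)
next
  case greater
  have "((\<lambda>x. x powr r) has_real_derivative r * x powr (r - 1)) (at x)"
    using greater by (rule has_real_derivative_powr)
  moreover have "x powr (r - 1) = x powr (r - 2) * x"
    using greater powr_add[of x "r - 2" 1] by simp
  ultimately have "((\<lambda>x. x powr r) has_real_derivative r * (\<bar>x\<bar> powr (r - 2) * x)) (at x)"
    using greater by simp
  then show ?thesis
    by (rule DERIV_cong_ev[OF refl _ refl, THEN iffD1, rotated])
       (use greater in \<open>auto intro!: eventually_mono[OF eventually_nhds_in_open[of "{0<..}"]]\<close>)
qed

text \<open>The exponent \<open>q\<close> may be at most 1, so |x|^q alone need not be
  differentiable at 0. Away from 0 the function is written as |x|^(q+2) / x; at 0 its difference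
  quotient is |h|^q.\<close>

lemma DERIV_abs_powr_mult:
  fixes q x :: real
  assumes q: "q > 0"
  shows "((\<lambda>x. \<bar>x\<bar> powr q * x) has_real_derivative (q + 1) * \<bar>x\<bar> powr q) (at x)"
proof (cases "x = 0")
  case True
  have "((\<lambda>h::real. \<bar>h\<bar> powr q) \<longlongrightarrow> \<bar>0\<bar> powr q) (at 0)"
    using q by (intro tendsto_powr' tendsto_rabs tendsto_ident_at tendsto_const) auto
  moreover have "\<forall>\<^sub>F h in at (0::real). \<bar>h\<bar> powr q = \<bar>h\<bar> powr q * h / h"
    unfolding eventually_at_filter by (rule always_eventually) simp
  ultimately have "((\<lambda>h::real. \<bar>h\<bar> powr q * h / h) \<longlongrightarrow> \<bar>0\<bar> powr q) (at 0)"
    by (rule Lim_transform_eventually)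
  with True show ?thesis by (simp add: has_field_derivative_iff)
next
  case False
  have "((\<lambda>x. \<bar>x\<bar> powr (q + 2) * inverse x) has_real_derivative
      (q + 2) * (\<bar>x\<bar> powr (q + 2 - 2) * x) * inverse x + - (inverse x ^ Suc (Suc 0)) * \<bar>x\<bar> powr (q + 2)) (at x)"
    using q False by (intro DERIV_mult DERIV_abs_powr DERIV_inverse) auto
  moreover have "(q + 2) * (\<bar>x\<bar> powr (q + 2 - 2) * x) * inverse x + - (inverse x ^ Suc (Suc 0)) * \<bar>x\<bar> powr (q + 2)
      = (q + 1) * \<bar>x\<bar> powr q"
    using False by (simp add: powr_add powr_numeral power2_eq_square field_simps)
  moreover have "(\<lambda>x. \<bar>x\<bar> powr (q + 2) * inverse x) = (\<lambda>x. \<bar>x\<bar> powr q * x)"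
  proof
    fix y :: real
    show "\<bar>y\<bar> powr (q + 2) * inverse y = \<bar>y\<bar> powr q * y"
      by (cases "y = 0") (auto simp: powr_add powr_numeral power2_eq_square)
  qed
  ultimately show ?thesis by (simp only:)
qed

lemma abs_powr_add_le:
  fixes x y p :: real
  assumes "p > 0" "\<bar>t\<bar> \<le> T"
  shows "\<bar>x + t * y\<bar> powr p \<le> (1 + T) powr p * (\<bar>x\<bar> powr p + \<bar>y\<bar> powr p)"
proof -
  define m where "m = max \<bar>x\<bar> \<bar>y\<bar>"
  have "\<bar>x + t * y\<bar> \<le> \<bar>x\<bar> + \<bar>t\<bar> * \<bar>y\<bar>" using abs_triangle_ineq[of x "t * y"] by (simp add: abs_mult)
  also have "\<dots> \<le> m + T * m" using assms by (intro add_mono mult_mono) (auto simp: m_def)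
  finally have "\<bar>x + t * y\<bar> powr p \<le> ((1 + T) * m) powr p"
    using assms by (intro powr_mono2) (auto simp: algebra_simps)
  also have "\<dots> = (1 + T) powr p * m powr p" by (rule powr_mult)
  also have "m powr p \<le> \<bar>x\<bar> powr p + \<bar>y\<bar> powr p" by (auto simp: m_def max_def)
  finally show ?thesis by (simp add: mult_left_mono)
qed

lemma abs_powr_mult_le:
  fixes x y p :: real
  assumes "0 \<le> r" "0 \<le> q" "r + q = p"
  shows "\<bar>x\<bar> powr r * \<bar>y\<bar> powr q \<le> \<bar>x\<bar> powr p + \<bar>y\<bar> powr p"
proof -
  define m where "m = max \<bar>x\<bar> \<bar>y\<bar>"
  have "\<bar>x\<bar> powr r * \<bar>y\<bar> powr q \<le> m powr r * m powr q"
    using assms by (intro mult_mono powr_mono2) (auto simp: m_def)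
  also have "\<dots> = m powr p" using assms by (simp add: powr_add[symmetric])
  also have "\<dots> \<le> \<bar>x\<bar> powr p + \<bar>y\<bar> powr p" by (auto simp: m_def max_def)
  finally show ?thesis .
qed

text \<open>Hoelder's inequality with exponents p/(p-2) and p/2: Young's inequality is applied
  pointwise after both integrals have been normalized to 1. A vanishing integral is a separate
  case.\<close>

lemma holder_square:
  fixes z v :: "'a \<Rightarrow> real"
  assumes p: "p > 2" and [measurable]: "z \<in> borel_measurable M" "v \<in> borel_measurable M"
    and int: "integrable M (\<lambda>x. \<bar>z x\<bar> powr p)" "integrable M (\<lambda>x. \<bar>v x\<bar> powr p)"
  shows "integrable M (\<lambda>x. \<bar>z x\<bar> powr (p - 2) * (v x)\<^sup>2)"
    "(\<integral>x. \<bar>z x\<bar> powr (p - 2) * (v x)\<^sup>2 \<partial>M)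
      \<le> (\<integral>x. \<bar>z x\<bar> powr p \<partial>M) powr (1 - 2 / p) * (\<integral>x. \<bar>v x\<bar> powr p \<partial>M) powr (2 / p)"
proof -
  have sq: "\<bar>y\<bar> powr 2 = y\<^sup>2" for y :: real by (cases "y = 0") (auto simp: powr_numeral)
  show i: "integrable M (\<lambda>x. \<bar>z x\<bar> powr (p - 2) * (v x)\<^sup>2)"
  proof (rule Bochner_Integration.integrable_bound[OF Bochner_Integration.integrable_add[OF int]])
    show "AE x in M. norm (\<bar>z x\<bar> powr (p - 2) * (v x)\<^sup>2) \<le> norm (\<bar>z x\<bar> powr p + \<bar>v x\<bar> powr p)"
    proof (rule AE_I2)
      fix x
      have "\<bar>z x\<bar> powr (p - 2) * \<bar>v x\<bar> powr 2 \<le> \<bar>z x\<bar> powr p + \<bar>v x\<bar> powr p"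
        using p by (intro abs_powr_mult_le) auto
      then show "norm (\<bar>z x\<bar> powr (p - 2) * (v x)\<^sup>2) \<le> norm (\<bar>z x\<bar> powr p + \<bar>v x\<bar> powr p)"
        by (simp add: sq)
    qed
  qed measurable
  define X where "X = (\<integral>x. \<bar>z x\<bar> powr p \<partial>M)"
  define Y where "Y = (\<integral>x. \<bar>v x\<bar> powr p \<partial>M)"
  have XY: "X \<ge> 0" "Y \<ge> 0" by (auto simp: X_def Y_def)
  show "(\<integral>x. \<bar>z x\<bar> powr (p - 2) * (v x)\<^sup>2 \<partial>M) \<le> X powr (1 - 2 / p) * Y powr (2 / p)"
  proof (cases "X = 0 \<or> Y = 0")
    case True
    then have "AE x in M. \<bar>z x\<bar> powr (p - 2) * (v x)\<^sup>2 = 0"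
    proof
      assume "X = 0"
      then have "AE x in M. \<bar>z x\<bar> powr p = 0"
        unfolding X_def using integral_nonneg_eq_0_iff_AE[OF int(1)] by simp
      then show ?thesis by eventually_elim simp
    next
      assume "Y = 0"
      then have "AE x in M. \<bar>v x\<bar> powr p = 0"
        unfolding Y_def using integral_nonneg_eq_0_iff_AE[OF int(2)] by simp
      then show ?thesis by eventually_elim simp
    qed
    then have "(\<integral>x. \<bar>z x\<bar> powr (p - 2) * (v x)\<^sup>2 \<partial>M) = 0" by (rule integral_eq_zero_AE)
    then show ?thesis by simp
  next
    case False
    with XY have XY: "X > 0" "Y > 0" by auto
    define \<theta> where "\<theta> = 2 / p"
    have \<theta>: "0 \<le> \<theta>" "0 \<le> 1 - \<theta>" "p * \<theta> = 2" "p * (1 - \<theta>) = p - 2" using p by (auto simp: \<theta>_def field_simps)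
    define k where "k = X powr (1 - \<theta>) * Y powr \<theta>"
    have k: "k > 0" using XY by (simp add: k_def)
    have "(\<integral>x. \<bar>z x\<bar> powr (p - 2) * (v x)\<^sup>2 \<partial>M)
      \<le> (\<integral>x. k * ((1 - \<theta>) / X * \<bar>z x\<bar> powr p + \<theta> / Y * \<bar>v x\<bar> powr p) \<partial>M)"
    proof (rule integral_mono[OF i])
      show "integrable M (\<lambda>x. k * ((1 - \<theta>) / X * \<bar>z x\<bar> powr p + \<theta> / Y * \<bar>v x\<bar> powr p))"
        using int by (intro integrable_mult_right Bochner_Integration.integrable_add)
      fix x
      show "\<bar>z x\<bar> powr (p - 2) * (v x)\<^sup>2 \<le> k * ((1 - \<theta>) / X * \<bar>z x\<bar> powr p + \<theta> / Y * \<bar>v x\<bar> powr p)"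
      proof (cases "z x = 0 \<or> v x = 0")
        case True
        moreover have "0 \<le> k * ((1 - \<theta>) / X * \<bar>z x\<bar> powr p + \<theta> / Y * \<bar>v x\<bar> powr p)"
          using k \<theta> XY by (intro mult_nonneg_nonneg add_nonneg_nonneg) auto
        ultimately show ?thesis by auto
      next
        case False
        have "(\<bar>z x\<bar> powr p / X) powr (1 - \<theta>) * (\<bar>v x\<bar> powr p / Y) powr \<theta> \<le> (1 - \<theta>) * (\<bar>z x\<bar> powr p / X) + \<theta> * (\<bar>v x\<bar> powr p / Y)"
          using \<theta> False XY by (intro Youngs_inequality_0) auto
        moreover have "(\<bar>z x\<bar> powr p / X) powr (1 - \<theta>) * (\<bar>v x\<bar> powr p / Y) powr \<theta> = \<bar>z x\<bar> powr (p - 2) * (v x)\<^sup>2 / k"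
          using XY by (simp add: powr_divide powr_powr \<theta> k_def sq)
        ultimately have "\<bar>z x\<bar> powr (p - 2) * (v x)\<^sup>2 / k \<le> (1 - \<theta>) / X * \<bar>z x\<bar> powr p + \<theta> / Y * \<bar>v x\<bar> powr p" by simp
        then show ?thesis using k by (simp add: pos_divide_le_eq mult.commute)
      qed
    qed
    also have "\<dots> = k * ((1 - \<theta>) / X * X + \<theta> / Y * Y)" using int by (simp add: X_def Y_def)
    also have "\<dots> = k" using XY by simp
    finally show ?thesis by (simp add: k_def \<theta>_def)
  qed
qed

section \<open>First variation of the energy and uniqueness\<close>

context kirchhoff
begin

lemma line_H10:
  assumes u: "u \<in> H10 \<Omega>" and v: "v \<in> H10 \<Omega>"
  defines "z \<equiv> \<lambda>t x. u x + t * v x"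
  shows "z t \<in> H10 \<Omega>"
    "sqnorm \<Omega> (wg (z t)) = sqnorm \<Omega> (wg u) + 2 * t * ip \<Omega> (wg u) (wg v) + t\<^sup>2 * sqnorm \<Omega> (wg v)"
    "ip \<Omega> (wg (z t)) (wg v) = ip \<Omega> (wg u) (wg v) + t * sqnorm \<Omega> (wg v)"
    "integrable M (\<lambda>x. \<bar>z t x\<bar> powr p)" "z t \<in> borel_measurable M"
proof -
  note L = H10_L2[OF open_domain u] H10_L2[OF open_domain v]
  note lc = H10_linear_combination[OF open_domain u v, of 1 t]
  show zH: "z t \<in> H10 \<Omega>" using lc(1) by (simp add: z_def)
  have ae: "AE x in M. wg (z t) x = 1 *\<^sub>R wg u x + t *\<^sub>R wg v x" using lc(2) by (simp add: z_def)
  note cL = L2_linear_combination[OF L(2) L(4), of 1 t]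
  show "sqnorm \<Omega> (wg (z t)) = sqnorm \<Omega> (wg u) + 2 * t * ip \<Omega> (wg u) (wg v) + t\<^sup>2 * sqnorm \<Omega> (wg v)"
    unfolding sqnorm_cong_AE[OF open_domain cL ae] sqnorm_linear_combination[OF L(2) L(4)] by simp
  have "ip \<Omega> (wg (z t)) (wg v) = ip \<Omega> (\<lambda>x. 1 *\<^sub>R wg u x + t *\<^sub>R wg v x) (wg v)"
  proof (rule integral_cong_AE)
    show "AE x in M. wg (z t) x \<bullet> wg v x = (1 *\<^sub>R wg u x + t *\<^sub>R wg v x) \<bullet> wg v x" using ae by eventually_elim simp
    show "(\<lambda>x. wg (z t) x \<bullet> wg v x) \<in> borel_measurable M"
      by (intro borel_measurable_inner L2_D(1) L H10_L2[OF open_domain zH])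
    show "(\<lambda>x. (1 *\<^sub>R wg u x + t *\<^sub>R wg v x) \<bullet> wg v x) \<in> borel_measurable M"
      by (intro borel_measurable_inner L2_D(1) L cL)
  qed
  then show "ip \<Omega> (wg (z t)) (wg v) = ip \<Omega> (wg u) (wg v) + t * sqnorm \<Omega> (wg v)"
    unfolding ip_linear_combination_left[OF L(2) L(4) L(4)] ip_self by simp
  show "integrable M (\<lambda>x. \<bar>z t x\<bar> powr p)" by (rule powr_integrable[OF zH])
  show "z t \<in> borel_measurable M" by (rule L2_D(1)[OF H10_L2(1)[OF open_domain zH]])
qed

text \<open>One majorant for both differentiations under the integral: q = 1 for the energy, q = 2
  for its derivative.\<close>

lemma line_dominated:
  fixes x y :: real
  assumes "\<bar>t - t0\<bar> \<le> 1" "0 \<le> q" "q \<le> p"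
  shows "\<bar>x + t * y\<bar> powr (p - q) * \<bar>y\<bar> powr q
    \<le> ((2 + \<bar>t0\<bar>) powr p + 1) * (\<bar>x\<bar> powr p + \<bar>y\<bar> powr p)"
proof -
  have "\<bar>x + t * y\<bar> powr (p - q) * \<bar>y\<bar> powr q \<le> \<bar>x + t * y\<bar> powr p + \<bar>y\<bar> powr p"
    using assms by (intro abs_powr_mult_le) auto
  also have "\<bar>x + t * y\<bar> powr p \<le> (1 + (1 + \<bar>t0\<bar>)) powr p * (\<bar>x\<bar> powr p + \<bar>y\<bar> powr p)"
    using assms p_bounds by (intro abs_powr_add_le) auto
  finally have 1: "\<bar>x + t * y\<bar> powr (p - q) * \<bar>y\<bar> powr q \<le> (1 + (1 + \<bar>t0\<bar>)) powr p * (\<bar>x\<bar> powr p + \<bar>y\<bar> powr p) + \<bar>y\<bar> powr p" by simp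
  have "\<bar>y\<bar> powr p \<le> \<bar>x\<bar> powr p + \<bar>y\<bar> powr p" by simp
  moreover have "((2 + \<bar>t0\<bar>) powr p + 1) * (\<bar>x\<bar> powr p + \<bar>y\<bar> powr p)
    = (1 + (1 + \<bar>t0\<bar>)) powr p * (\<bar>x\<bar> powr p + \<bar>y\<bar> powr p) + (\<bar>x\<bar> powr p + \<bar>y\<bar> powr p)"
    by (simp add: distrib_right)
  ultimately show ?thesis using 1 by linarith
qed

lemma energy_line_derivative:
  assumes u: "u \<in> H10 \<Omega>" and v: "v \<in> H10 \<Omega>"
  shows "((\<lambda>t. energy (\<lambda>x. u x + t * v x)) has_real_derivative
     (a + b * sqnorm \<Omega> (wg u)) * ip \<Omega> (wg u) (wg v)
       - (\<integral>x. \<bar>u x\<bar> powr (p - 2) * u x * v x \<partial>M) - (\<integral>x. h x * v x \<partial>M)) (at 0)"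
proof -
  define A B C where "A = sqnorm \<Omega> (wg u)" and "B = ip \<Omega> (wg u) (wg v)" and "C = sqnorm \<Omega> (wg v)"
  note line = line_H10[OF u v]
  note [measurable] = L2_D(1)[OF H10_L2(1)[OF open_domain u]] L2_D(1)[OF H10_L2(1)[OF open_domain v]]
  have "((\<lambda>t. \<integral>x. \<bar>u x + t * v x\<bar> powr p \<partial>M) has_real_derivative
      (\<integral>x. p * (\<bar>u x + 0 * v x\<bar> powr (p - 2) * (u x + 0 * v x)) * v x \<partial>M)) (at 0)"
  proof (rule DERIV_integral_dominated)
    show "integrable M (\<lambda>x. \<bar>u x + t * v x\<bar> powr p)" for t by (rule line(4))
    show "((\<lambda>t. \<bar>u x + t * v x\<bar> powr p) has_real_derivative p * (\<bar>u x + t * v x\<bar> powr (p - 2) * (u x + t * v x)) * v x) (at t)" for t x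
      using p_bounds by (intro DERIV_chain2[OF DERIV_abs_powr]) (auto intro!: derivative_eq_intros)
    show "integrable M (\<lambda>x. p * (((2 + \<bar>0\<bar>) powr p + 1) * (\<bar>u x\<bar> powr p + \<bar>v x\<bar> powr p)))"
      using powr_integrable[OF u] powr_integrable[OF v] by simp
    fix t x :: real and y assume t: "\<bar>t - 0\<bar> \<le> 1"
    have e: "\<bar>w\<bar> powr (p - 2) * \<bar>w\<bar> = \<bar>w\<bar> powr (p - 1)" for w :: real
      using powr_add[of "\<bar>w\<bar>" "p - 2" 1] by simp
    have "\<bar>p * (\<bar>u y + t * v y\<bar> powr (p - 2) * (u y + t * v y)) * v y\<bar> = p * (\<bar>u y + t * v y\<bar> powr (p - 1) * \<bar>v y\<bar> powr 1)"
      using p_bounds by (simp add: abs_mult e)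
    also have "\<dots> \<le> p * (((2 + \<bar>0\<bar>) powr p + 1) * (\<bar>u y\<bar> powr p + \<bar>v y\<bar> powr p))"
      using line_dominated[OF t, of 1 "u y" "v y"] p_bounds by (intro mult_left_mono) auto
    finally show "\<bar>p * (\<bar>u y + t * v y\<bar> powr (p - 2) * (u y + t * v y)) * v y\<bar>
        \<le> p * (((2 + \<bar>0\<bar>) powr p + 1) * (\<bar>u y\<bar> powr p + \<bar>v y\<bar> powr p))" .
  qed measurable
  also have "(\<integral>x. p * (\<bar>u x + 0 * v x\<bar> powr (p - 2) * (u x + 0 * v x)) * v x \<partial>M)
      = p * (\<integral>x. \<bar>u x\<bar> powr (p - 2) * u x * v x \<partial>M)"
    by (simp add: mult.assoc)
  finally have P: "((\<lambda>t. \<integral>x. \<bar>u x + t * v x\<bar> powr p \<partial>M) has_real_derivative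
      p * (\<integral>x. \<bar>u x\<bar> powr (p - 2) * u x * v x \<partial>M)) (at 0)" .
  have H: "(\<integral>x. h x * (u x + t * v x) \<partial>M) = (\<integral>x. h x * u x \<partial>M) + t * (\<integral>x. h x * v x \<partial>M)" for t
    using L2_inner_integrable[OF h_L2 H10_L2(1)[OF open_domain u]] L2_inner_integrable[OF h_L2 H10_L2(1)[OF open_domain v]]
    by (simp add: distrib_left mult.left_commute)
  have E: "energy (\<lambda>x. u x + t * v x) = a / 2 * (A + 2 * t * B + t\<^sup>2 * C) + b / 4 * (A + 2 * t * B + t\<^sup>2 * C)\<^sup>2
     - (\<integral>x. \<bar>u x + t * v x\<bar> powr p \<partial>M) / p - ((\<integral>x. h x * u x \<partial>M) + t * (\<integral>x. h x * v x \<partial>M))" for t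
    unfolding energy_def line(2) H A_def B_def C_def ..
  show ?thesis
    unfolding E A_def[symmetric] B_def[symmetric] C_def[symmetric] using p_bounds
    by (auto intro!: derivative_eq_intros P simp: field_simps)
qed

theorem minimizer_weak_solution:
  assumes u: "u \<in> H10 \<Omega>" and min: "\<And>v. v \<in> H10 \<Omega> \<Longrightarrow> energy u \<le> energy v"
  shows "weak_solution \<Omega> a b h u"
  unfolding weak_solution_def H10_norm_eq p_def[symmetric]
proof (intro conjI ballI u)
  fix v assume v: "v \<in> H10 \<Omega>"
  have "(a + b * sqnorm \<Omega> (wg u)) * ip \<Omega> (wg u) (wg v)
       - (\<integral>x. \<bar>u x\<bar> powr (p - 2) * u x * v x \<partial>M) - (\<integral>x. h x * v x \<partial>M) = 0"
  proof (rule DERIV_local_min[OF energy_line_derivative[OF u v], of 1])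
    show "\<forall>y. \<bar>0 - y\<bar> < 1 \<longrightarrow> energy (\<lambda>x. u x + 0 * v x) \<le> energy (\<lambda>x. u x + y * v x)"
      using min line_H10(1)[OF u v] by simp
  qed simp
  then show "(a + b * sqnorm \<Omega> (wg u)) * ip \<Omega> (wg u) (wg v)
      = (\<integral>x. \<bar>u x\<bar> powr (p - 2) * u x * v x \<partial>M) + (\<integral>x. h x * v x \<partial>M)" by simp
qed

text \<open>On the segment from \<open>u\<close> to \<open>w\<close>, \<open>Q\<close> is the
  derivative of the energy without its linear part. Both ends being solutions, \<open>Q\<close>
  takes the same value there, whereas the strict inequality makes it strictly increasing unless the
  gradient norm of \<open>v\<close> vanishes.\<close>

theorem weak_solution_unique:
  assumes strict: "\<And>\<tau>. \<tau> \<ge> 0 \<Longrightarrow> a + b * \<tau> > (p - 1) * s * \<tau> powr (p / 2 - 1)"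
    and u: "weak_solution \<Omega> a b h u" and w: "weak_solution \<Omega> a b h w"
  shows "eq_ae \<Omega> w u"
proof -
  have uH: "u \<in> H10 \<Omega>" and wH: "w \<in> H10 \<Omega>" using u w by (auto simp: weak_solution_def)
  define v where "v x = w x + (- 1) * u x" for x
  have vH: "v \<in> H10 \<Omega>" using line_H10(1)[OF wH uH, of "- 1"] by (simp add: v_def[abs_def])
  define A B C where "A = sqnorm \<Omega> (wg u)" and "B = ip \<Omega> (wg u) (wg v)" and "C = sqnorm \<Omega> (wg v)"
  define z where "z t x = u x + t * v x" for t x
  have z_eq: "z t = (\<lambda>x. u x + t * v x)" for t by (simp add: z_def fun_eq_iff)
  have line: "z t \<in> H10 \<Omega>" "sqnorm \<Omega> (wg (z t)) = A + 2 * t * B + t\<^sup>2 * C"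
    "ip \<Omega> (wg (z t)) (wg v) = B + t * C" "integrable M (\<lambda>x. \<bar>z t x\<bar> powr p)" "z t \<in> borel_measurable M" for t
    unfolding A_def B_def C_def z_eq by (rule line_H10[OF uH vH])+
  note [measurable] = L2_D(1)[OF H10_L2(1)[OF open_domain uH]] L2_D(1)[OF H10_L2(1)[OF open_domain vH]]
  have z01: "z 0 = u" "z 1 = w" by (auto simp: z_def v_def)
  define F where "F t = (\<integral>x. \<bar>z t x\<bar> powr (p - 2) * z t x * v x \<partial>M)" for t
  define Q where "Q t = (a + b * (A + 2 * t * B + t\<^sup>2 * C)) * (B + t * C) - F t" for t
  have Q: "Q t = (\<integral>x. h x * v x \<partial>M)" if "weak_solution \<Omega> a b h (z t)" for t
  proof -
    have "(a + b * sqnorm \<Omega> (wg (z t))) * ip \<Omega> (wg (z t)) (wg v) = F t + (\<integral>x. h x * v x \<partial>M)"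
      using that vH unfolding weak_solution_def H10_norm_eq p_def[symmetric] F_def by blast
    then show ?thesis unfolding line(2) line(3) Q_def by linarith
  qed
  have Q01: "Q 0 = Q 1" using Q[of 0] Q[of 1] u w by (simp add: z01)
  have F: "(F has_real_derivative (p - 1) * (\<integral>x. \<bar>z t x\<bar> powr (p - 2) * (v x)\<^sup>2 \<partial>M)) (at t)" for t
  proof -
    have sq: "\<bar>y\<bar> powr 2 = y\<^sup>2" for y :: real by (cases "y = 0") (auto simp: powr_numeral)
    have e: "\<bar>y\<bar> powr (p - 2) * \<bar>y\<bar> = \<bar>y\<bar> powr (p - 1)" for y :: real
      using powr_add[of "\<bar>y\<bar>" "p - 2" 1] by simp
    have dom: "integrable M (\<lambda>x. c * (((2 + \<bar>t\<bar>) powr p + 1) * (\<bar>u x\<bar> powr p + \<bar>v x\<bar> powr p)))" for c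
      using powr_integrable[OF uH] powr_integrable[OF vH] by simp
    have "(F has_real_derivative (\<integral>x. (p - 1) * \<bar>z t x\<bar> powr (p - 2) * (v x) * v x \<partial>M)) (at t)"
      unfolding F_def
    proof (rule DERIV_integral_dominated[OF _ _ _ _ dom[of "p - 1"]])
      show "integrable M (\<lambda>x. \<bar>z t x\<bar> powr (p - 2) * z t x * v x)" for t
      proof (rule Bochner_Integration.integrable_bound[OF Bochner_Integration.integrable_add[OF line(4) powr_integrable[OF vH]]])
        show "AE x in M. norm (\<bar>z t x\<bar> powr (p - 2) * z t x * v x) \<le> norm (\<bar>z t x\<bar> powr p + \<bar>v x\<bar> powr p)"
        proof (rule AE_I2)
          fix x
          have "\<bar>z t x\<bar> powr (p - 1) * \<bar>v x\<bar> powr 1 \<le> \<bar>z t x\<bar> powr p + \<bar>v x\<bar> powr p"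
            using p_bounds by (intro abs_powr_mult_le) auto
          then show "norm (\<bar>z t x\<bar> powr (p - 2) * z t x * v x) \<le> norm (\<bar>z t x\<bar> powr p + \<bar>v x\<bar> powr p)"
            by (simp add: abs_mult e)
        qed
      qed (use line(5)[of t] in measurable)
      show "(\<lambda>x. (p - 1) * \<bar>z t x\<bar> powr (p - 2) * v x * v x) \<in> borel_measurable M"
        using line(5)[of t] by measurable
      show "((\<lambda>t. \<bar>z t x\<bar> powr (p - 2) * z t x * v x) has_real_derivative (p - 1) * \<bar>z t x\<bar> powr (p - 2) * v x * v x) (at t)" for t x
      proof -
        have "((\<lambda>t. u x + t * v x) has_real_derivative v x) (at t)" by (auto intro!: derivative_eq_intros)
        moreover have "((\<lambda>y. \<bar>y\<bar> powr (p - 2) * y) has_real_derivative (p - 2 + 1) * \<bar>z t x\<bar> powr (p - 2)) (at (u x + t * v x))"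
          unfolding z_def using p_bounds by (intro DERIV_abs_powr_mult) simp
        ultimately have "((\<lambda>t. \<bar>u x + t * v x\<bar> powr (p - 2) * (u x + t * v x)) has_real_derivative
            (p - 2 + 1) * \<bar>z t x\<bar> powr (p - 2) * v x) (at t)"
          by (rule DERIV_chain2[rotated])
        then show ?thesis unfolding z_def by (intro DERIV_cmult_right) simp
      qed
      fix t' x assume t': "\<bar>t' - t\<bar> \<le> 1"
      have "\<bar>(p - 1) * \<bar>z t' x\<bar> powr (p - 2) * v x * v x\<bar> = (p - 1) * (\<bar>u x + t' * v x\<bar> powr (p - 2) * \<bar>v x\<bar> powr 2)"
        using p_bounds unfolding sq by (simp add: abs_mult z_def power2_eq_square)
      also have "\<dots> \<le> (p - 1) * (((2 + \<bar>t\<bar>) powr p + 1) * (\<bar>u x\<bar> powr p + \<bar>v x\<bar> powr p))"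
        using line_dominated[OF t', of 2 "u x" "v x"] p_bounds by (intro mult_left_mono) auto
      finally show "\<bar>(p - 1) * \<bar>z t' x\<bar> powr (p - 2) * v x * v x\<bar> \<le> (p - 1) * (((2 + \<bar>t\<bar>) powr p + 1) * (\<bar>u x\<bar> powr p + \<bar>v x\<bar> powr p))" .
    qed
    then show ?thesis by (simp add: power2_eq_square mult.assoc)
  qed
  have C0: "C = 0"
  proof (rule ccontr)
    assume "C \<noteq> 0"
    then have C: "C > 0" by (simp add: C_def less_le)
    have "Q 0 < Q 1"
    proof (rule DERIV_pos_imp_increasing[of 0 1 Q])
      fix t :: real
      define D where "D = A + 2 * t * B + t\<^sup>2 * C"
      define I where "I = (\<integral>x. \<bar>z t x\<bar> powr (p - 2) * (v x)\<^sup>2 \<partial>M)"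
      have D0: "D \<ge> 0" unfolding D_def line(2)[symmetric] by simp
      \<comment> \<open>Hoelder, followed by the Sobolev inequality for \<open>z t\<close> and for
        \<open>v\<close>; the exponents of the two factors \<open>s\<close> add up to 1.\<close>
      have "I \<le> (\<integral>x. \<bar>z t x\<bar> powr p \<partial>M) powr (1 - 2 / p) * (\<integral>x. \<bar>v x\<bar> powr p \<partial>M) powr (2 / p)"
        unfolding I_def by (rule holder_square(2)[OF p_bounds(1) line(5) _ line(4) powr_integrable[OF vH]]) measurable
      also have "\<dots> \<le> (s * D powr (p / 2)) powr (1 - 2 / p) * (s * C powr (p / 2)) powr (2 / p)"
        using sobolev[OF line(1)[of t]] sobolev[OF vH] p_bounds
        by (intro mult_mono powr_mono2) (auto simp: s_def line(2) D_def C_def)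
      also have "\<dots> = (s powr (1 - 2 / p) * s powr (2 / p)) * (D powr (p / 2 - 1) * C)"
      proof -
        have "p / 2 * (1 - 2 / p) = p / 2 - 1" using p_bounds by (simp add: field_simps)
        then show ?thesis using C p_bounds by (simp add: powr_mult powr_powr diff_divide_distrib)
      qed
      also have "s powr (1 - 2 / p) * s powr (2 / p) = s" using s_pos by (simp add: powr_add[symmetric])
      finally have I: "(p - 1) * I \<le> (p - 1) * (s * (D powr (p / 2 - 1) * C))"
        using p_bounds by (intro mult_left_mono) auto
      have "((p - 1) * s * D powr (p / 2 - 1)) * C < (a + b * D) * C"
        using strict[OF D0] C by (rule mult_strict_right_mono)
      moreover have "(p - 1) * I \<le> ((p - 1) * s * D powr (p / 2 - 1)) * C" using I by (simp add: mult_ac)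
      \<comment> \<open>Differentiating the nonlocal coefficient contributes a square, which has the
        favourable sign.\<close>
      moreover have "0 \<le> b * (2 * B + 2 * t * C) * (B + t * C)"
      proof -
        have "b * (2 * B + 2 * t * C) * (B + t * C) = 2 * b * (B + t * C)\<^sup>2" by (simp add: power2_eq_square algebra_simps)
        moreover have "0 \<le> 2 * b * (B + t * C)\<^sup>2" using ab by simp
        ultimately show ?thesis by (simp only:)
      qed
      ultimately have pos: "0 < b * (2 * B + 2 * t * C) * (B + t * C) + (a + b * D) * C - (p - 1) * I" by linarith
      have "((\<lambda>t. (a + b * (A + 2 * t * B + t\<^sup>2 * C)) * (B + t * C)) has_real_derivative
          b * (2 * B + 2 * t * C) * (B + t * C) + (a + b * D) * C) (at t)"
        unfolding D_def by (auto intro!: derivative_eq_intros simp: algebra_simps)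
      from DERIV_diff[OF this F] have "(Q has_real_derivative b * (2 * B + 2 * t * C) * (B + t * C) + (a + b * D) * C - (p - 1) * I) (at t)"
        unfolding Q_def[abs_def] I_def by simp
      with pos show "\<exists>y. (Q has_real_derivative y) (at t) \<and> y > 0" by blast
    qed simp
    then show False using Q01 by simp
  qed
  \<comment> \<open>Poincare's inequality turns the vanishing gradient norm of \<open>v\<close> into
    \<open>v = 0\<close> almost everywhere.\<close>
  obtain P where P: "P > 0" "\<And>u. u \<in> H10 \<Omega> \<Longrightarrow> sqnorm \<Omega> u \<le> P * sqnorm \<Omega> (wg u)"
    using poincare by blast
  have "sqnorm \<Omega> v \<le> 0" using P(2)[OF vH] C0 by (simp add: C_def)
  then have "sqnorm \<Omega> v = 0" using sqnorm_nonneg[of \<Omega> v] by linarith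
  then have "AE x in M. (norm (v x))\<^sup>2 = 0"
    using integral_nonneg_eq_0_iff_AE[OF L2_D(2)[OF H10_L2(1)[OF open_domain vH]]] by simp
  then have "AE x in M. w x = u x" by eventually_elim (simp add: v_def)
  then show ?thesis by (simp add: eq_ae_def)
qed

end

theorem theorem1p2:
  fixes \<Omega> :: "(real^'n) set" and a b :: real and h :: "real^'n \<Rightarrow> real"
  assumes dim: "CARD('n) \<ge> 4"
    and domain: "open \<Omega>" "connected \<Omega>" "\<Omega> \<noteq> {}" "bounded \<Omega>"
    and ab: "a > 0" "b > 0"
    and h: "h \<in> Linfty \<Omega>" "AE x in lebesgue_on \<Omega>. h x > 0"
  shows "(a powr ((real CARD('n) - 4) / 2) * b \<ge> L_const CARD('n) (sobolev_const \<Omega>) \<longrightarrow>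
            (\<exists>u. weak_solution \<Omega> a b h u)) \<and>
         (a powr ((real CARD('n) - 4) / 2) * b > C_const CARD('n) (sobolev_const \<Omega>) \<longrightarrow>
            (\<exists>u. weak_solution \<Omega> a b h u \<and>
                 (\<forall>w. weak_solution \<Omega> a b h w \<longrightarrow> eq_ae \<Omega> w u)))"
proof -
  interpret kirchhoff \<Omega> a b h
    by unfold_locales (use assms in auto)
  have ex: "\<exists>u. weak_solution \<Omega> a b h u" if wlsc
    using minimizer_exists[OF that] minimizer_weak_solution by metis
  show ?thesis
  proof (intro conjI impI)
    assume L: "a powr ((real CARD('n) - 4) / 2) * b \<ge> L_const CARD('n) (sobolev_const \<Omega>)"
    have wlsc
      unfolding wlsc_def s_def p_def using L_const_inequality[OF dim ab S_pos _ L[folded S_def]] by blast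
    then show "\<exists>u. weak_solution \<Omega> a b h u" by (rule ex)
  next
    assume C: "a powr ((real CARD('n) - 4) / 2) * b > C_const CARD('n) (sobolev_const \<Omega>)"
    have strict: "a + b * \<tau> > (p - 1) * s * \<tau> powr (p / 2 - 1)" if "\<tau> \<ge> 0" for \<tau>
      unfolding s_def p_def by (rule C_const_inequality[OF dim ab S_pos that C[folded S_def]])
    have wlsc
      unfolding wlsc_def
      using strict_inequality_imp_weak[OF p_bounds less_imp_le[OF s_pos] ab _ strict] by blast
    then obtain u where "weak_solution \<Omega> a b h u" using ex by blast
    then show "\<exists>u. weak_solution \<Omega> a b h u \<and> (\<forall>w. weak_solution \<Omega> a b h w \<longrightarrow> eq_ae \<Omega> w u)"
      using weak_solution_unique[OF strict] by blast
  qed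
qed

end
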